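(* Let $m,n\ge1$ be coprime integers, $\alpha>m-1-\frac mn$, $\ell\ge1$ an integer, $0\le a_1<a_2<\dots<a_{2\ell}$, $a=(a_1,\dots,a_{2\ell})$ and $\widetilde J=\bigcup_{j=1}^{\ell}(a_{2j-1},a_{2j})$. The functions $x_{j,k},y_{j,k},u_j,v_j$ of $a$ ($0\le j\le m+n-1$, $1\le k\le 2\ell$) defined in the context satisfy the following system of coupled partial differential equations. (1) For $1\le k\ne i\le2\ell$ and $0\le j\le m+n-1$, $$\frac{\partial x_{j,k}}{\partial a_i}=(-1)^i\frac{x_{j,i}}{a_k-a_i}\sum_{l=0}^{m+n-1}x_{l,k}y_{l,i},\qquad \frac{\partial y_{j,k}}{\partial a_i}=(-1)^i\frac{y_{j,i}}{a_i-a_k}\sum_{l=0}^{m+n-1}x_{l,i}y_{l,k}.$$ (2) For $1\le k\le2\ell$ and $0\le j\le m+n-2$, $$a_k\frac{\partial x_{j,k}}{\partial a_k}=-v_jx_{0,k}-x_{j+1,k}-\sum_{i=1,i\ne k}^{2\ell}(-1)^i\frac{a_ix_{j,i}}{a_k-a_i}\sum_{l=0}^{m+n-1}x_{l,k}y_{l,i},$$ while for $j=m+n-1$ $$a_k\frac{\partial x_{m+n-1,k}}{\partial a_k}=\big((-1)^{n+1}a_k-v_{m+n-1}\big)x_{0,k}+\sum_{i=0}^{m+n-1}u_ix_{i,k}-\sum_{i=1,i\ne k}^{2\ell}(-1)^i\frac{a_ix_{m+n-1,i}}{a_k-a_i}\sum_{l=0}^{m+n-1}x_{l,k}y_{l,i}.$$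 (3) For $1\le k\le2\ell$ and $1\le j\le m+n-1$, $$a_k\frac{\partial y_{j,k}}{\partial a_k}=y_{j-1,k}-u_jy_{m+n-1,k}-\sum_{i=1,i\ne k}^{2\ell}(-1)^i\frac{a_iy_{j,i}}{a_i-a_k}\sum_{l=0}^{m+n-1}x_{l,i}y_{l,k},$$ while for $j=0$ $$a_k\frac{\partial y_{0,k}}{\partial a_k}=\sum_{i=0}^{m+n-1}v_iy_{i,k}+\big((-1)^na_k-u_0\big)y_{m+n-1,k}-\sum_{i=1,i\ne k}^{2\ell}(-1)^i\frac{a_iy_{0,i}}{a_i-a_k}\sum_{l=0}^{m+n-1}x_{l,i}y_{l,k}.$$ (4) For $1\le k\le2\ell$ and $0\le j\le m+n-1$, $$\frac{\partial u_j}{\partial a_k}=(-1)^{n+k}x_{0,k}y_{j,k},\qquad \frac{\partial v_j}{\partial a_k}=(-1)^{n+k}x_{j,k}y_{m+n-1,k}.$$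
   Context: Let $\nu_0=0$, $\nu_i=\frac in$ for $1\le i\le n-1$, $\nu_i=1-\frac\alpha m-\frac{i-n+1}m$ for $n\le i\le m+n-1$; let $b_0,\dots,b_{m+n-1}$ be defined by $\prod_{i=1}^{m+n-1}(x-\nu_i)=\sum_{i=0}^{m+n-1}b_ix^i$ and set $b_{-1}=0$. Write $\Delta_x=x\frac{d}{dx}$. Meijer G-function: for $1\le k\le q$, real $\beta_1,\dots,\beta_q$ and $z>0$, $G^{k,0}_{0,q}\big({-\atop\beta_1,\dots,\beta_q}\big|z\big)=\frac1{2\pi i}\int_\gamma\frac{\prod_{j=1}^k\Gamma(\beta_j+u)}{\prod_{j=k+1}^q\Gamma(1-\beta_j-u)}z^{-u}du$, where $\gamma$ has all poles of $\Gamma(\beta_j+u)$, $j\le k$, on its left (it may be taken as a loop starting and ending at $-\infty$ encircling all these poles once positively). Set $\widetilde f(x)=G^{m,0}_{0,m+n}\big({-\atop-\nu_{m+n-1},\dots,-\nu_1,\nu_0}\big|x\big)$, $\widetilde g(y)=G^{n,0}_{0,m+n}\big({-\atop\nu_0,\nu_1,\dots,\nu_{m+n-1}}\big|y\big)$ and, for $0\le i\le m+n-1$, $$\phi_i(x)=(-1)^{n+1-i}(\Delta_x)^i\widetilde f(x),\qquad \psi_i(y)=\sum_{j=0}^{m+n-1-i}b_{i+j}(\Delta_y)^j\widetilde g(y).$$ Let $\widetilde K(x,y)=\frac{\sum_{i=0}^{m+n-1}\phi_i(x)\psi_i(y)}{x-y}$ (extended by continuity to $x=y$). Let $\widetilde{\mathcal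 K}$ be the integral operator on functions on $(0,\infty)$ with kernel $\widetilde K(x,y)\chi_{\widetilde J}(y)$, and $\widetilde{\mathcal K}'$ the one with kernel $\widetilde K(y,x)\chi_{\widetilde J}(y)$; here $\chi_{\widetilde J}$ is the characteristic function. It is a standing fact that $I-\widetilde{\mathcal K}$ and $I-\widetilde{\mathcal K}'$ are invertible. Thus $\mathcal Q_j=(I-\widetilde{\mathcal K})^{-1}\phi_j$ is the solution of $\mathcal Q_j(x)-\int_{\widetilde J}\widetilde K(x,y)\mathcal Q_j(y)\,dy=\phi_j(x)$, and $\mathcal P_j=(I-\widetilde{\mathcal K}')^{-1}\psi_j$ is the solution of $\mathcal P_j(y)-\int_{\widetilde J}\widetilde K(x,y)\mathcal P_j(x)\,dx=\psi_j(y)$. For $0\le j\le m+n-1$, $1\le k\le2\ell$ define $$x_{j,k}=\mathcal Q_j(a_k),\qquad y_{j,k}=\mathcal P_j(a_k)$$ (understood as limits from inside $\widetilde J$), and $$u_j=(-1)^n\int_{\widetilde J}\phi_0(x)\mathcal P_j(x)\,dx+b_{j-1},\qquad v_j=(-1)^n\int_{\widetilde J}\phi_j(x)\mathcal P_{m+n-1}(x)\,dx.$$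
   Formalization: At a_1=0: if α<m-1 the limits x_{j,1} are infinite, and equations containing them (other than multiplied by a_1) are not asserted; a_1∂/∂a_1 is read as 0 there, so (2),(3) with k=1 say the right-hand side vanishes, without claiming the derivative exists. *)

theory Defs
  imports
    "HOL-Complex_Analysis.Complex_Analysis"
    "HOL-Computational_Algebra.Polynomial"
begin

section \<open>The Meijer G-function with parameters (k, 0; 0, q)\<close>

text \<open>
  The list \<open>\<beta>s\<close> holds \<open>\<beta>\<^sub>1, \<dots>, \<beta>\<^sub>q\<close>. A pole of a Gamma factor in the denominator makes
  the integrand vanish there, which is what division by \<open>Gamma\<close> (with value \<open>0\<close> at its poles)
  does.
\<close>

definition meijer_integrand :: "nat \<Rightarrow> real list \<Rightarrow> real \<Rightarrow> complex \<Rightarrow> complex" where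
  "meijer_integrand k \<beta>s z u =
     (\<Prod>\<beta>\<leftarrow>take k \<beta>s. Gamma (of_real \<beta> + u)) / (\<Prod>\<beta>\<leftarrow>drop k \<beta>s. Gamma (1 - of_real \<beta> - u))
       * of_real z powr (- u)"

text \<open>
  The poles of the integrand lie on the real axis, to the left of \<open>c\<close> below. As \<open>R\<close> tends to
  infinity the path becomes the loop that comes from \<open>-\<infinity>\<close> under the real axis, crosses it
  at \<open>c\<close>, and returns to \<open>-\<infinity>\<close> above it.
\<close>

definition meijer_path :: "nat \<Rightarrow> real list \<Rightarrow> real \<Rightarrow> real \<Rightarrow> complex" where
  "meijer_path k \<beta>s R =
     (let c = 1 + Max (uminus ` set (take k \<beta>s)) in
        linepath (Complex (- R) (- 1)) (Complex c (- 1)) +++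
        linepath (Complex c (- 1)) (Complex c 1) +++
        linepath (Complex c 1) (Complex (- R) 1))"

definition meijer_G :: "nat \<Rightarrow> real list \<Rightarrow> real \<Rightarrow> complex" where
  "meijer_G k \<beta>s z =
     1 / (2 * of_real pi * \<i>) *
       Lim at_top (\<lambda>R. contour_integral (meijer_path k \<beta>s R) (meijer_integrand k \<beta>s z))"


section \<open>The kernel\<close>

definition mb_nu :: "nat \<Rightarrow> nat \<Rightarrow> real \<Rightarrow> nat \<Rightarrow> real" where
  "mb_nu m n \<alpha> i =
     (if i < n then real i / real n
      else 1 - \<alpha> / real m - (real i - real n + 1) / real m)"

definition mb_b :: "nat \<Rightarrow> nat \<Rightarrow> real \<Rightarrow> nat \<Rightarrow> real" where
  "mb_b m n \<alpha> i = coeff (\<Prod>k = 1..m + n - 1. [:- mb_nu m n \<alpha> k, 1:]) i"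

text \<open>
  For real parameters and \<open>z > 0\<close> the loop and the integrand are symmetric under complex
  conjugation, so \<open>meijer_G\<close> is real there and taking \<open>Re\<close> only changes the type.
\<close>

definition mb_f :: "nat \<Rightarrow> nat \<Rightarrow> real \<Rightarrow> real \<Rightarrow> real" where
  "mb_f m n \<alpha> x =
     Re (meijer_G m (map (\<lambda>i. - mb_nu m n \<alpha> i) (rev [1..<m + n]) @ [mb_nu m n \<alpha> 0]) x)"

definition mb_g :: "nat \<Rightarrow> nat \<Rightarrow> real \<Rightarrow> real \<Rightarrow> real" where
  "mb_g m n \<alpha> y = Re (meijer_G n (map (mb_nu m n \<alpha>) [0..<m + n]) y)"

definition euler_op :: "(real \<Rightarrow> real) \<Rightarrow> real \<Rightarrow> real" where
  "euler_op h x = x * deriv h x"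

definition mb_phi :: "nat \<Rightarrow> nat \<Rightarrow> real \<Rightarrow> nat \<Rightarrow> real \<Rightarrow> real" where
  "mb_phi m n \<alpha> i x = (- 1) powi (int n + 1 - int i) * (euler_op ^^ i) (mb_f m n \<alpha>) x"

definition mb_psi :: "nat \<Rightarrow> nat \<Rightarrow> real \<Rightarrow> nat \<Rightarrow> real \<Rightarrow> real" where
  "mb_psi m n \<alpha> i y =
     (\<Sum>j<m + n - i. mb_b m n \<alpha> (i + j) * (euler_op ^^ j) (mb_g m n \<alpha>) y)"

definition mb_quot :: "nat \<Rightarrow> nat \<Rightarrow> real \<Rightarrow> real \<Rightarrow> real \<Rightarrow> real" where
  "mb_quot m n \<alpha> x y = (\<Sum>i<m + n. mb_phi m n \<alpha> i x * mb_psi m n \<alpha> i y) / (x - y)"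

definition mb_K :: "nat \<Rightarrow> nat \<Rightarrow> real \<Rightarrow> real \<Rightarrow> real \<Rightarrow> real" where
  "mb_K m n \<alpha> x y =
     (if x \<noteq> y then mb_quot m n \<alpha> x y
      else Lim (at (x, y) within {(s, t). 0 < s \<and> 0 < t \<and> s \<noteq> t}) (\<lambda>(s, t). mb_quot m n \<alpha> s t))"


section \<open>Integral operators on functions on \<open>(0, \<infinity>)\<close>\<close>

text \<open>
  The operator with kernel \<open>L x y * \<chi>\<^sub>J y\<close> acts on all functions on \<open>(0, \<infinity>)\<close> for which the
  defining integral converges absolutely at every \<open>x > 0\<close>. A function on \<open>(0, \<infinity>)\<close> is
  represented by its extensional (\<open>undefined\<close> elsewhere) extension to the reals.
\<close>

definition op_dom :: "(real \<Rightarrow> real \<Rightarrow> real) \<Rightarrow> real set \<Rightarrow> (real \<Rightarrow> real) set" where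
  "op_dom L J =
     {q \<in> extensional {0<..}. \<forall>x>0. set_integrable lborel J (\<lambda>y. L x y * q y)}"

definition id_minus_op :: "(real \<Rightarrow> real \<Rightarrow> real) \<Rightarrow> real set \<Rightarrow> (real \<Rightarrow> real) \<Rightarrow> real \<Rightarrow> real" where
  "id_minus_op L J q = (\<lambda>x\<in>{0<..}. q x - (LINT y:J|lborel. L x y * q y))"

definition id_minus_op_invertible :: "(real \<Rightarrow> real \<Rightarrow> real) \<Rightarrow> real set \<Rightarrow> bool" where
  "id_minus_op_invertible L J \<longleftrightarrow> bij_betw (id_minus_op L J) (op_dom L J) (op_dom L J)"

definition resolvent_op :: "(real \<Rightarrow> real \<Rightarrow> real) \<Rightarrow> real set \<Rightarrow> (real \<Rightarrow> real) \<Rightarrow> real \<Rightarrow> real" where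
  "resolvent_op L J h = inv_into (op_dom L J) (id_minus_op L J) (restrict h {0<..})"


section \<open>The functions of the endpoints\<close>

text \<open>
  A vector \<open>(a\<^sub>1, \<dots>, a\<^bsub>2p\<^esub>)\<close> is a function on the naturals of which only the values at
  \<open>1, \<dots>, 2p\<close> matter, where \<open>p\<close> is the number of intervals.
\<close>

definition endpoints :: "nat \<Rightarrow> (nat \<Rightarrow> real) set" where
  "endpoints p = {a. 0 \<le> a 1 \<and> (\<forall>i\<in>{1..<2 * p}. a i < a (i + 1))}"

definition mb_J :: "nat \<Rightarrow> (nat \<Rightarrow> real) \<Rightarrow> real set" where
  "mb_J p a = (\<Union>j\<in>{1..p}. {a (2 * j - 1)<..<a (2 * j)})"

definition mb_Q :: "nat \<Rightarrow> nat \<Rightarrow> real \<Rightarrow> nat \<Rightarrow> (nat \<Rightarrow> real) \<Rightarrow> nat \<Rightarrow> real \<Rightarrow> real" where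
  "mb_Q m n \<alpha> p a j = resolvent_op (mb_K m n \<alpha>) (mb_J p a) (mb_phi m n \<alpha> j)"

definition mb_P :: "nat \<Rightarrow> nat \<Rightarrow> real \<Rightarrow> nat \<Rightarrow> (nat \<Rightarrow> real) \<Rightarrow> nat \<Rightarrow> real \<Rightarrow> real" where
  "mb_P m n \<alpha> p a j = resolvent_op (\<lambda>y x. mb_K m n \<alpha> x y) (mb_J p a) (mb_psi m n \<alpha> j)"

definition mb_x :: "nat \<Rightarrow> nat \<Rightarrow> real \<Rightarrow> nat \<Rightarrow> nat \<Rightarrow> nat \<Rightarrow> (nat \<Rightarrow> real) \<Rightarrow> real" where
  "mb_x m n \<alpha> p j k a = Lim (at (a k) within mb_J p a) (mb_Q m n \<alpha> p a j)"

definition mb_y :: "nat \<Rightarrow> nat \<Rightarrow> real \<Rightarrow> nat \<Rightarrow> nat \<Rightarrow> nat \<Rightarrow> (nat \<Rightarrow> real) \<Rightarrow> real" where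
  "mb_y m n \<alpha> p j k a = Lim (at (a k) within mb_J p a) (mb_P m n \<alpha> p a j)"

definition mb_u :: "nat \<Rightarrow> nat \<Rightarrow> real \<Rightarrow> nat \<Rightarrow> nat \<Rightarrow> (nat \<Rightarrow> real) \<Rightarrow> real" where
  "mb_u m n \<alpha> p j a =
     (- 1) ^ n * (LINT x:mb_J p a|lborel. mb_phi m n \<alpha> 0 x * mb_P m n \<alpha> p a j x)
       + (if j = 0 then 0 else mb_b m n \<alpha> (j - 1))"

definition mb_v :: "nat \<Rightarrow> nat \<Rightarrow> real \<Rightarrow> nat \<Rightarrow> nat \<Rightarrow> (nat \<Rightarrow> real) \<Rightarrow> real" where
  "mb_v m n \<alpha> p j a =
     (- 1) ^ n * (LINT x:mb_J p a|lborel. mb_phi m n \<alpha> j x * mb_P m n \<alpha> p a (m + n - 1) x)"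


section \<open>Partial derivatives, and the degenerate endpoint \<open>a\<^sub>1 = 0\<close>\<close>

text \<open>
  The derivative is taken along the slice of \<open>endpoints p\<close> through \<open>a\<close> in direction \<open>i\<close>. This
  is the ordinary two-sided partial derivative, except for \<open>i = 1\<close> at \<open>a\<^sub>1 = 0\<close>, where it is the
  one from the right.
\<close>

definition has_partial :: "nat \<Rightarrow> ((nat \<Rightarrow> real) \<Rightarrow> real) \<Rightarrow> nat \<Rightarrow> real \<Rightarrow> (nat \<Rightarrow> real) \<Rightarrow> bool" where
  "has_partial p F i d a \<longleftrightarrow>
     ((\<lambda>t. F (a(i := t))) has_real_derivative d) (at (a i) within {t. a(i := t) \<in> endpoints p})"

text \<open>
  \<open>a\<^sub>k \<partial>F/\<partial>a\<^sub>k = e\<close>. At \<open>a\<^sub>k = 0\<close> the left-hand side is read as \<open>0\<close>: there \<open>F\<close> is in general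
  continuous but behaves like a fractional power of \<open>a\<^sub>k\<close>, so that \<open>\<partial>F/\<partial>a\<^sub>k\<close> itself is
  infinite while \<open>a\<^sub>k \<partial>F/\<partial>a\<^sub>k\<close> tends to \<open>0\<close> as \<open>a\<^sub>k\<close> does.
\<close>

definition has_euler_partial :: "nat \<Rightarrow> ((nat \<Rightarrow> real) \<Rightarrow> real) \<Rightarrow> nat \<Rightarrow> real \<Rightarrow> (nat \<Rightarrow> real) \<Rightarrow> bool" where
  "has_euler_partial p F k e a \<longleftrightarrow>
     (\<exists>d. (0 < a k \<longrightarrow> has_partial p F k d a) \<and> a k * d = e)"

text \<open>
  Near \<open>0\<close> the functions \<open>\<phi>\<^sub>j\<close> behave like multiples of \<open>x powr ((\<alpha> + 1) / m - 1)\<close>. Hence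
  if \<open>a\<^sub>1 = 0\<close> and \<open>\<alpha> < m - 1\<close>, the limits defining the \<open>x\<^bsub>j,1\<^esub>\<close> are infinite; an equation
  in which such an \<open>x\<^bsub>j,1\<^esub>\<close> occurs (other than multiplied by \<open>a\<^sub>1 = 0\<close>) is then meaningless.
\<close>

definition x_finite_at :: "nat \<Rightarrow> real \<Rightarrow> real \<Rightarrow> bool" where
  "x_finite_at m \<alpha> t \<longleftrightarrow> 0 < t \<or> real m - 1 \<le> \<alpha>"

end

theory Submission
  imports Defs "HOL-Real_Asymp.Real_Asymp"
begin

text \<open>
  Closing the contour to the left expands the two G-functions into Frobenius series, so that up to the
  weight \<open>w(x) = x\<^sup>-\<^sup>s\<close> the \<open>\<phi>\<^sub>i\<close> and \<open>\<psi>\<^sub>i\<close> are continuous on \<open>[0, \<infinity>)\<close>. Differentiating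
  \<open>\<Sum>\<^sub>i \<phi>\<^sub>i(tx) \<psi>\<^sub>i(ty)\<close> with respect to \<open>t\<close> shows that the kernel is, up to sign, the integral of
  \<open>\<phi>\<^sub>0(tx) \<psi>\<^sub>m\<^sub>+\<^sub>n\<^sub>-\<^sub>1(ty)\<close> over \<open>0 < t < 1\<close>, hence of the form \<open>w(x) k(x, y)\<close> with a continuous \<open>k\<close> whose
  Euler derivatives in \<open>x\<close> and \<open>y\<close> add up, modulo a multiple of \<open>k\<close>, to a function of rank one.

  The integral equations can therefore be solved in the space of bounded continuous functions with the
  finite measure \<open>\<chi>\<^sub>J w dy\<close>. Pairing the solution for perturbed endpoints with the solution of the
  transposed equation for the original ones gives an exact formula for the difference of two
  solutions, and with it the derivatives with respect to the endpoints. The resolvent kernel again has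
  the integrable form \<open>(x - y) R(x, y) = \<Sum>\<^sub>l Q\<^sub>l(x) P\<^sub>l(y)\<close> up to the weight. Integration by parts yields
  the Euler derivatives of the solutions, and the chain rule the remaining equations.
\<close>

section \<open>Injective compact perturbations of the identity\<close>

text \<open>The hypothesis of invertibility is weak: it is bijectivity on a space of functions
  without topology, for each endpoint vector separately, so neither a bounded inverse nor continuity
  in \<open>a\<close> comes with it. Compactness recovers a bounded inverse from uniqueness, and
  continuity in \<open>a\<close> is obtained from an exact comparison of two measures instead of a
  Neumann series. The other obstacle is the point 0, where the weight may be unbounded and
  \<open>a 1\<close> may lie. Hence the weight is moved from the kernel into the measure, and
  derivatives are replaced by Euler derivatives \<open>x h'(x)\<close>, which stay continuous at 0.
  The exponent \<open>s\<close> bounds the order of the singularity of the \<open>\<phi>\<close>;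
  the hypothesis on \<alpha> makes it smaller than \<open>1/n\<close>, the step between the leading
  exponents of \<open>mb_g\<close>. This gives both the integrability of the weight and the
  vanishing of the boundary term at \<open>t = 0\<close> in the integral formula for the
  kernel.\<close>

lemma riesz_almost_orthogonal:
  fixes U :: "'a::real_normed_vector set"
  assumes "subspace U" "closed U" "subspace V" "U \<subseteq> V" "v \<in> V" "v \<notin> U"
  obtains e where "e \<in> V" "norm e = 1" "\<And>z. z \<in> U \<Longrightarrow> 1/2 \<le> norm (e - z)"
proof -
  have ne: "U \<noteq> {}" using assms(1) subspace_0 by blast
  define d where "d = infdist v U"
  have "d > 0"
    using infdist_nonneg[of v U] in_closed_iff_infdist_zero[OF assms(2) ne, of v] assms(6)
    by (simp add: d_def less_le)
  \<comment> \<open>A nearest point of \<open>U\<close> need not exist. A point within twice the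
    infimum is enough, and this factor is the origin of 1/2.\<close>
  then have "\<exists>z\<in>U. dist v z < 2 * d"
    using cINF_less_iff[of U "dist v" "2 * d"] ne by (auto simp: d_def infdist_notempty)
  then obtain z where z: "z \<in> U" "dist v z < 2 * d" by blast
  define c where "c = norm (v - z)"
  have c: "c > 0" using z(1) assms(6) by (auto simp: c_def)
  show ?thesis
  proof
    show "(1/c) *\<^sub>R (v - z) \<in> V"
      using assms z by (intro subspace_scale subspace_diff) auto
    show "norm ((1/c) *\<^sub>R (v - z)) = 1" using c by (simp add: c_def)
    fix y assume y: "y \<in> U"
    have "z + c *\<^sub>R y \<in> U" using assms(1) z(1) y by (intro subspace_add subspace_scale)
    then have "d \<le> dist v (z + c *\<^sub>R y)" unfolding d_def by (rule infdist_le)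
    also have "v - (z + c *\<^sub>R y) = c *\<^sub>R ((1/c) *\<^sub>R (v - z) - y)"
      using c by (simp add: algebra_simps)
    then have "dist v (z + c *\<^sub>R y) = c * norm ((1/c) *\<^sub>R (v - z) - y)"
      using c by (simp add: dist_norm)
    finally have "d \<le> c * norm ((1/c) *\<^sub>R (v - z) - y)" .
    moreover have "c < 2 * d" using z(2) by (simp add: c_def dist_norm)
    ultimately have "c * (1/2) \<le> c * norm ((1/c) *\<^sub>R (v - z) - y)" by linarith
    then show "1/2 \<le> norm ((1/c) *\<^sub>R (v - z) - y)" using c by simp
  qed
qed

text \<open>Half of the Fredholm alternative: injectivity of the identity minus \<open>T\<close>
  implies that it is onto with bounded inverse. Compactness is stated by sequences, the form in
  which Arzela-Ascoli delivers it.\<close>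

locale compact_perturbation =
  fixes T :: "'a::{real_normed_vector,complete_space} \<Rightarrow> 'a"
  assumes blin: "bounded_linear T"
    and compact: "\<And>X :: nat \<Rightarrow> 'a. bounded (range X) \<Longrightarrow>
        \<exists>l r. strict_mono r \<and> (\<lambda>i. T (X (r i))) \<longlonglongrightarrow> l"
    and inj: "\<And>x. T x = x \<Longrightarrow> x = 0"
begin

interpretation T: bounded_linear T by (rule blin)

definition S :: "'a \<Rightarrow> 'a" where "S x = x - T x"

lemma blin_S: "bounded_linear S"
  unfolding S_def by (intro bounded_linear_sub bounded_linear_ident blin)

interpretation S: bounded_linear S by (rule blin_S)

text \<open>Otherwise there are unit vectors \<open>x\<close> with \<open>S x\<close> tending to 0.
  As \<open>x = S x + T x\<close>, a subsequence converges to a unit vector fixed by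
  \<open>T\<close>, against injectivity.\<close>

lemma bounded_below: "\<exists>c>0. \<forall>x. norm x \<le> c * norm (S x)"
proof (rule ccontr)
  assume neg: "\<not> ?thesis"
  have "\<exists>x. norm x = 1 \<and> norm (S x) < 1 / real (Suc i)" for i
  proof -
    from neg obtain x where x: "real (Suc i) * norm (S x) < norm x"
      by (metis not_le of_nat_0_less_iff zero_less_Suc)
    then have x0: "norm x > 0" by (smt (verit) norm_ge_zero mult_nonneg_nonneg of_nat_0_le_iff)
    define y where "y = (1 / norm x) *\<^sub>R x"
    have "norm (S y) = norm (S x) / norm x" unfolding y_def using x0 by (simp add: S.scaleR)
    also have "\<dots> < 1 / real (Suc i)" using x x0 by (simp add: field_simps)
    finally show ?thesis using x0 by (intro exI[of _ y]) (simp add: y_def)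
  qed
  then obtain X where X: "\<And>i. norm (X i) = 1" "\<And>i. norm (S (X i)) < 1 / real (Suc i)"
    by metis
  have "bounded (range X)" using X(1) by (auto simp: bounded_iff)
  from compact[OF this] obtain l r where r: "strict_mono r" "(\<lambda>i. T (X (r i))) \<longlonglongrightarrow> l" by blast
  have "(\<lambda>i. S (X i)) \<longlonglongrightarrow> 0"
    by (rule Lim_null_comparison[where g="\<lambda>i. 1 / real (Suc i)"])
       (use X(2) LIMSEQ_inverse_real_of_nat in \<open>auto intro!: always_eventually less_imp_le simp: inverse_eq_divide simp del: of_nat_Suc\<close>)
  then have "(\<lambda>i. S (X (r i))) \<longlonglongrightarrow> 0"
    using r(1) LIMSEQ_subseq_LIMSEQ[of "\<lambda>i. S (X i)" 0 r] by (simp add: o_def)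
  from tendsto_add[OF this r(2)] have lim: "(\<lambda>i. X (r i)) \<longlonglongrightarrow> l" by (simp add: S_def)
  have "(\<lambda>i. T (X (r i))) \<longlonglongrightarrow> T l" using lim by (rule T.tendsto)
  with r(2) have "T l = l" by (rule LIMSEQ_unique[rotated])
  then have "l = 0" by (rule inj)
  moreover have "norm l = 1" using tendsto_norm[OF lim] X(1) by (simp add: LIMSEQ_const_iff)
  ultimately show False by simp
qed

text \<open>\<open>riesz_almost_orthogonal\<close> asks for closed subspaces. By the lower bound a
  Cauchy sequence in the image comes from one in \<open>U\<close>, so completeness is
  inherited.\<close>

lemma closed_S_image:
  assumes "closed U" "subspace U" shows "closed (S ` U)"
proof -
  from bounded_below obtain c where c: "c > 0" "\<And>x. norm x \<le> c * norm (S x)" by blast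
  show ?thesis
  proof (rule complete_imp_closed, rule complete_isometric_image)
    show "0 < 1 / c" using c by simp
    show "\<forall>x\<in>U. norm (S x) \<ge> 1/c * norm x" using c by (simp add: field_simps)
    show "complete U" using assms by (simp add: complete_eq_closed)
  qed (use assms blin_S in auto)
qed

text \<open>If \<open>S\<close> were not onto, the ranges of its powers would decrease strictly, and almost orthogonal
  unit vectors chosen in them would have images under \<open>T\<close> without a Cauchy subsequence.\<close>

lemma surj_S: "surj S"
proof (rule ccontr)
  assume ns: "\<not> surj S"
  define V where "V i = (S ^^ i) ` UNIV" for i
  have V_Suc: "V (Suc i) = S ` V i" for i by (simp add: V_def image_comp)
  have sub: "subspace (V i)" for i
    by (induction i) (auto simp: V_Suc V_def[of 0] intro: S.linear_axioms linear_subspace_image)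
  have clo: "closed (V i)" for i
    by (induction i) (auto simp: V_Suc V_def[of 0] intro: closed_S_image sub)
  have dec: "V (Suc i) \<subseteq> V i" for i
    by (induction i) (auto simp: V_Suc V_def[of 0])
  have dec': "i \<le> j \<Longrightarrow> V j \<subseteq> V i" for i j
    by (rule lift_Suc_antimono_le) (use dec in auto)
  have injS: "inj S"
    by (rule injI) (metis (no_types, opaque_lifting) S.diff S_def eq_iff_diff_eq_0 inj)
  have "\<exists>v. v \<in> V i \<and> v \<notin> V (Suc i)" for i
  proof (induction i)
    case 0 show ?case using ns by (auto simp: V_def)
  next
    case (Suc i)
    then obtain v where "v \<in> V i" "v \<notin> V (Suc i)" by blast
    then show ?case by (intro exI[of _ "S v"]) (auto simp: V_Suc[of i] V_Suc[of "Suc i"] inj_image_mem_iff[OF injS])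
  qed
  then have "\<exists>e. e \<in> V i \<and> norm e = 1 \<and> (\<forall>z\<in>V (Suc i). 1/2 \<le> norm (e - z))" for i
    by (metis riesz_almost_orthogonal[OF sub clo sub dec])
  then obtain e where e: "\<And>i. e i \<in> V i" "\<And>i. norm (e i) = 1"
    "\<And>i z. z \<in> V (Suc i) \<Longrightarrow> 1/2 \<le> norm (e i - z)" by metis
  have "bounded (range e)" using e(2) by (auto simp: bounded_iff)
  from compact[OF this] obtain l r where r: "strict_mono r" "(\<lambda>i. T (e (r i))) \<longlonglongrightarrow> l" by blast
  have "Cauchy (\<lambda>i. T (e (r i)))" using r(2) by (rule LIMSEQ_imp_Cauchy)
  then obtain i where i: "norm (T (e (r i)) - T (e (r (Suc i)))) < 1/2"
    unfolding Cauchy_iff by (metis half_gt_zero_iff le_add2 order_refl plus_1_eq_Suc zero_less_one)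
  have lt: "r i < r (Suc i)" using r(1) by (simp add: strict_mono_def)
  \<comment> \<open>Since \<open>T x = x - S x\<close>, the difference of the two images under
    \<open>T\<close> is \<open>e (r i)\<close> minus a vector of the next smaller range.\<close>
  define z where "z = S (e (r i)) + (e (r (Suc i)) - S (e (r (Suc i))))"
  have "S (e (r i)) \<in> V (Suc (r i))" by (auto simp: V_Suc e)
  moreover have "e (r (Suc i)) \<in> V (Suc (r i))" using e(1) dec' lt by (metis Suc_leI subsetD)
  moreover have "S (e (r (Suc i))) \<in> V (Suc (r i))"
    using dec'[of "Suc (r i)" "Suc (r (Suc i))"] lt by (auto simp: V_Suc[of "r (Suc i)"] e)
  ultimately have "z \<in> V (Suc (r i))" unfolding z_def
    by (intro subspace_add subspace_diff sub)
  from e(3)[OF this] have "1/2 \<le> norm (e (r i) - z)" .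
  also have "e (r i) - z = T (e (r i)) - T (e (r (Suc i)))" by (simp add: z_def S_def)
  finally show False using i by simp
qed

end

section \<open>Integral equations for bounded continuous functions\<close>

abbreviation bcont :: "(real \<Rightarrow> real) set" where "bcont \<equiv> bcontfun"

lemma bcontI:
  assumes "continuous_on UNIV h" "\<And>x. \<bar>h x\<bar> \<le> c" shows "h \<in> bcont"
  using assms by (auto simp: bcontfun_def bounded_iff)

lemma bcontD:
  assumes "h \<in> bcont"
  shows "continuous_on UNIV h" "\<exists>c\<ge>0. \<forall>x. \<bar>h x\<bar> \<le> c"
proof -
  show "continuous_on UNIV h" using assms by (auto simp: bcontfun_def)
  obtain c where c: "\<And>x. \<bar>h x\<bar> \<le> c" using assms by (auto simp: bcontfun_def bounded_iff)
  then show "\<exists>c\<ge>0. \<forall>x. \<bar>h x\<bar> \<le> c" by (intro exI[of _ c]) (meson abs_ge_zero order_trans)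
qed

lemma bcont_mult: "g \<in> bcont \<Longrightarrow> h \<in> bcont \<Longrightarrow> (\<lambda>x. g x * h x) \<in> bcont"
proof -
  assume g: "g \<in> bcont" and h: "h \<in> bcont"
  from bcontD(2)[OF g] obtain c where c: "c \<ge> 0" "\<And>x. \<bar>g x\<bar> \<le> c" by blast
  from bcontD(2)[OF h] obtain d where d: "d \<ge> 0" "\<And>x. \<bar>h x\<bar> \<le> d" by blast
  show ?thesis
  proof (rule bcontI)
    show "continuous_on UNIV (\<lambda>x. g x * h x)" by (intro continuous_on_mult bcontD(1) g h)
    show "\<bar>g x * h x\<bar> \<le> c * d" for x using c d by (simp add: abs_mult mult_mono)
  qed
qed

lemma bcont_add: "g \<in> bcont \<Longrightarrow> h \<in> bcont \<Longrightarrow> (\<lambda>x. g x + h x) \<in> bcont"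
  using plus_cont[of g h] by simp

lemma bcont_diff: "g \<in> bcont \<Longrightarrow> h \<in> bcont \<Longrightarrow> (\<lambda>x. g x - h x) \<in> bcont"
  using minus_cont[of g h] by simp

lemma bcont_const: "(\<lambda>_. c) \<in> bcont" by (rule const_bcontfun)

lemma bcont_cmult: "h \<in> bcont \<Longrightarrow> (\<lambda>x. c * h x) \<in> bcont" by (intro bcont_mult bcont_const)

lemma bcont_sum: "(\<And>i. i \<in> A \<Longrightarrow> h i \<in> bcont) \<Longrightarrow> (\<lambda>x. \<Sum>i\<in>A. h i x) \<in> bcont"
  by (induction A rule: infinite_finite_induct) (auto intro: bcont_add bcont_const)

text \<open>Only the values on \<open>[0, B]\<close> matter, where \<open>B\<close> bounds the endpoints. Everything is extended
  constantly to the whole line, so that the library's Banach space of bounded continuous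
  functions can be used and the space does not depend on the endpoints.\<close>

definition clamp0 :: "real \<Rightarrow> real \<Rightarrow> real" where
  "clamp0 B x = max 0 (min B x)"

lemma clamp0_id [simp]: "0 \<le> x \<Longrightarrow> x \<le> B \<Longrightarrow> clamp0 B x = x"
  by (simp add: clamp0_def)

lemma clamp0_nonneg [simp]: "0 \<le> clamp0 B x"
  by (simp add: clamp0_def)

lemma clamp0_mem: "0 \<le> B \<Longrightarrow> clamp0 B x \<in> {0..B}"
  by (simp add: clamp0_def)

lemma clamp0_idem [simp]: "clamp0 B (clamp0 B x) = clamp0 B x"
  by (simp add: clamp0_def)

lemma clamp0_lipschitz: "\<bar>clamp0 B x - clamp0 B y\<bar> \<le> \<bar>x - y\<bar>"
  by (simp add: clamp0_def)

lemma continuous_on_clamp0 [continuous_intros]: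
  "continuous_on S h \<Longrightarrow> continuous_on S (\<lambda>x. clamp0 B (h x))"
  unfolding clamp0_def by (intro continuous_intros)

lemma bcont_clamp0:
  assumes "continuous_on {0..} h" "0 \<le> B" shows "(\<lambda>x. h (clamp0 B x)) \<in> bcont"
proof -
  have "continuous_on {0..B} h" by (rule continuous_on_subset[OF assms(1)]) auto
  then have "compact (h ` {0..B})" by (rule compact_continuous_image) simp
  then obtain c where "\<And>z. z \<in> h ` {0..B} \<Longrightarrow> \<bar>z\<bar> \<le> c"
    using compact_imp_bounded[of "h ` {0..B}"] unfolding bounded_iff real_norm_def by metis
  then have c: "\<bar>h x\<bar> \<le> c" if "x \<in> {0..B}" for x using that by blast
  show ?thesis
  proof (rule bcontI)
    show "continuous_on UNIV (\<lambda>x. h (clamp0 B x))"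
      by (intro continuous_on_compose2[OF assms(1)] continuous_intros) auto
    show "\<bar>h (clamp0 B x)\<bar> \<le> c" for x by (intro c clamp0_mem assms)
  qed
qed

definition clamped_kernel :: "real \<Rightarrow> (real \<Rightarrow> real \<Rightarrow> real) \<Rightarrow> bool" where
  "clamped_kernel B k \<longleftrightarrow> 0 \<le> B \<and> continuous_on UNIV (\<lambda>z. k (fst z) (snd z)) \<and>
     (\<forall>x y. k (clamp0 B x) (clamp0 B y) = k x y)"

lemma clamped_kernel_clamp0:
  assumes "clamped_kernel B k" shows "k (clamp0 B x) y = k x y"
proof -
  have e: "\<And>x y. k (clamp0 B x) (clamp0 B y) = k x y" using assms by (simp add: clamped_kernel_def)
  show ?thesis using e[of "clamp0 B x" y] e[of x y] by simp
qed

lemma clamped_kernelI: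
  assumes "0 \<le> B" "continuous_on ({0..} \<times> {0..}) (\<lambda>z. k (fst z) (snd z))"
  shows "clamped_kernel B (\<lambda>x y. k (clamp0 B x) (clamp0 B y))"
proof -
  have "continuous_on UNIV (\<lambda>z. (clamp0 B (fst z), clamp0 B (snd z)))"
    by (intro continuous_intros)
  from continuous_on_compose2[OF assms(2) this]
  have "continuous_on UNIV (\<lambda>z. k (clamp0 B (fst z)) (clamp0 B (snd z)))" by force
  then show ?thesis using assms by (simp add: clamped_kernel_def)
qed

lemma clamped_kernel_transpose: "clamped_kernel B k \<Longrightarrow> clamped_kernel B (\<lambda>x y. k y x)"
proof -
  assume k: "clamped_kernel B k"
  then have "continuous_on UNIV (\<lambda>z. k (fst z) (snd z))" by (simp add: clamped_kernel_def)
  from continuous_on_compose2[OF this, of UNIV "\<lambda>z. (snd z, fst z)"]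
  have "continuous_on UNIV (\<lambda>z. k (snd z) (fst z))" by (simp add: continuous_intros)
  then show ?thesis using k unfolding clamped_kernel_def by auto
qed

text \<open>Uniform continuity on the compact square carries over to the plane because the clamp
  does not increase distances. The modulus is the same for all \<open>y\<close>, as integration over
  \<open>y\<close> requires.\<close>

lemma clamped_kernel_ucont:
  assumes k: "clamped_kernel B k" and "e > 0"
  shows "\<exists>d>0. \<forall>x x' y. \<bar>x - x'\<bar> < d \<longrightarrow> \<bar>k x y - k x' y\<bar> < e"
proof -
  have "continuous_on ({0..B} \<times> {0..B}) (\<lambda>z. k (fst z) (snd z))"
    using k continuous_on_subset[OF _ subset_UNIV] unfolding clamped_kernel_def by metis
  then have "uniformly_continuous_on ({0..B} \<times> {0..B}) (\<lambda>z. k (fst z) (snd z))"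
    by (intro compact_uniformly_continuous compact_Times compact_Icc)
  then obtain d where d: "d > 0" "\<And>z z'. z \<in> {0..B} \<times> {0..B} \<Longrightarrow> z' \<in> {0..B} \<times> {0..B} \<Longrightarrow>
      dist z' z < d \<Longrightarrow> dist (k (fst z') (snd z')) (k (fst z) (snd z)) < e"
    unfolding uniformly_continuous_on_def using \<open>e > 0\<close> by meson
  have "\<bar>k x y - k x' y\<bar> < e" if "\<bar>x - x'\<bar> < d" for x x' y
  proof -
    have B: "0 \<le> B" and kc: "\<And>x y. k (clamp0 B x) (clamp0 B y) = k x y"
      using k by (auto simp: clamped_kernel_def)
    have "dist (clamp0 B x, clamp0 B y) (clamp0 B x', clamp0 B y) < d"
      using that clamp0_lipschitz[of B x x'] by (simp add: dist_Pair_Pair dist_real_def)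
    from d(2)[OF _ _ this] have "\<bar>k (clamp0 B x) (clamp0 B y) - k (clamp0 B x') (clamp0 B y)\<bar> < e"
      using clamp0_mem[OF B] by (simp add: dist_real_def)
    then show ?thesis using kc[of x y] kc[of x' y] by simp
  qed
  with d(1) show ?thesis by blast
qed

lemma clamped_kernel_bounded:
  assumes k: "clamped_kernel B k"
  obtains c where "c \<ge> 0" "\<And>x y. \<bar>k x y\<bar> \<le> c"
proof -
  have "continuous_on ({0..B} \<times> {0..B}) (\<lambda>z. k (fst z) (snd z))"
    using k continuous_on_subset[OF _ subset_UNIV] unfolding clamped_kernel_def by metis
  then have "compact ((\<lambda>z. k (fst z) (snd z)) ` ({0..B} \<times> {0..B}))"
    by (intro compact_continuous_image compact_Times compact_Icc)
  from compact_imp_bounded[OF this] obtain c where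
    c: "\<forall>z\<in>(\<lambda>z. k (fst z) (snd z)) ` ({0..B} \<times> {0..B}). norm z \<le> c"
    unfolding bounded_iff by (rule exE)
  then have c: "\<bar>k x y\<bar> \<le> c" if "x \<in> {0..B}" "y \<in> {0..B}" for x y
    using bspec[OF c, of "k x y"] that by (force intro: image_eqI[of _ _ "(x, y)"])
  have "\<bar>k x y\<bar> \<le> c" for x y
    using k c[of "clamp0 B x" "clamp0 B y"] clamp0_mem[of B x] clamp0_mem[of B y]
    unfolding clamped_kernel_def by metis
  moreover from this[of 0 0] have "c \<ge> 0" by linarith
  ultimately show ?thesis by (rule that[rotated])
qed

lemma clamped_kernel_bcont1: "clamped_kernel B k \<Longrightarrow> k x \<in> bcont"
proof -
  assume k: "clamped_kernel B k"
  then have "continuous_on UNIV (\<lambda>z. k (fst z) (snd z))" by (simp add: clamped_kernel_def)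
  from continuous_on_compose2[OF this, of UNIV "\<lambda>y. (x, y)"]
  have "continuous_on UNIV (k x)" by (simp add: continuous_intros)
  moreover obtain C where "C \<ge> 0" "\<And>x y. \<bar>k x y\<bar> \<le> C" by (metis clamped_kernel_bounded[OF k])
  ultimately show ?thesis by (blast intro: bcontI)
qed

lemma clamped_kernel_bcont2: "clamped_kernel B k \<Longrightarrow> (\<lambda>x. k x y) \<in> bcont"
  using clamped_kernel_bcont1[OF clamped_kernel_transpose] .

definition clamped_fun :: "real \<Rightarrow> (real \<Rightarrow> real) \<Rightarrow> bool" where
  "clamped_fun B h \<longleftrightarrow> (\<forall>x. h (clamp0 B x) = h x)"

section \<open>Integral operators with clamped kernels over a finite measure\<close>

locale finite_borel = finite_measure M for M :: "real measure" +
  assumes sets_M [measurable_cong]: "sets M = sets borel"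
begin

lemma space_M [simp]: "space M = UNIV"
  using sets_eq_imp_space_eq[OF sets_M] by simp

lemma integrable_bcont: "h \<in> bcont \<Longrightarrow> integrable M h"
proof -
  assume h: "h \<in> bcont"
  have "h \<in> borel_measurable borel" using bcontD(1)[OF h] by (rule borel_measurable_continuous_onI)
  then have "h \<in> borel_measurable M" by (simp add: measurable_cong_sets[OF sets_M refl])
  moreover from bcontD(2)[OF h] obtain c where "\<And>x. \<bar>h x\<bar> \<le> c" by blast
  ultimately show ?thesis by (intro integrable_const_bound[of _ c]) auto
qed

lemma abs_integral_le:
  assumes "h \<in> bcont" "\<And>x. \<bar>h x\<bar> \<le> c"
  shows "\<bar>\<integral>x. h x \<partial>M\<bar> \<le> c * measure M UNIV"
proof -
  have "\<bar>\<integral>x. h x \<partial>M\<bar> \<le> (\<integral>x. \<bar>h x\<bar> \<partial>M)" by (rule integral_abs_bound)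
  also have "\<dots> \<le> (\<integral>x. c \<partial>M)"
    using assms by (intro integral_mono integrable_abs integrable_bcont bcont_const) auto
  finally show ?thesis by (simp add: mult.commute)
qed

definition intop :: "(real \<Rightarrow> real \<Rightarrow> real) \<Rightarrow> (real \<Rightarrow> real) \<Rightarrow> real \<Rightarrow> real" where
  "intop k q x = (\<integral>y. k x y * q y \<partial>M)"

context
  fixes B k assumes k: "clamped_kernel B k"
begin

lemma intop_modulus:
  assumes "q \<in> bcont" "\<And>y. \<bar>q y\<bar> \<le> c" "\<And>y. \<bar>k x y - k x' y\<bar> \<le> e" "c \<ge> 0"
  shows "\<bar>intop k q x - intop k q x'\<bar> \<le> e * c * measure M UNIV"
proof -
  have "intop k q x - intop k q x' = (\<integral>y. (k x y - k x' y) * q y \<partial>M)"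
    using assms(1) clamped_kernel_bcont1[OF k]
    by (simp add: intop_def left_diff_distrib integrable_bcont bcont_mult)
  moreover have "\<bar>\<integral>y. (k x y - k x' y) * q y \<partial>M\<bar> \<le> (e * c) * measure M UNIV"
    using assms
    by (intro abs_integral_le bcont_mult bcont_diff clamped_kernel_bcont1[OF k])
       (auto simp: abs_mult intro!: mult_mono intro: order_trans[OF abs_ge_zero])
  ultimately show ?thesis by simp
qed

lemma intop_bound:
  assumes "q \<in> bcont" "\<And>y. \<bar>q y\<bar> \<le> c" "\<And>y. \<bar>k x y\<bar> \<le> e"
  shows "\<bar>intop k q x\<bar> \<le> e * c * measure M UNIV"
  unfolding intop_def using assms
    by (intro abs_integral_le bcont_mult clamped_kernel_bcont1[OF k]) (auto simp: abs_mult intro!: mult_mono intro: order_trans[OF abs_ge_zero])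

text \<open>The modulus depends on \<open>q\<close> only through its bound. This is the
  equicontinuity for Arzela-Ascoli, and for a single \<open>q\<close> it also gives
  continuity.\<close>

lemma intop_equicont:
  assumes "e > 0"
  shows "\<exists>d>0. \<forall>q\<in>bcont. (\<forall>y. \<bar>q y\<bar> \<le> c) \<longrightarrow> (\<forall>x x'. \<bar>x - x'\<bar> < d \<longrightarrow> \<bar>intop k q x - intop k q x'\<bar> < e)"
proof (cases "c \<ge> 0")
  case True
  \<comment> \<open>The summand 1 covers the case that \<open>c\<close> or the measure vanishes; the
    factor 2 makes the final inequality strict.\<close>
  define e' where "e' = e / (2 * (c * measure M UNIV + 1))"
  have nn: "0 \<le> c * measure M UNIV" using True by simp
  have e': "e' > 0" using assms nn by (simp add: e'_def)
  from clamped_kernel_ucont[OF k e'] obtain d where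
    d: "d > 0" "\<And>x x' y. \<bar>x - x'\<bar> < d \<Longrightarrow> \<bar>k x y - k x' y\<bar> < e'" by blast
  show ?thesis
  proof (intro exI[of _ d] conjI ballI impI allI)
    fix q x x' assume q: "q \<in> bcont" "\<forall>y. \<bar>q y\<bar> \<le> c" "\<bar>x - x'\<bar> < d"
    have "\<bar>intop k q x - intop k q x'\<bar> \<le> e' * c * measure M UNIV"
      using q d(2) True by (intro intop_modulus) (auto intro: less_imp_le)
    also have "\<dots> \<le> e' * (c * measure M UNIV + 1)" using e' by (simp add: algebra_simps)
    also have "\<dots> = e / 2" using nn by (simp add: e'_def divide_simps)
    finally show "\<bar>intop k q x - intop k q x'\<bar> < e" using assms by simp
  qed (use d in auto)
qed (auto intro!: exI[of _ 1] dest: order_trans[OF abs_ge_zero])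

lemma intop_bcont:
  assumes q: "q \<in> bcont" shows "intop k q \<in> bcont"
proof -
  from bcontD(2)[OF q] obtain c where c: "c \<ge> 0" "\<And>x. \<bar>q x\<bar> \<le> c" by blast
  obtain C where C: "C \<ge> 0" "\<And>x y. \<bar>k x y\<bar> \<le> C" by (metis clamped_kernel_bounded[OF k])
  show ?thesis
  proof (rule bcontI)
    show "\<bar>intop k q x\<bar> \<le> C * c * measure M UNIV" for x
      using q c C by (intro intop_bound) auto
    show "continuous_on UNIV (intop k q)"
      unfolding continuous_on_iff dist_real_def
      using intop_equicont[of _ c] q c(2) by (metis abs_minus_commute)
  qed
qed

lemma intop_clamped: "clamped_fun B (intop k q)"
  by (simp add: clamped_fun_def intop_def clamped_kernel_clamp0[OF k])

end

end

locale fredholm_kernel = finite_borel M for M :: "real measure" +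
  fixes B :: real and k :: "real \<Rightarrow> real \<Rightarrow> real"
  assumes kernel: "clamped_kernel B k"
    and nondegenerate: "\<And>q. q \<in> bcont \<Longrightarrow> (\<And>x. q x = (\<integral>y. k x y * q y \<partial>M)) \<Longrightarrow> q = (\<lambda>_. 0)"
begin

lemma B_nonneg: "0 \<le> B" using kernel by (simp add: clamped_kernel_def)

definition T :: "(real \<Rightarrow>\<^sub>C real) \<Rightarrow> (real \<Rightarrow>\<^sub>C real)" where
  "T q = Bcontfun (intop k (apply_bcontfun q))"

lemma apply_T: "apply_bcontfun (T q) x = intop k (apply_bcontfun q) x"
  unfolding T_def using intop_bcont[OF kernel, of "apply_bcontfun q"]
  by (simp add: Bcontfun_inverse apply_bcontfun)

lemma blin_T: "bounded_linear T"
proof -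
  obtain C where C: "C \<ge> 0" "\<And>x y. \<bar>k x y\<bar> \<le> C" by (metis clamped_kernel_bounded[OF kernel])
  show ?thesis
  proof (rule bounded_linear_intro)
    fix f g :: "real \<Rightarrow>\<^sub>C real" and c :: real
    have [simp]: "integrable M (\<lambda>y. k x y * apply_bcontfun f y)" for x f
      by (intro integrable_bcont bcont_mult clamped_kernel_bcont1[OF kernel] apply_bcontfun)
    show "T (f + g) = T f + T g"
      by (rule bcontfun_eqI) (simp add: apply_T intop_def distrib_left)
    show "T (c *\<^sub>R f) = c *\<^sub>R T f"
      by (rule bcontfun_eqI) (simp add: apply_T intop_def mult.left_commute)
    show "norm (T f) \<le> norm f * (C * measure M UNIV)"
    proof (rule norm_bound)
      fix x
      show "norm (apply_bcontfun (T f) x) \<le> norm f * (C * measure M UNIV)"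
        using intop_bound[OF kernel, of "apply_bcontfun f" "norm f" x C] C norm_bounded[of f] apply_bcontfun[of f]
        by (simp add: apply_T mult.commute mult.left_commute)
    qed
  qed
qed

sublocale T: compact_perturbation T
proof
  interpret bounded_linear T by (rule blin_T)
  show "T (b1 + b2) = T b1 + T b2" for b1 b2 by (rule add)
  show "T (r *\<^sub>R b) = r *\<^sub>R T b" for r b by (rule scale)
  show "\<exists>K. \<forall>x. norm (T x) \<le> norm x * K" by (rule bounded)
next
  fix X :: "nat \<Rightarrow> (real \<Rightarrow>\<^sub>C real)" assume "bounded (range X)"
  then obtain c where c: "\<And>i. norm (X i) \<le> c" by (auto simp: bounded_iff)
  then have c': "\<bar>apply_bcontfun (X i) x\<bar> \<le> c" for i x
    using norm_bounded[of "X i" x] by (metis order_trans real_norm_def)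
  obtain C where C: "C \<ge> 0" "\<And>x y. \<bar>k x y\<bar> \<le> C" by (metis clamped_kernel_bounded[OF kernel])
  define F where "F i x = apply_bcontfun (T (X i)) x" for i x
  have F: "F i = intop k (apply_bcontfun (X i))" for i by (simp add: F_def apply_T fun_eq_iff)
  have clF: "F i (clamp0 B x) = F i x" for i x
    using intop_clamped[OF kernel] unfolding F clamped_fun_def by blast
  obtain g r where g: "continuous_on {0..B} g" "strict_mono (r::nat\<Rightarrow>nat)"
    "\<And>e. 0 < e \<Longrightarrow> \<exists>N. \<forall>n x. n \<ge> N \<and> x \<in> {0..B} \<longrightarrow> norm (F (r n) x - g x) < e"
  proof (rule Arzela_Ascoli[of "{0..B}" F "C * c * measure M UNIV"])
    show "norm (F n x) \<le> C * c * measure M UNIV" for n x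
      unfolding F real_norm_def using c' C by (intro intop_bound[OF kernel] apply_bcontfun) auto
    show "\<exists>d>0. \<forall>n y. y \<in> {0..B} \<and> norm (x - y) < d \<longrightarrow> norm (F n x - F n y) < e" if "0 < e" for x e
    proof -
      from intop_equicont[OF kernel that, of c] obtain d where d: "d > 0"
        "\<And>q x x'. q \<in> bcont \<Longrightarrow> (\<forall>y. \<bar>q y\<bar> \<le> c) \<Longrightarrow> \<bar>x - x'\<bar> < d \<Longrightarrow> \<bar>intop k q x - intop k q x'\<bar> < e"
        by blast
      show ?thesis unfolding F real_norm_def using d c' apply_bcontfun by blast
    qed
  qed auto
  \<comment> \<open>Arzela-Ascoli gives uniform convergence on \<open>[0, B]\<close> only.
    Composition with the clamp extends it to the line, since the clamp leaves the functions
    \<open>F i\<close> unchanged.\<close>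
  define G where "G x = g (clamp0 B x)" for x
  have "uniform_limit UNIV (\<lambda>i. F (r i)) G sequentially"
  proof (rule uniform_limitI)
    fix e :: real assume "e > 0"
    from g(3)[OF this] obtain N where N: "\<And>n x. n \<ge> N \<Longrightarrow> x \<in> {0..B} \<Longrightarrow> norm (F (r n) x - g x) < e" by blast
    have "dist (F (r n) x) (G x) < e" if "n \<ge> N" for n x
      using N[OF that clamp0_mem[OF B_nonneg], of x] unfolding clF G_def dist_real_def real_norm_def .
    then show "\<forall>\<^sub>F n in sequentially. \<forall>x\<in>UNIV. dist (F (r n) x) (G x) < e"
      by (auto simp: eventually_sequentially)
  qed
  moreover have "F i = apply_bcontfun (T (X i))" for i by (simp add: F_def fun_eq_iff)
  ultimately have "uniform_limit UNIV (\<lambda>i. apply_bcontfun (T (X (r i)))) G sequentially" by simp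
  then obtain l where "(\<lambda>i. T (X (r i))) \<longlonglongrightarrow> l"
    by (rule uniform_limit_bcontfunE) auto
  with g(2) show "\<exists>l r. strict_mono r \<and> (\<lambda>i. T (X (r i))) \<longlonglongrightarrow> l" by blast
next
  fix q assume "T q = q"
  then have "apply_bcontfun q x = (\<integral>y. k x y * apply_bcontfun q y \<partial>M)" for x
    using apply_T[of q x] by (simp add: intop_def)
  from nondegenerate[OF apply_bcontfun this] show "q = 0"
    by (intro bcontfun_eqI) auto
qed

text \<open>The constant is that of \<open>bounded_below\<close>, hence the same for all
  \<open>h\<close>. Pointwise bounds \<open>b\<close> replace the norm, so that later arguments need
  not return to the type of bounded continuous functions.\<close>

lemma solution_exists:
  "\<exists>c\<ge>0. \<forall>h\<in>bcont. \<exists>q\<in>bcont. (\<forall>x. q x = h x + (\<integral>y. k x y * q y \<partial>M)) \<and>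
      (\<forall>b. (\<forall>x. \<bar>h x\<bar> \<le> b) \<longrightarrow> (\<forall>x. \<bar>q x\<bar> \<le> c * b))"
proof -
  from T.bounded_below obtain c where c: "c > 0" "\<And>x. norm x \<le> c * norm (T.S x)" by blast
  show ?thesis
  proof (intro exI[of _ c] conjI ballI)
    fix h assume "h \<in> bcont"
    then obtain H :: "real \<Rightarrow>\<^sub>C real" where H: "h = apply_bcontfun H" by (rule bcontfunE)
    obtain q where q: "T.S q = H" using T.surj_S by (metis surjD)
    show "\<exists>q\<in>bcont. (\<forall>x. q x = h x + (\<integral>y. k x y * q y \<partial>M)) \<and>
      (\<forall>b. (\<forall>x. \<bar>h x\<bar> \<le> b) \<longrightarrow> (\<forall>x. \<bar>q x\<bar> \<le> c * b))"
    proof (intro bexI[of _ "apply_bcontfun q"] conjI allI impI)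
      fix x
      have "q = H + T q" using q by (auto simp: T.S_def)
      then have "apply_bcontfun q x = apply_bcontfun (H + T q) x" by simp
      then show "apply_bcontfun q x = h x + (\<integral>y. k x y * apply_bcontfun q y \<partial>M)"
        by (simp add: H apply_T intop_def)
      fix b assume "\<forall>x. \<bar>h x\<bar> \<le> b"
      then have "norm H \<le> b" by (intro norm_bound) (auto simp: H)
      have "\<bar>apply_bcontfun q x\<bar> \<le> norm q" using norm_bounded[of q x] by simp
      also have "\<dots> \<le> c * norm H" using c(2)[of q] q by simp
      also have "\<dots> \<le> c * b" using \<open>norm H \<le> b\<close> c(1) by simp
      finally show "\<bar>apply_bcontfun q x\<bar> \<le> c * b" .
    qed (rule apply_bcontfun)
  qed (use c in auto)
qed

definition sol :: "(real \<Rightarrow> real) \<Rightarrow> real \<Rightarrow> real" where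
  "sol h = (SOME q. q \<in> bcont \<and> (\<forall>x. q x = h x + (\<integral>y. k x y * q y \<partial>M)))"

lemma sol:
  assumes "h \<in> bcont"
  shows sol_bcont: "sol h \<in> bcont" and sol_eq: "sol h x = h x + (\<integral>y. k x y * sol h y \<partial>M)"
proof -
  from solution_exists assms have "\<exists>q. q \<in> bcont \<and> (\<forall>x. q x = h x + (\<integral>y. k x y * q y \<partial>M))" by blast
  from someI_ex[OF this] show "sol h \<in> bcont" "sol h x = h x + (\<integral>y. k x y * sol h y \<partial>M)"
    unfolding sol_def by blast+
qed

lemma integrable_kernel: "q \<in> bcont \<Longrightarrow> integrable M (\<lambda>y. k x y * q y)"
  by (intro integrable_bcont bcont_mult clamped_kernel_bcont1[OF kernel])

lemma sol_unique:
  assumes h: "h \<in> bcont" and q: "q \<in> bcont" "\<And>x. q x = h x + (\<integral>y. k x y * q y \<partial>M)"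
  shows "q = sol h"
proof -
  note s = sol[OF h]
  have "(\<lambda>x. q x - sol h x) = (\<lambda>_. 0)"
  proof (rule nondegenerate)
    show "(\<lambda>x. q x - sol h x) \<in> bcont" by (intro bcont_diff q s)
    show "q x - sol h x = (\<integral>y. k x y * (q y - sol h y) \<partial>M)" for x
      using q(1) s(1) by (subst q(2), subst s(2)) (simp add: right_diff_distrib integrable_kernel)
  qed
  then show ?thesis by (simp add: fun_eq_iff)
qed

lemma sol_add:
  assumes "g \<in> bcont" "h \<in> bcont" shows "sol (\<lambda>x. g x + h x) x = sol g x + sol h x"
proof -
  have "(\<lambda>x. sol g x + sol h x) = sol (\<lambda>x. g x + h x)"
  proof (rule sol_unique)
    show "sol g x + sol h x = (g x + h x) + (\<integral>y. k x y * (sol g y + sol h y) \<partial>M)" for x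
      using sol_eq[OF assms(1), of x] sol_eq[OF assms(2), of x]
      by (simp add: distrib_left integrable_kernel sol_bcont assms)
  qed (intro bcont_add sol_bcont assms)+
  then show ?thesis by (simp add: fun_eq_iff)
qed

lemma sol_cmult:
  assumes "h \<in> bcont" shows "sol (\<lambda>x. c * h x) x = c * sol h x"
proof -
  have "(\<lambda>x. c * sol h x) = sol (\<lambda>x. c * h x)"
  proof (rule sol_unique)
    show "c * sol h x = c * h x + (\<integral>y. k x y * (c * sol h y) \<partial>M)" for x
      using sol_eq[OF assms, of x] by (simp add: distrib_left mult.left_commute)
  qed (intro bcont_cmult sol_bcont assms)+
  then show ?thesis by (simp add: fun_eq_iff)
qed

lemma sol_diff:
  assumes "g \<in> bcont" "h \<in> bcont" shows "sol (\<lambda>x. g x - h x) x = sol g x - sol h x"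
  using sol_add[of g "\<lambda>x. (-1) * h x" x] sol_cmult[of h "-1" x] assms bcont_cmult[of h "-1"] by simp

lemma sol_zero: "sol (\<lambda>_. 0) x = 0"
  using sol_cmult[of "\<lambda>_. 0" 0 x] bcont_const[of 0] by simp

lemma sol_sum:
  "(\<And>i. i \<in> A \<Longrightarrow> h i \<in> bcont) \<Longrightarrow> sol (\<lambda>x. \<Sum>i\<in>A. h i x) x = (\<Sum>i\<in>A. sol (h i) x)"
  by (induction A rule: infinite_finite_induct) (auto simp: sol_zero sol_add bcont_sum)

lemma sol_bound: "\<exists>c\<ge>0. \<forall>h\<in>bcont. \<forall>b. (\<forall>x. \<bar>h x\<bar> \<le> b) \<longrightarrow> (\<forall>x. \<bar>sol h x\<bar> \<le> c * b)"
proof -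
  from solution_exists obtain c where c: "c \<ge> 0 \<and> (\<forall>h\<in>bcont.
     \<exists>q\<in>bcont. (\<forall>x. q x = h x + (\<integral>y. k x y * q y \<partial>M)) \<and> (\<forall>b. (\<forall>x. \<bar>h x\<bar> \<le> b) \<longrightarrow> (\<forall>x. \<bar>q x\<bar> \<le> c * b)))"
    by (rule exE)
  show ?thesis
  proof (intro exI[of _ c] conjI ballI)
    fix h assume h: "h \<in> bcont"
    from c[THEN conjunct2, THEN bspec, OF h] obtain q where q: "q \<in> bcont" "(\<forall>x. q x = h x + (\<integral>y. k x y * q y \<partial>M)) \<and>
       (\<forall>b. (\<forall>x. \<bar>h x\<bar> \<le> b) \<longrightarrow> (\<forall>x. \<bar>q x\<bar> \<le> c * b))" by (rule bexE)
    have "q = sol h" by (rule sol_unique[OF h q(1) q(2)[THEN conjunct1, rule_format]])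
    with q(2) show "\<forall>b. (\<forall>x. \<bar>h x\<bar> \<le> b) \<longrightarrow> (\<forall>x. \<bar>sol h x\<bar> \<le> c * b)" by metis
  qed (rule conjunct1[OF c])
qed

end

lemma fubini_kernel:
  assumes M: "finite_borel M" and M': "finite_borel M'" and k: "clamped_kernel B k"
    and p: "p \<in> bcont" and q: "q \<in> bcont"
  shows "(\<integral>y. (\<integral>x. k x y * p x \<partial>M) * q y \<partial>M') = (\<integral>x. p x * (\<integral>y. k x y * q y \<partial>M') \<partial>M)"
proof -
  interpret M: finite_borel M by (rule M)
  interpret M': finite_borel M' by (rule M')
  interpret pair_sigma_finite M M' by unfold_locales
  have cont: "continuous_on UNIV (\<lambda>z. k (fst z) (snd z) * p (fst z) * q (snd z))"
    using k bcontD(1)[OF p] bcontD(1)[OF q] unfolding clamped_kernel_def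
    by (intro continuous_intros continuous_on_compose2[OF bcontD(1)[OF p] continuous_on_fst]
          continuous_on_compose2[OF bcontD(1)[OF q] continuous_on_snd] continuous_on_id) auto
  have sets: "sets (M \<Otimes>\<^sub>M M') = sets borel"
    using sets_pair_measure_cong[OF M.sets_M M'.sets_M] by (simp only: borel_prod)
  have meas: "(\<lambda>z. k (fst z) (snd z) * p (fst z) * q (snd z)) \<in> borel_measurable (M \<Otimes>\<^sub>M M')"
    using borel_measurable_continuous_onI[OF cont] by (simp only: measurable_cong_sets[OF sets refl])
  obtain C where C: "C \<ge> 0" "\<And>x y. \<bar>k x y\<bar> \<le> C" by (metis clamped_kernel_bounded[OF k])
  obtain c where c: "c \<ge> 0" "\<forall>x. \<bar>p x\<bar> \<le> c" using bcontD(2)[OF p] by blast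
  obtain d where d: "d \<ge> 0" "\<forall>x. \<bar>q x\<bar> \<le> d" using bcontD(2)[OF q] by blast
  interpret P: finite_measure "M \<Otimes>\<^sub>M M'"
    by (rule finite_measure_pair_measure) unfold_locales
  have "integrable (M \<Otimes>\<^sub>M M') (\<lambda>z. k (fst z) (snd z) * p (fst z) * q (snd z))"
    using C c d by (intro P.integrable_const_bound[of _ "C * c * d"] meas)
      (auto simp: abs_mult intro!: mult_mono mult_nonneg_nonneg)
  then have "integrable (M \<Otimes>\<^sub>M M') (case_prod (\<lambda>x y. k x y * p x * q y))"
    by (simp add: case_prod_unfold)
  from Fubini_integral[OF this] show ?thesis
    by (simp add: mult.assoc mult.left_commute flip: integral_mult_left_zero integral_mult_right_zero)
qed

section \<open>Duality, change of the measure, and the resolvent kernel\<close>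

locale fredholm_pair = fredholm_kernel M B k + tr: fredholm_kernel M B "\<lambda>x y. k y x"
  for M B k
begin

abbreviation "sol_tr \<equiv> tr.sol"

end

text \<open>Solving the direct equation for \<open>M'\<close> and the transposed one for \<open>M\<close> compares the two measures
  exactly, without any smallness assumption.\<close>

lemma weak_solution:
  assumes K': "fredholm_kernel M' B k" and Kt: "fredholm_kernel M B (\<lambda>x y. k y x)"
    and h: "h \<in> bcont" and g: "g \<in> bcont"
  defines "q' \<equiv> fredholm_kernel.sol M' k h" and "p \<equiv> fredholm_kernel.sol M (\<lambda>x y. k y x) g"
  shows "(\<integral>y. g y * q' y \<partial>M') = (\<integral>y. p y * q' y \<partial>M') - (\<integral>y. p y * q' y \<partial>M) + (\<integral>y. p y * h y \<partial>M)"
proof -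
  interpret K': fredholm_kernel M' B k by fact
  interpret Kt: fredholm_kernel M B "\<lambda>x y. k y x" by fact
  have q': "q' \<in> bcont" unfolding q'_def by (rule K'.sol_bcont[OF h])
  have p: "p \<in> bcont" unfolding p_def by (rule Kt.sol_bcont[OF g])
  have eq': "(\<integral>y. k x y * q' y \<partial>M') = q' x - h x" for x
    using K'.sol_eq[OF h, of x] by (simp add: q'_def)
  have ep: "(\<integral>x. k x y * p x \<partial>M) = p y - g y" for y
    using Kt.sol_eq[OF g, of y] by (simp add: p_def)
  from fubini_kernel[of M M' B k p q', unfolded eq' ep]
  have "(\<integral>y. (p y - g y) * q' y \<partial>M') = (\<integral>x. p x * (q' x - h x) \<partial>M)"
    using K'.kernel p q' K'.finite_borel_axioms Kt.finite_borel_axioms by blast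
  moreover have "(\<integral>y. (p y - g y) * q' y \<partial>M') = (\<integral>y. p y * q' y \<partial>M') - (\<integral>y. g y * q' y \<partial>M')"
    by (simp add: left_diff_distrib K'.integrable_bcont bcont_mult p q' g)
  moreover have "(\<integral>x. p x * (q' x - h x) \<partial>M) = (\<integral>y. p y * q' y \<partial>M) - (\<integral>y. p y * h y \<partial>M)"
    by (simp add: right_diff_distrib Kt.integrable_bcont bcont_mult p q' h)
  ultimately show ?thesis by simp
qed

context fredholm_pair
begin

lemma duality:
  assumes "h \<in> bcont" "g \<in> bcont"
  shows "(\<integral>y. g y * sol h y \<partial>M) = (\<integral>y. sol_tr g y * h y \<partial>M)"
  using weak_solution[OF fredholm_kernel_axioms tr.fredholm_kernel_axioms assms] by simp

text \<open>In \<open>weak_solution\<close> minus \<open>duality\<close> the integrals of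
  \<open>sol_tr g * h\<close> cancel, and there remains the difference of two measures applied to
  one and the same product. If the measures differ near one endpoint only, this is an integral over
  a short interval.\<close>

lemma perturbation:
  assumes "fredholm_kernel M' B k" "h \<in> bcont" "g \<in> bcont"
  defines "q' \<equiv> fredholm_kernel.sol M' k h"
  shows "(\<integral>y. g y * q' y \<partial>M') - (\<integral>y. g y * sol h y \<partial>M) =
    (\<integral>y. sol_tr g y * q' y \<partial>M') - (\<integral>y. sol_tr g y * q' y \<partial>M)"
  using weak_solution[OF assms(1) tr.fredholm_kernel_axioms assms(2,3)] duality[OF assms(2,3)]
  by (simp add: q'_def)

text \<open>The kernel of \<open>K (I - K)^-1\<close> for the integral operator \<open>K\<close>
  with kernel \<open>k\<close>, obtained by solving the transposed equation in the second
  variable.\<close>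

definition res :: "real \<Rightarrow> real \<Rightarrow> real" where "res x = sol_tr (k x)"

lemma kernel_bcont: "k x \<in> bcont" "(\<lambda>x. k x y) \<in> bcont"
  by (rule clamped_kernel_bcont1[OF kernel], rule clamped_kernel_bcont2[OF kernel])

lemma res_bcont: "res x \<in> bcont"
  unfolding res_def by (rule tr.sol_bcont[OF kernel_bcont(1)])

text \<open>Solving in the first variable gives the same kernel: both integral equations have the
  inhomogeneity \<open>k x y\<close>, and \<open>duality\<close> identifies their integrals.\<close>

lemma sol_kernel: "sol (\<lambda>x. k x y) x = res x y"
  unfolding res_def
  using sol_eq[OF kernel_bcont(2), of y x] tr.sol_eq[OF kernel_bcont(1), of x y]
    duality[OF kernel_bcont(2)[of y] kernel_bcont(1)[of x]]
  by (simp add: mult.commute)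

lemma sol_tr_eq_res:
  assumes "h \<in> bcont" shows "sol_tr h y = h y + (\<integral>x. res x y * h x \<partial>M)"
  using tr.sol_eq[OF assms, of y] duality[OF kernel_bcont(2)[of y] assms]
  by (simp add: sol_kernel mult.commute)

lemma res_bounded: "\<exists>c\<ge>0. \<forall>x y. \<bar>res x y\<bar> \<le> c"
proof -
  obtain C where C: "C \<ge> 0" "\<And>x y. \<bar>k x y\<bar> \<le> C" by (metis clamped_kernel_bounded[OF kernel])
  from tr.sol_bound obtain c where c: "c \<ge> 0 \<and> (\<forall>h\<in>bcont. \<forall>b. (\<forall>x. \<bar>h x\<bar> \<le> b) \<longrightarrow> (\<forall>x. \<bar>sol_tr h x\<bar> \<le> c * b))"
    by (rule exE)
  show ?thesis
    using c C kernel_bcont(1) by (intro exI[of _ "c * C"]) (auto simp: res_def)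
qed

text \<open>By linearity the difference of two rows of the resolvent solves the equation for the
  difference of two rows of \<open>k\<close>. This serves where the point of evaluation moves
  together with an endpoint.\<close>

lemma res_ucont:
  assumes "e > 0" shows "\<exists>d>0. \<forall>x x' y. \<bar>x - x'\<bar> < d \<longrightarrow> \<bar>res x y - res x' y\<bar> < e"
proof -
  from tr.sol_bound obtain c where c: "c \<ge> 0 \<and> (\<forall>h\<in>bcont. \<forall>b. (\<forall>x. \<bar>h x\<bar> \<le> b) \<longrightarrow> (\<forall>x. \<bar>sol_tr h x\<bar> \<le> c * b))"
    by (rule exE)
  define e' where "e' = e / (c + 1)"
  have e': "e' > 0" "c * e' < e" using assms c by (auto simp: e'_def field_simps)
  from clamped_kernel_ucont[OF kernel e'(1)] obtain d where
    d: "d > 0" "\<And>x x' y. \<bar>x - x'\<bar> < d \<Longrightarrow> \<bar>k x y - k x' y\<bar> < e'" by blast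
  show ?thesis
  proof (intro exI[of _ d] conjI allI impI d(1))
    fix x x' y assume "\<bar>x - x'\<bar> < d"
    then have "\<forall>y. \<bar>k x y - k x' y\<bar> \<le> e'" using d(2) less_imp_le by blast
    then have "\<bar>sol_tr (\<lambda>y. k x y - k x' y) y\<bar> \<le> c * e'"
      by (intro c[THEN conjunct2, rule_format] bcont_diff kernel_bcont) auto
    also note e'(2)
    finally show "\<bar>res x y - res x' y\<bar> < e"
      by (simp add: res_def tr.sol_diff[OF kernel_bcont(1) kernel_bcont(1)])
  qed
qed

text \<open>As a function of \<open>x\<close>, the left-hand side solves the integral equation whose right-hand side is a
  linear combination of the \<open>f l\<close>.\<close>

lemma res_integrable_form:
  fixes f g :: "nat \<Rightarrow> real \<Rightarrow> real"
  assumes f: "\<And>l. l < N \<Longrightarrow> f l \<in> bcont" and g: "\<And>l. l < N \<Longrightarrow> g l \<in> bcont" and e: "e \<in> bcont"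
    and eq: "\<And>x z. (e x - e z) * k x z = (\<Sum>l<N. f l x * g l z)"
  shows "(e x - e y) * res x y = (\<Sum>l<N. sol (f l) x * sol_tr (g l) y)"
proof -
  define r where "r x = res x y" for x
  have r_eq: "r = sol (\<lambda>x. k x y)" by (simp add: r_def sol_kernel fun_eq_iff)
  have r: "r \<in> bcont" unfolding r_eq by (rule sol_bcont[OF kernel_bcont(2)])
  have er: "(\<lambda>x. (e x - e y) * r x) \<in> bcont" by (intro bcont_mult bcont_diff e bcont_const r)
  have "(\<lambda>x. (e x - e y) * r x) = sol (\<lambda>x. \<Sum>l<N. sol_tr (g l) y * f l x)"
  proof (rule sol_unique[OF _ er])
    show "(\<lambda>x. \<Sum>l<N. sol_tr (g l) y * f l x) \<in> bcont"
      by (intro bcont_sum bcont_cmult f) auto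
    fix x
    have ig: "integrable M (\<lambda>z. g l z * r z)" if "l < N" for l
      by (intro integrable_bcont bcont_mult g r that)
    have "(\<integral>z. k x z * ((e z - e y) * r z) \<partial>M) =
        (\<integral>z. (e x - e y) * (k x z * r z) - (\<Sum>l<N. f l x * (g l z * r z)) \<partial>M)"
    proof (rule Bochner_Integration.integral_cong)
      fix z
      have "k x z * ((e z - e y) * r z) = (e x - e y) * (k x z * r z) - ((e x - e z) * k x z) * r z"
        by (simp add: algebra_simps)
      then show "k x z * ((e z - e y) * r z) = (e x - e y) * (k x z * r z) - (\<Sum>l<N. f l x * (g l z * r z))"
        unfolding eq by (simp add: sum_distrib_right mult.assoc)
    qed simp
    also have "\<dots> = (e x - e y) * (\<integral>z. k x z * r z \<partial>M) - (\<Sum>l<N. f l x * (\<integral>z. g l z * r z \<partial>M))"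
      by (subst Bochner_Integration.integral_diff)
         (auto simp: integral_sum ig integrable_kernel[OF r])
    also have "(\<integral>z. k x z * r z \<partial>M) = r x - k x y"
      unfolding r_eq using sol_eq[OF kernel_bcont(2)[of y], of x] by simp
    also have "(\<Sum>l<N. f l x * (\<integral>z. g l z * r z \<partial>M)) = (\<Sum>l<N. f l x * (sol_tr (g l) y - g l y))"
    proof (rule sum.cong)
      fix l assume "l \<in> {..<N}"
      then show "f l x * (\<integral>z. g l z * r z \<partial>M) = f l x * (sol_tr (g l) y - g l y)"
        using sol_tr_eq_res[of "g l" y] g by (simp add: r_def mult.commute)
    qed simp
    also have "\<dots> = (\<Sum>l<N. sol_tr (g l) y * f l x) - (\<Sum>l<N. f l x * g l y)"
      by (simp add: right_diff_distrib sum_subtractf mult.commute)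
    finally show "(e x - e y) * r x = (\<Sum>l<N. sol_tr (g l) y * f l x) + (\<integral>z. k x z * ((e z - e y) * r z) \<partial>M)"
      using eq[of x y] by (simp add: algebra_simps)
  qed
  then have "(e x - e y) * r x = sol (\<lambda>x. \<Sum>l<N. sol_tr (g l) y * f l x) x" by (simp add: fun_eq_iff)
  also have "\<dots> = (\<Sum>l<N. sol_tr (g l) y * sol (f l) x)"
    by (subst sol_sum) (auto simp: f bcont_cmult sol_cmult)
  finally show ?thesis by (simp add: r_def mult.commute)
qed

end

section \<open>Dependence on the endpoints\<close>

text \<open>The weight is \<open>y\<close> to the power \<open>- s\<close>; the case distinction is needed because \<open>0 powr 0 = 0\<close>.\<close>

definition wt :: "real \<Rightarrow> real \<Rightarrow> real" where
  "wt s y = (if s = 0 then 1 else y powr (- s))"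

lemma wt_nonneg [simp]: "0 \<le> wt s y"
  by (simp add: wt_def)

lemma wt_pos: "0 < y \<Longrightarrow> 0 < wt s y"
  by (simp add: wt_def)

lemma borel_measurable_wt [measurable]: "wt s \<in> borel_measurable borel"
  unfolding wt_def by measurable

lemma continuous_on_wt: "\<delta> > 0 \<or> s = 0 \<and> \<delta> = 0 \<Longrightarrow> continuous_on {\<delta>..} (wt s)"
  by (cases "s = 0") (auto simp: wt_def intro!: continuous_intros)

lemma id_mult_wt: "0 \<le> s \<Longrightarrow> 0 \<le> y \<Longrightarrow> y * wt s y = y powr (1 - s)"
  by (cases "y = 0") (auto simp: wt_def powr_diff powr_minus field_simps)

definition prim :: "real \<Rightarrow> (real \<Rightarrow> real) \<Rightarrow> real \<Rightarrow> real" where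
  "prim s h t = integral {0..t} (\<lambda>y. wt s y * h y)"

context
  fixes s :: real assumes s: "0 \<le> s" "s < 1"
begin

lemma wt_set_integrable: "set_integrable lborel {0..t} (wt s)"
proof (cases "0 \<le> t")
  case True
  have "wt s integrable_on {0..t}"
    using has_integral_powr_from_0[of "-s" t] s True unfolding wt_def
    by (cases "s = 0") (auto simp: integrable_on_def)
  then have "wt s absolutely_integrable_on {0..t}"
    by (rule nonnegative_absolutely_integrable_1) simp
  then show ?thesis unfolding set_integrable_def
    by (subst (asm) integrable_completion) auto
qed (simp add: set_integrable_def)

lemma wt_mult_set_integrable:
  assumes h: "h \<in> bcont" and S: "S \<in> sets borel" "S \<subseteq> {0..t}"
  shows "set_integrable lborel S (\<lambda>y. wt s y * h y)"
proof -
  from bcontD(2)[OF h] obtain c where c: "c \<ge> 0" "\<And>x. \<bar>h x\<bar> \<le> c" by blast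
  have hm [measurable]: "h \<in> borel_measurable borel"
    by (rule borel_measurable_continuous_onI[OF bcontD(1)[OF h]])
  have "set_integrable lborel {0..t} (\<lambda>y. c * wt s y)"
    by (intro set_integrable_mult_right wt_set_integrable)
  then have "set_integrable lborel {0..t} (\<lambda>y. wt s y * h y)"
  proof (rule set_integrable_bound)
    show "set_borel_measurable lborel {0..t} (\<lambda>y. wt s y * h y)"
      unfolding set_borel_measurable_def by measurable
    show "AE y in lborel. y \<in> {0..t} \<longrightarrow> norm (wt s y * h y) \<le> norm (c * wt s y)"
      using c by (auto simp: abs_mult mult.commute intro!: mult_right_mono)
  qed
  then show ?thesis by (rule set_integrable_subset) (use S in auto)
qed

lemma wt_mult_integrable_on:
  assumes h: "h \<in> bcont" and "0 \<le> c" shows "(\<lambda>y. wt s y * h y) integrable_on {c..t}"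
  using set_borel_integral_eq_integral(1)[OF wt_mult_set_integrable[OF h, of "{c..t}" t]] assms by auto

lemma prim_diff:
  assumes h: "h \<in> bcont" and "0 \<le> c" "c \<le> d"
  shows "prim s h d - prim s h c = integral {c..d} (\<lambda>y. wt s y * h y)"
  using Henstock_Kurzweil_Integration.integral_combine[OF assms(2,3) wt_mult_integrable_on[OF h order.refl, of d]]
  by (simp add: prim_def)

lemma set_integral_interval:
  assumes h: "h \<in> bcont" and "0 \<le> c" "c \<le> d"
  shows "(LINT y:{c<..<d}|lborel. wt s y * h y) = prim s h d - prim s h c"
proof -
  have "(LINT y:{c<..<d}|lborel. wt s y * h y) = integral {c<..<d} (\<lambda>y. wt s y * h y)"
    by (rule set_borel_integral_eq_integral(2), rule wt_mult_set_integrable[OF h, of _ d]) (use assms in auto)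
  then show ?thesis using prim_diff[OF assms] by (simp add: integral_open_interval_real)
qed

lemma prim_minus:
  assumes "g \<in> bcont" "h \<in> bcont"
  shows "prim s (\<lambda>x. g x - h x) t = prim s g t - prim s h t"
  unfolding prim_def using wt_mult_integrable_on[OF assms(1), of 0 t] wt_mult_integrable_on[OF assms(2), of 0 t]
  by (simp add: right_diff_distrib integral_diff)

text \<open>The primitive of the weight acts as a modulus of continuity common to all
  \<open>h\<close> with the same bound. It is continuous at 0 although the weight may be unbounded
  there.\<close>

lemma prim_diff_bound:
  assumes h: "h \<in> bcont" and hc: "\<And>x. \<bar>h x\<bar> \<le> e" and "0 \<le> c" "0 \<le> d"
  shows "\<bar>prim s h d - prim s h c\<bar> \<le> e * \<bar>prim s (\<lambda>_. 1) d - prim s (\<lambda>_. 1) c\<bar>"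
proof -
  have *: "\<bar>prim s h d - prim s h c\<bar> \<le> e * \<bar>prim s (\<lambda>_. 1) d - prim s (\<lambda>_. 1) c\<bar>" if "0 \<le> c" "c \<le> d" for c d
  proof -
    have "norm (integral {c..d} (\<lambda>y. wt s y * h y)) \<le> integral {c..d} (\<lambda>y. wt s y * e)"
    proof (rule integral_norm_bound_integral)
      show "norm (wt s y * h y) \<le> wt s y * e" for y
        using hc[of y] by (simp add: abs_mult mult_left_mono)
    qed (intro wt_mult_integrable_on h bcont_const that(1))+
    then have "\<bar>integral {c..d} (\<lambda>y. wt s y * h y)\<bar> \<le> e * integral {c..d} (\<lambda>y. wt s y * 1)"
      by (simp add: mult.commute)
    moreover have "0 \<le> integral {c..d} (\<lambda>y. wt s y * 1)"
      by (rule integral_nonneg[OF wt_mult_integrable_on[OF bcont_const that(1)]]) simp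
    ultimately show ?thesis
      by (simp add: prim_diff[OF h that] prim_diff[OF bcont_const that])
  qed
  show ?thesis using *[of c d] *[of d c] assms(3,4) by (cases "c \<le> d") (auto simp: abs_minus_commute)
qed

text \<open>At \<open>c = 0\<close> the primitive of the weight is differentiable only if \<open>s = 0\<close>.\<close>

lemma prim_deriv:
  assumes h: "h \<in> bcont" and c: "0 \<le> c" "0 < c \<or> s = 0"
  shows "(prim s h has_real_derivative wt s c * h c) (at c within {0..})"
proof -
  \<comment> \<open>The left end of the interval stays away from 0, where the weight may be
    discontinuous, except for \<open>c = 0\<close>, where \<open>s = 0\<close> and the weight is
    constant.\<close>
  define \<delta> where "\<delta> = (if c = 0 then 0 else c / 2)"
  have \<delta>: "\<delta> > 0 \<or> s = 0 \<and> \<delta> = 0" "0 \<le> \<delta>" "\<delta> \<le> c" using c by (auto simp: \<delta>_def)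
  have "continuous_on {\<delta>..c+1} (\<lambda>y. wt s y * h y)"
    using continuous_on_subset[OF continuous_on_wt[OF \<delta>(1)], of "{\<delta>..c+1}"]
      continuous_on_subset[OF bcontD(1)[OF h]] by (auto intro!: continuous_on_mult)
  then have "((\<lambda>x. integral {\<delta>..x} (\<lambda>y. wt s y * h y)) has_real_derivative wt s c * h c) (at c within {\<delta>..c+1})"
    by (rule integral_has_real_derivative) (use \<delta> in auto)
  then have "((\<lambda>x. prim s h x - prim s h \<delta>) has_real_derivative wt s c * h c) (at c within {\<delta>..c+1})"
    by (rule has_field_derivative_transform_within[OF _ zero_less_one])
       (use \<delta> in \<open>auto simp: prim_diff[OF h]\<close>)
  then have "((\<lambda>x. (prim s h x - prim s h \<delta>) + prim s h \<delta>) has_real_derivative wt s c * h c + 0) (at c within {\<delta>..c+1})"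
    by (intro DERIV_add) auto
  then have *: "(prim s h has_real_derivative wt s c * h c) (at c within {\<delta>..c+1})" by simp
  have "at c within {0..} = at c within {\<delta>..c+1}"
    by (rule at_within_nhd[of c "if c = 0 then {..<1} else {c/2<..<c+1}"])
       (use c in \<open>auto simp: \<delta>_def\<close>)
  with * show ?thesis by simp
qed

text \<open>The integrand varies with \<open>t\<close> as well, so the fundamental theorem is
  applied to the limit \<open>h\<close> only. Replacing \<open>H t\<close> by \<open>h\<close> costs
  at most their distance times the difference quotient of the primitive of the weight, which is
  bounded near \<open>c\<close>.\<close>

lemma prim_quotient_tendsto:
  assumes S: "S \<subseteq> {0..}" and c: "0 \<le> c" "0 < c \<or> s = 0"
    and H: "\<And>t. t \<in> S \<Longrightarrow> H t \<in> bcont" and h: "h \<in> bcont"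
    and lim: "uniform_limit UNIV H h (at c within S)"
  shows "((\<lambda>t. (prim s (H t) t - prim s (H t) c) / (t - c)) \<longlongrightarrow> wt s c * h c) (at c within S)"
proof -
  let ?D = "\<lambda>h t. (prim s h t - prim s h c) / (t - c)"
  have D: "(?D h \<longlongrightarrow> wt s c * h c) (at c within S)" if "h \<in> bcont" for h
    using DERIV_subset[OF prim_deriv[OF that c] S] unfolding has_field_derivative_iff .
  have D1: "(?D (\<lambda>_. 1) \<longlongrightarrow> wt s c) (at c within S)" using D[OF bcont_const[of 1]] by simp
  have "((\<lambda>t. ?D (H t) t - ?D h t) \<longlongrightarrow> 0) (at c within S)"
  proof (rule tendstoI)
    fix e :: real assume e: "e > 0"
    define e' where "e' = e / (wt s c + 2)"
    have w: "wt s c + 2 > 0" using wt_nonneg[of s c] by linarith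
    have e': "e' > 0" "e' * (wt s c + 1) < e"
      using e w by (auto simp: e'_def field_simps)
    have ev1: "\<forall>\<^sub>F t in at c within S. \<forall>x\<in>UNIV. dist (H t x) (h x) < e'"
      by (rule uniform_limitD[OF lim e'(1)])
    have ev2: "\<forall>\<^sub>F t in at c within S. dist (?D (\<lambda>_. 1) t) (wt s c) < 1"
      using tendstoD[OF D1, of 1] by simp
    have ev3: "\<forall>\<^sub>F t in at c within S. t \<in> S" by (simp add: eventually_at_filter)
    from ev1 ev2 ev3 show "\<forall>\<^sub>F t in at c within S. dist (?D (H t) t - ?D h t) 0 < e"
    proof eventually_elim
      case (elim t)
      have "?D (H t) t - ?D h t = (prim s (\<lambda>x. H t x - h x) t - prim s (\<lambda>x. H t x - h x) c) / (t - c)"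
        using H[OF elim(3)] h by (simp add: prim_minus diff_divide_distrib)
      also have "\<bar>\<dots>\<bar> \<le> e' * \<bar>prim s (\<lambda>_. 1) t - prim s (\<lambda>_. 1) c\<bar> / \<bar>t - c\<bar>"
        unfolding abs_divide using elim S c(1)
        by (intro divide_right_mono prim_diff_bound bcont_diff H h) (auto simp: dist_real_def intro: less_imp_le)
      also have "\<dots> = e' * \<bar>?D (\<lambda>_. 1) t\<bar>" by (simp add: abs_divide)
      also have "\<dots> \<le> e' * (wt s c + 1)"
        using abs_triangle_ineq[of "wt s c" "?D (\<lambda>_. 1) t - wt s c"] elim(2) e'(1) wt_nonneg[of s c]
        by (intro mult_left_mono) (auto simp: dist_real_def simp del: abs_divide)
      finally show ?case using e'(2) by (simp add: dist_real_def)
    qed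
  qed
  from tendsto_add[OF this D[OF h]] show ?thesis by simp
qed

end

section \<open>Endpoint vectors and the weighted measure on the intervals\<close>

lemma
  assumes a: "a \<in> endpoints p"
  shows endpoints_mono: "1 \<le> i \<Longrightarrow> i < j \<Longrightarrow> j \<le> 2 * p \<Longrightarrow> a i < a j"
    and endpoints_nonneg: "1 \<le> i \<Longrightarrow> i \<le> 2 * p \<Longrightarrow> 0 \<le> a i"
proof -
  have st: "a i < a (Suc i)" if "1 \<le> i" "i < 2 * p" for i
    using a that by (auto simp: endpoints_def)
  show mono: "a i < a j" if "1 \<le> i" "i < j" "j \<le> 2 * p" for i j
    using that(2,1,3)
  proof (induction j rule: less_Suc_induct[consumes 1])
    case (1 i) then show ?case using st by simp
  next
    case (2 i j k) then show ?case by force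
  qed
  show "0 \<le> a i" if "1 \<le> i" "i \<le> 2 * p"
    using mono[of 1 i] that a by (cases "i = 1") (auto simp: endpoints_def)
qed

lemma mb_J_borel [measurable]: "mb_J p a \<in> sets borel"
  unfolding mb_J_def by auto

lemma mb_J_subset:
  assumes "a \<in> endpoints p" shows "mb_J p a \<subseteq> {0<..<a (2 * p)}"
proof
  fix x assume "x \<in> mb_J p a"
  then obtain j where j: "j \<in> {1..p}" "a (2 * j - 1) < x" "x < a (2 * j)" by (auto simp: mb_J_def)
  have "0 \<le> a (2 * j - 1)" by (rule endpoints_nonneg[OF assms]) (use j in auto)
  moreover have "a (2 * j) \<le> a (2 * p)"
    using endpoints_mono[OF assms, of "2 * j" "2 * p"] j by (cases "j = p") auto
  ultimately show "x \<in> {0<..<a (2 * p)}" using j by auto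
qed

text \<open>Right ends of the intervals have even indices and left ends odd ones. This is the source
  of the factors \<open>(-1) ^ i\<close> in the differential equations.\<close>

lemma set_integral_mb_J:
  assumes s: "0 \<le> s" "s < 1" and a: "a \<in> endpoints p" and h: "h \<in> bcont"
  shows "(LINT y:mb_J p a|lborel. wt s y * h y) = (\<Sum>i=1..2 * p. (-1) ^ i * prim s h (a i))"
proof -
  have "(LINT y:mb_J p a|lborel. wt s y * h y) =
      (\<Sum>j\<in>{1..p}. LINT y:{a (2 * j - 1)<..<a (2 * j)}|lborel. wt s y * h y)"
    unfolding mb_J_def
  proof (rule set_integral_finite_Union)
    show "disjoint_family_on (\<lambda>j. {a (2 * j - 1)<..<a (2 * j)}) {1..p}"
      unfolding disjoint_family_on_def
    proof (intro ballI impI)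
      have *: "{a (2 * i - 1)<..<a (2 * i)} \<inter> {a (2 * j - 1)<..<a (2 * j)} = {}"
        if "i \<in> {1..p}" "j \<in> {1..p}" "i < j" for i j
      proof -
        have "a (2 * i) \<le> a (2 * j - 1)"
          by (rule less_imp_le, rule endpoints_mono[OF a]) (use that in auto)
        then show ?thesis by auto
      qed
      fix i j assume "i \<in> {1..p}" "j \<in> {1..p}" "i \<noteq> j"
      then show "{a (2 * i - 1)<..<a (2 * i)} \<inter> {a (2 * j - 1)<..<a (2 * j)} = {}"
        using *[of i j] *[of j i] by (cases "i < j") (auto simp: Int_commute)
    qed
    show "set_integrable lborel {a (2 * j - 1)<..<a (2 * j)} (\<lambda>y. wt s y * h y)" if "j \<in> {1..p}" for j
    proof (rule wt_mult_set_integrable[OF s h])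
      have "0 \<le> a (2 * j - 1)" by (rule endpoints_nonneg[OF a]) (use that in auto)
      then show "{a (2 * j - 1)<..<a (2 * j)} \<subseteq> {0..a (2 * j)}" by auto
    qed simp
  qed auto
  also have "\<dots> = (\<Sum>j\<in>{1..p}. prim s h (a (2 * j)) - prim s h (a (2 * j - 1)))"
  proof (rule sum.cong)
    fix j assume j: "j \<in> {1..p}"
    show "(LINT y:{a (2 * j - 1)<..<a (2 * j)}|lborel. wt s y * h y) = prim s h (a (2 * j)) - prim s h (a (2 * j - 1))"
      by (intro set_integral_interval[OF s h] endpoints_nonneg[OF a] less_imp_le[OF endpoints_mono[OF a]])
         (use j in auto)
  qed simp
  also have "\<dots> = (\<Sum>i=1..2 * p. (-1) ^ i * prim s h (a i))"
    by (induction p) (auto simp: algebra_simps)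
  finally show ?thesis .
qed

definition mb_measure :: "real \<Rightarrow> nat \<Rightarrow> (nat \<Rightarrow> real) \<Rightarrow> real measure" where
  "mb_measure s p a = density lborel (\<lambda>y. ennreal (indicator (mb_J p a) y * wt s y))"

lemma integral_mb_measure:
  assumes h: "h \<in> bcont"
  shows "(\<integral>y. h y \<partial>mb_measure s p a) = (LINT y:mb_J p a|lborel. wt s y * h y)"
proof -
  have [measurable]: "h \<in> borel_measurable borel"
    by (rule borel_measurable_continuous_onI[OF bcontD(1)[OF h]])
  show ?thesis
    unfolding mb_measure_def set_lebesgue_integral_def
    by (subst integral_density) (auto simp: mult_ac)
qed

lemma finite_borel_mb_measure:
  assumes s: "0 \<le> s" "s < 1" and a: "a \<in> endpoints p"
  shows "finite_borel (mb_measure s p a)"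
proof (intro finite_borel.intro finite_measureI finite_borel_axioms.intro)
  have "set_integrable lborel (mb_J p a) (\<lambda>y. wt s y * 1)"
    by (rule wt_mult_set_integrable[OF s bcont_const, of _ "a (2 * p)"])
       (use mb_J_subset[OF a] in auto)
  then have "integrable lborel (\<lambda>y. indicator (mb_J p a) y * wt s y)"
    by (simp add: set_integrable_def)
  then have "(\<integral>\<^sup>+ y. ennreal (indicator (mb_J p a) y * wt s y) \<partial>lborel) \<noteq> \<infinity>"
    by (subst nn_integral_eq_integral) auto
  then show "emeasure (mb_measure s p a) (space (mb_measure s p a)) \<noteq> \<infinity>"
    unfolding mb_measure_def by (subst emeasure_density) auto
  show "sets (mb_measure s p a) = sets borel" by (simp add: mb_measure_def)
qed

definition endpoints_upto :: "nat \<Rightarrow> real \<Rightarrow> (nat \<Rightarrow> real) set" where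
  "endpoints_upto p B = {a \<in> endpoints p. a (2 * p) \<le> B}"

lemma endpoints_upto_bounds:
  assumes "a \<in> endpoints_upto p B" "1 \<le> i" "i \<le> 2 * p"
  shows "0 \<le> a i" "a i \<le> B"
proof -
  have a: "a \<in> endpoints p" "a (2 * p) \<le> B" using assms by (auto simp: endpoints_upto_def)
  show "0 \<le> a i" by (rule endpoints_nonneg[OF a(1) assms(2,3)])
  show "a i \<le> B"
    using endpoints_mono[OF a(1) assms(2), of "2 * p"] assms(3) a(2) by (cases "i = 2 * p") auto
qed

section \<open>Solutions as functions of the endpoints\<close>

locale endpoint_system =
  fixes s B :: real and p :: nat and k :: "real \<Rightarrow> real \<Rightarrow> real"
  assumes s: "0 \<le> s" "s < 1" and p: "1 \<le> p" and kernel: "clamped_kernel B k"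
    and nondegenerate: "\<And>a q. a \<in> endpoints_upto p B \<Longrightarrow> q \<in> bcont \<Longrightarrow>
        (\<And>x. q x = (\<integral>y. k x y * q y \<partial>mb_measure s p a)) \<Longrightarrow> q = (\<lambda>_. 0)"
    and nondegenerate_tr: "\<And>a q. a \<in> endpoints_upto p B \<Longrightarrow> q \<in> bcont \<Longrightarrow>
        (\<And>x. q x = (\<integral>y. k y x * q y \<partial>mb_measure s p a)) \<Longrightarrow> q = (\<lambda>_. 0)"
begin

abbreviation "M \<equiv> mb_measure s p"
abbreviation "E \<equiv> endpoints_upto p B"

definition Q :: "(nat \<Rightarrow> real) \<Rightarrow> (real \<Rightarrow> real) \<Rightarrow> real \<Rightarrow> real" where
  "Q a = fredholm_kernel.sol (M a) k"
definition P :: "(nat \<Rightarrow> real) \<Rightarrow> (real \<Rightarrow> real) \<Rightarrow> real \<Rightarrow> real" where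
  "P a = fredholm_kernel.sol (M a) (\<lambda>x y. k y x)"
definition R :: "(nat \<Rightarrow> real) \<Rightarrow> real \<Rightarrow> real \<Rightarrow> real" where
  "R a = fredholm_pair.res (M a) k"

lemma transpose: "endpoint_system s B p (\<lambda>x y. k y x)"
  by (intro endpoint_system.intro s p clamped_kernel_transpose[OF kernel] nondegenerate nondegenerate_tr)

lemma fredholm_pair:
  assumes a: "a \<in> E" shows "fredholm_pair (M a) B k"
proof -
  have fb: "finite_borel (M a)"
    using a by (intro finite_borel_mb_measure s) (simp add: endpoints_upto_def)
  show ?thesis
  proof (intro fredholm_pair.intro fredholm_kernel.intro fredholm_kernel_axioms.intro fb kernel
       clamped_kernel_transpose[OF kernel])
    fix q :: "real \<Rightarrow> real" assume q: "q \<in> bcont"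
    show "q = (\<lambda>_. 0)" if "\<And>x. q x = (\<integral>y. k x y * q y \<partial>M a)" by (rule nondegenerate[OF a q that])
    show "q = (\<lambda>_. 0)" if "\<And>x. q x = (\<integral>y. k y x * q y \<partial>M a)" by (rule nondegenerate_tr[OF a q that])
  qed
qed

lemma Q_bcont: "a \<in> E \<Longrightarrow> h \<in> bcont \<Longrightarrow> Q a h \<in> bcont"
  unfolding Q_def by (rule fredholm_kernel.sol_bcont[OF fredholm_pair.axioms(1)[OF fredholm_pair]])

lemma Q_eq: "a \<in> E \<Longrightarrow> h \<in> bcont \<Longrightarrow> Q a h x = h x + (\<integral>y. k x y * Q a h y \<partial>M a)"
  unfolding Q_def by (rule fredholm_kernel.sol_eq[OF fredholm_pair.axioms(1)[OF fredholm_pair]])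

lemma P_bcont: "a \<in> E \<Longrightarrow> h \<in> bcont \<Longrightarrow> P a h \<in> bcont"
  unfolding P_def by (rule fredholm_kernel.sol_bcont[OF fredholm_pair.axioms(2)[OF fredholm_pair]])

lemma P_eq: "a \<in> E \<Longrightarrow> h \<in> bcont \<Longrightarrow> P a h y = h y + (\<integral>x. k x y * P a h x \<partial>M a)"
  unfolding P_def by (rule fredholm_kernel.sol_eq[OF fredholm_pair.axioms(2)[OF fredholm_pair]])

lemma P_kernel: "a \<in> E \<Longrightarrow> P a (k x) = R a x"
  unfolding P_def R_def by (rule fredholm_pair.res_def[OF fredholm_pair, symmetric])

lemma Q_kernel: "a \<in> E \<Longrightarrow> Q a (\<lambda>x. k x y) x = R a x y"
  unfolding Q_def R_def by (rule fredholm_pair.sol_kernel[OF fredholm_pair])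

lemma R_bcont: "a \<in> E \<Longrightarrow> R a x \<in> bcont"
  unfolding R_def by (rule fredholm_pair.res_bcont[OF fredholm_pair])

lemma kernel_bcont: "k x \<in> bcont" "(\<lambda>x. k x y) \<in> bcont"
  by (rule clamped_kernel_bcont1[OF kernel], rule clamped_kernel_bcont2[OF kernel])

lemma integral_M:
  assumes "a \<in> E" "f \<in> bcont"
  shows "(\<integral>y. f y \<partial>M a) = (\<Sum>i=1..2 * p. (-1) ^ i * prim s f (a i))"
  using assms by (simp add: integral_mb_measure set_integral_mb_J[OF s] endpoints_upto_def)

lemma integral_M_diff:
  assumes "a \<in> E" "a(i := t) \<in> E" and f: "f \<in> bcont" and i: "i \<in> {1..2 * p}"
  shows "(\<integral>y. f y \<partial>M (a(i := t))) - (\<integral>y. f y \<partial>M a) = (-1) ^ i * (prim s f t - prim s f (a i))"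
proof -
  have "(\<Sum>j\<in>{1..2 * p} - {i}. (-1) ^ j * prim s f ((a(i := t)) j)) =
        (\<Sum>j\<in>{1..2 * p} - {i}. (-1) ^ j * prim s f (a j))"
    by (rule sum.cong) auto
  then show ?thesis
    unfolding integral_M[OF assms(1) f] integral_M[OF assms(2) f] sum.remove[OF finite_atLeastAtMost i]
    by (simp add: right_diff_distrib)
qed

text \<open>An exact increment: only one endpoint has moved, so the two measures in
  \<open>perturbation\<close> differ by a signed integral between \<open>a i\<close> and
  \<open>t\<close>.\<close>

lemma bilinear_diff:
  assumes a: "a \<in> E" "a(i := t) \<in> E" and i: "i \<in> {1..2 * p}" and h: "h \<in> bcont" and g: "g \<in> bcont"
  shows "(\<integral>y. g y * Q (a(i := t)) h y \<partial>M (a(i := t))) - (\<integral>y. g y * Q a h y \<partial>M a) =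
    (-1) ^ i * (prim s (\<lambda>y. P a g y * Q (a(i := t)) h y) t - prim s (\<lambda>y. P a g y * Q (a(i := t)) h y) (a i))"
  using fredholm_pair.perturbation[OF fredholm_pair[OF a(1)] fredholm_pair.axioms(1)[OF fredholm_pair[OF a(2)]] h g]
    integral_M_diff[OF a bcont_mult[OF P_bcont[OF a(1) g] Q_bcont[OF a(2) h]] i]
  by (simp add: Q_def P_def)

lemma duality:
  assumes "a \<in> E" "h \<in> bcont" "g \<in> bcont"
  shows "(\<integral>y. g y * Q a h y \<partial>M a) = (\<integral>y. h y * P a g y \<partial>M a)"
  using fredholm_pair.duality[OF fredholm_pair[OF assms(1)] assms(2,3)]
  by (simp add: Q_def P_def mult.commute)

text \<open>The case \<open>g = k x\<close>, for which the solution of the transposed equation is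
  the resolvent kernel \<open>R a x\<close>.\<close>

lemma Q_diff:
  assumes a: "a \<in> E" "a(i := t) \<in> E" and i: "i \<in> {1..2 * p}" and h: "h \<in> bcont"
  shows "Q (a(i := t)) h x - Q a h x =
    (-1) ^ i * (prim s (\<lambda>y. R a x y * Q (a(i := t)) h y) t - prim s (\<lambda>y. R a x y * Q (a(i := t)) h y) (a i))"
  using bilinear_diff[OF a i h kernel_bcont(1)[of x]] Q_eq[OF a(1) h, of x] Q_eq[OF a(2) h, of x]
  by (simp add: P_kernel[OF a(1)])

abbreviation "slice a i \<equiv> {t. a(i := t) \<in> E}"

lemma slice_nonneg: "i \<in> {1..2 * p} \<Longrightarrow> slice a i \<subseteq> {0..}"
proof
  fix t assume "i \<in> {1..2 * p}" "t \<in> slice a i"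
  then show "t \<in> {0..}" using endpoints_upto_bounds(1)[of "a(i := t)" p B i] by auto
qed

lemma eventually_slice: "\<forall>\<^sub>F t in at (a i) within slice a i. a(i := t) \<in> E"
  by (simp add: eventually_at_filter)

text \<open>The exact formula \<open>Q_diff\<close> bounds the change of \<open>Q\<close> by its own supremum times a factor tending
  to \<open>0\<close>, so that the supremum can be absorbed.\<close>

lemma Q_uniform_limit:
  assumes a: "a \<in> E" and i: "i \<in> {1..2 * p}" and h: "h \<in> bcont"
  shows "uniform_limit UNIV (\<lambda>t. Q (a(i := t)) h) (Q a h) (at (a i) within slice a i)"
proof -
  obtain C where C: "C \<ge> 0" "\<And>x y. \<bar>R a x y\<bar> \<le> C"
    using fredholm_pair.res_bounded[OF fredholm_pair[OF a]] unfolding R_def[symmetric] by blast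
  obtain b where b: "b \<ge> 0" "\<And>x. \<bar>Q a h x\<bar> \<le> b"
    using bcontD(2)[OF Q_bcont[OF a h]] by blast
  define \<delta> where "\<delta> t = \<bar>prim s (\<lambda>_. 1) t - prim s (\<lambda>_. 1) (a i)\<bar>" for t
  have ai: "0 \<le> a i" "a i \<le> B" using endpoints_upto_bounds[OF a] i by auto
  \<comment> \<open>The primitive of the weight is continuous at 0 for every \<open>s < 1\<close>,
    so the limit includes the endpoint 0.\<close>
  have "continuous_on {0..B} (prim s (\<lambda>_. 1))"
    unfolding prim_def by (rule indefinite_integral_continuous_1) (rule wt_mult_integrable_on[OF s bcont_const order.refl])
  then have "(prim s (\<lambda>_. 1) \<longlongrightarrow> prim s (\<lambda>_. 1) (a i)) (at (a i) within {0..B})"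
    using ai by (auto simp: continuous_on_def)
  then have "(prim s (\<lambda>_. 1) \<longlongrightarrow> prim s (\<lambda>_. 1) (a i)) (at (a i) within slice a i)"
  proof (rule tendsto_within_subset)
    show "slice a i \<subseteq> {0..B}"
      using endpoints_upto_bounds[of "a(i := t)" p B i for t] i by auto
  qed
  then have "(\<delta> \<longlongrightarrow> \<bar>prim s (\<lambda>_. 1) (a i) - prim s (\<lambda>_. 1) (a i)\<bar>) (at (a i) within slice a i)"
    unfolding \<delta>_def by (intro tendsto_intros)
  then have \<delta>0: "(\<delta> \<longlongrightarrow> 0) (at (a i) within slice a i)" by simp
  have key: "\<bar>Q (a(i := t)) h x - Q a h x\<bar> \<le> 2 * b * C * \<delta> t"
    if t: "a(i := t) \<in> E" and small: "C * \<delta> t \<le> 1/2" for t x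
  proof -
    define n where "n = (SUP x. \<bar>Q (a(i := t)) h x\<bar>)"
    obtain c where c: "\<And>x. \<bar>Q (a(i := t)) h x\<bar> \<le> c" using bcontD(2)[OF Q_bcont[OF t h]] by blast
    have n: "\<bar>Q (a(i := t)) h x\<bar> \<le> n" for x
      unfolding n_def using c by (intro cSUP_upper bdd_aboveI[of _ c]) auto
    have n0: "0 \<le> n" using n[of 0] by linarith
    have t0: "0 \<le> t" using slice_nonneg[OF i] t by auto
    have d: "\<bar>Q (a(i := t)) h x - Q a h x\<bar> \<le> C * n * \<delta> t" for x
    proof -
      have "\<bar>Q (a(i := t)) h x - Q a h x\<bar> =
          \<bar>prim s (\<lambda>y. R a x y * Q (a(i := t)) h y) t - prim s (\<lambda>y. R a x y * Q (a(i := t)) h y) (a i)\<bar>"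
        by (simp add: Q_diff[OF a t i h] abs_mult)
      also have "\<dots> \<le> (C * n) * \<delta> t"
        unfolding \<delta>_def
        by (rule prim_diff_bound[OF s bcont_mult[OF R_bcont[OF a] Q_bcont[OF t h]] _ ai(1) t0])
           (use C n n0 in \<open>simp add: abs_mult mult_mono\<close>)
      finally show ?thesis .
    qed
    have "n \<le> b + n / 2"
      unfolding n_def
    proof (rule cSUP_least)
      fix x
      have "\<bar>Q (a(i := t)) h x\<bar> \<le> b + (C * \<delta> t) * n" using d[of x] b(2)[of x] by (simp add: mult_ac)
      also have "(C * \<delta> t) * n \<le> 1/2 * n" using small n0 by (rule mult_right_mono)
      finally show "\<bar>Q (a(i := t)) h x\<bar> \<le> b + (SUP x. \<bar>Q (a(i := t)) h x\<bar>) / 2" by (simp add: n_def)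
    qed simp
    then have "n \<le> 2 * b" by linarith
    have "\<bar>Q (a(i := t)) h x - Q a h x\<bar> \<le> (C * \<delta> t) * n" using d[of x] by (simp add: mult_ac)
    also have "\<dots> \<le> (C * \<delta> t) * (2 * b)"
      using \<open>n \<le> 2 * b\<close> C(1) by (intro mult_left_mono) (auto simp: \<delta>_def)
    finally show ?thesis by (simp add: mult_ac)
  qed
  have lim: "((\<lambda>t. C * \<delta> t) \<longlongrightarrow> 0) (at (a i) within slice a i)"
    "((\<lambda>t. 2 * b * C * \<delta> t) \<longlongrightarrow> 0) (at (a i) within slice a i)"
    by (auto intro!: tendsto_mult_right_zero \<delta>0)
  show ?thesis
  proof (rule uniform_limitI)
    fix e :: real assume e: "e > 0"
    have "\<forall>\<^sub>F t in at (a i) within slice a i. C * \<delta> t < 1/2"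
      by (rule order_tendstoD(2)[OF lim(1)]) simp
    moreover have "\<forall>\<^sub>F t in at (a i) within slice a i. 2 * b * C * \<delta> t < e"
      by (rule order_tendstoD(2)[OF lim(2) e])
    ultimately show "\<forall>\<^sub>F t in at (a i) within slice a i. \<forall>x\<in>UNIV. dist (Q (a(i := t)) h x) (Q a h x) < e"
      using eventually_slice
    proof eventually_elim
      case (elim t)
      then show ?case using key[of t] by (auto simp: dist_real_def intro: le_less_trans)
    qed
  qed
qed

lemma bcont_bounded_range: "h \<in> bcont \<Longrightarrow> bounded (range h)"
  by (auto simp: bcontfun_def)

lemma R_uniform_limit:
  assumes a: "a \<in> E"
  shows "uniform_limit UNIV (\<lambda>t. R a t) (R a c) (at c within S)"
proof (rule uniform_limitI)
  fix e :: real assume e: "e > 0"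
  from fredholm_pair.res_ucont[OF fredholm_pair[OF a] e] obtain d where
    d: "d > 0" "\<And>x x' y. \<bar>x - x'\<bar> < d \<Longrightarrow> \<bar>R a x y - R a x' y\<bar> < e" unfolding R_def by blast
  show "\<forall>\<^sub>F t in at c within S. \<forall>x\<in>UNIV. dist (R a t x) (R a c x) < e"
    unfolding eventually_at using d by (intro exI[of _ d]) (auto simp: dist_real_def)
qed

text \<open>The factor \<open>G\<close> may depend on \<open>t\<close>, so that the resolvent kernel
  can be taken along the moving endpoint.\<close>

lemma prim_Q_quotient:
  assumes a: "a \<in> E" and i: "i \<in> {1..2 * p}" and ai: "0 < a i \<or> s = 0" and h: "h \<in> bcont"
    and G: "\<And>t. G t \<in> bcont" "uniform_limit UNIV G g (at (a i) within slice a i)" and g: "g \<in> bcont"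
  shows "((\<lambda>t. (prim s (\<lambda>y. G t y * Q (a(i := t)) h y) t - prim s (\<lambda>y. G t y * Q (a(i := t)) h y) (a i)) / (t - a i))
    \<longlongrightarrow> wt s (a i) * (g (a i) * Q a h (a i))) (at (a i) within slice a i)"
  using endpoints_upto_bounds(1)[OF a, of i] i
  by (intro prim_quotient_tendsto[OF s slice_nonneg[OF i]] ai uniform_lim_mult Q_uniform_limit a h G
       bcont_mult Q_bcont bcont_bounded_range g) auto

text \<open>In the limit of \<open>bilinear_diff\<close> the short integral contributes the value of
  its integrand at the endpoint. With \<open>g = k x\<close> this differentiates the solutions;
  transposed, with one of the later functions \<open>f j\<close> for \<open>g\<close>, it
  differentiates the integrals \<open>U\<close> and \<open>V\<close>.\<close>

lemma bilinear_partial: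
  assumes a: "a \<in> E" and i: "i \<in> {1..2 * p}" and ai: "0 < a i \<or> s = 0" and h: "h \<in> bcont" and g: "g \<in> bcont"
  shows "((\<lambda>t. \<integral>y. g y * Q (a(i := t)) h y \<partial>M (a(i := t))) has_real_derivative
     (-1) ^ i * (wt s (a i) * (P a g (a i) * Q a h (a i)))) (at (a i) within slice a i)"
proof -
  have "((\<lambda>t. (-1) ^ i * ((prim s (\<lambda>y. P a g y * Q (a(i := t)) h y) t - prim s (\<lambda>y. P a g y * Q (a(i := t)) h y) (a i)) / (t - a i)))
    \<longlongrightarrow> (-1) ^ i * (wt s (a i) * (P a g (a i) * Q a h (a i)))) (at (a i) within slice a i)"
    by (intro tendsto_mult_left prim_Q_quotient a i ai h P_bcont g uniform_limit_const)
  then show ?thesis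
    unfolding has_field_derivative_iff
  proof (rule Lim_transform_eventually)
    show "\<forall>\<^sub>F t in at (a i) within slice a i.
       (-1) ^ i * ((prim s (\<lambda>y. P a g y * Q (a(i := t)) h y) t - prim s (\<lambda>y. P a g y * Q (a(i := t)) h y) (a i)) / (t - a i))
       = ((\<integral>y. g y * Q (a(i := t)) h y \<partial>M (a(i := t))) - (\<integral>y. g y * Q (a(i := a i)) h y \<partial>M (a(i := a i)))) / (t - a i)"
      using eventually_slice
    proof eventually_elim
      case (elim t)
      then show ?case using bilinear_diff[OF a elim i h g] by simp
    qed
  qed
qed

lemma Q_partial:
  assumes a: "a \<in> E" and i: "i \<in> {1..2 * p}" and ai: "0 < a i \<or> s = 0" and h: "h \<in> bcont"
  shows "((\<lambda>t. Q (a(i := t)) h x) has_real_derivative (-1) ^ i * (wt s (a i) * (R a x (a i) * Q a h (a i))))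
     (at (a i) within slice a i)"
proof -
  have "((\<lambda>t. h x + (\<integral>y. k x y * Q (a(i := t)) h y \<partial>M (a(i := t)))) has_real_derivative
      0 + (-1) ^ i * (wt s (a i) * (P a (k x) (a i) * Q a h (a i)))) (at (a i) within slice a i)"
    by (intro DERIV_add DERIV_const bilinear_partial a i ai h kernel_bcont)
  then have "((\<lambda>t. Q (a(i := t)) h x) has_real_derivative
      0 + (-1) ^ i * (wt s (a i) * (P a (k x) (a i) * Q a h (a i)))) (at (a i) within slice a i)"
    by (rule has_field_derivative_transform_within[OF _ zero_less_one]) (use a h in \<open>auto simp: Q_eq[of _ h x]\<close>)
  then show ?thesis by (simp add: P_kernel[OF a])
qed

text \<open>The change at the moving point splits into the change of the endpoint vector, given by
  \<open>Q_diff\<close>, and the change of the argument in the fixed solution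
  \<open>Q a h\<close>.\<close>

lemma Q_partial_diag:
  assumes a: "a \<in> E" and i: "i \<in> {1..2 * p}" and ai: "0 < a i \<or> s = 0" and h: "h \<in> bcont"
    and D: "(Q a h has_real_derivative D) (at (a i) within slice a i)"
  shows "((\<lambda>t. Q (a(i := t)) h t) has_real_derivative (-1) ^ i * (wt s (a i) * (R a (a i) (a i) * Q a h (a i))) + D)
     (at (a i) within slice a i)"
proof -
  have "((\<lambda>t. (-1) ^ i * ((prim s (\<lambda>y. R a t y * Q (a(i := t)) h y) t - prim s (\<lambda>y. R a t y * Q (a(i := t)) h y) (a i)) / (t - a i))
      + (Q a h t - Q a h (a i)) / (t - a i))
    \<longlongrightarrow> (-1) ^ i * (wt s (a i) * (R a (a i) (a i) * Q a h (a i))) + D) (at (a i) within slice a i)"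
    by (rule tendsto_add[OF tendsto_mult_left[OF prim_Q_quotient[OF a i ai h R_bcont[OF a] R_uniform_limit[OF a] R_bcont[OF a]]]
          D[unfolded has_field_derivative_iff]])
  then show ?thesis
    unfolding has_field_derivative_iff
  proof (rule Lim_transform_eventually)
    show "\<forall>\<^sub>F t in at (a i) within slice a i.
       (-1) ^ i * ((prim s (\<lambda>y. R a t y * Q (a(i := t)) h y) t - prim s (\<lambda>y. R a t y * Q (a(i := t)) h y) (a i)) / (t - a i))
      + (Q a h t - Q a h (a i)) / (t - a i) = (Q (a(i := t)) h t - Q (a(i := a i)) h (a i)) / (t - a i)"
      using eventually_slice
    proof eventually_elim
      case (elim t)
      have "Q (a(i := t)) h t - Q (a(i := a i)) h (a i) =
        (-1) ^ i * (prim s (\<lambda>y. R a t y * Q (a(i := t)) h y) t - prim s (\<lambda>y. R a t y * Q (a(i := t)) h y) (a i))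
         + (Q a h t - Q a h (a i))"
        unfolding Q_diff[OF a elim i h, of t, symmetric] by simp
      then show ?case by (simp only: add_divide_distrib times_divide_eq_right)
    qed
  qed
qed

end

section \<open>Euler derivatives of solutions\<close>

text \<open>Here \<open>h1\<close> stands for \<open>x h'(x)\<close>, which unlike \<open>h'\<close> extends continuously to \<open>0\<close>.\<close>

definition euler_deriv :: "real \<Rightarrow> (real \<Rightarrow> real) \<Rightarrow> (real \<Rightarrow> real) \<Rightarrow> bool" where
  "euler_deriv B h h1 \<longleftrightarrow> (\<forall>x. 0 < x \<longrightarrow> x < B \<longrightarrow> (h has_real_derivative h1 x / x) (at x))"

lemma euler_derivD: "euler_deriv B h h1 \<Longrightarrow> 0 < x \<Longrightarrow> x < B \<Longrightarrow> (h has_real_derivative h1 x / x) (at x)"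
  by (simp add: euler_deriv_def)

text \<open>Differentiation under the integral sign: by the mean value theorem the difference
  quotients of the kernel converge uniformly in \<open>y\<close>.\<close>

lemma (in finite_borel) integral_kernel_deriv:
  assumes k: "clamped_kernel B k" and kx: "clamped_kernel B kx" and q: "q \<in> bcont"
    and der: "\<And>y. euler_deriv B (\<lambda>x. k x y) (\<lambda>x. kx x y)"
  shows "euler_deriv B (\<lambda>x. \<integral>y. k x y * q y \<partial>M) (\<lambda>x. \<integral>y. kx x y * q y \<partial>M)"
  unfolding euler_deriv_def
proof (intro allI impI)
  fix x0 assume x0: "0 < x0" "x0 < B"
  \<comment> \<open>The kernel of the ordinary derivative. The lower bound \<open>x0 / 2\<close> of
    the denominator changes nothing near \<open>x0\<close>, but makes \<open>kd\<close> a clamped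
    kernel on the whole plane.\<close>
  define kd where "kd x y = kx x y / max (x0 / 2) (clamp0 B x)" for x y
  have kd: "clamped_kernel B kd"
    using kx x0 unfolding clamped_kernel_def kd_def by (auto intro!: continuous_intros)
  have kd_eq: "kd x y = kx x y / x" if "x0 / 2 < x" "x < B" for x y
    using that x0 by (simp add: kd_def)
  have Dk: "((\<lambda>x. k x y) has_real_derivative kd x y) (at x)" if "x0 / 2 < x" "x < B" for x y
    using euler_derivD[OF der[of y], of x] that x0 by (simp add: kd_eq)
  obtain c where c: "c \<ge> 0" "\<And>y. \<bar>q y\<bar> \<le> c" using bcontD(2)[OF q] by blast
  have bc: "(\<lambda>y. k x y * q y) \<in> bcont" "(\<lambda>y. kd x y * q y) \<in> bcont" for x
    by (intro bcont_mult clamped_kernel_bcont1[OF k] clamped_kernel_bcont1[OF kd] q)+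
  let ?F = "\<lambda>x. \<integral>y. k x y * q y \<partial>M"
  have "((\<lambda>x. (?F x - ?F x0) / (x - x0)) \<longlongrightarrow> (\<integral>y. kd x0 y * q y \<partial>M)) (at x0)"
  proof (rule tendstoI)
    fix e :: real assume e: "e > 0"
    define e' where "e' = e / (c * measure M UNIV + 1)"
    have nn: "0 \<le> c * measure M UNIV" using c by simp
    have e': "e' > 0" "e' * (c * measure M UNIV) < e"
      using e nn by (auto simp: e'_def field_simps)
    from clamped_kernel_ucont[OF kd e'(1)] obtain d where
      d: "d > 0" "\<And>x x' y. \<bar>x - x'\<bar> < d \<Longrightarrow> \<bar>kd x y - kd x' y\<bar> < e'" by blast
    define d' where "d' = min d (min (x0 / 2) (B - x0))"
    have d': "d' > 0" using d x0 by (simp add: d'_def)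
    have "dist ((?F x - ?F x0) / (x - x0)) (\<integral>y. kd x0 y * q y \<partial>M) < e"
      if x: "x \<noteq> x0" "dist x x0 < d'" for x
    proof -
      have bd: "\<bar>(k x y - k x0 y) / (x - x0) - kd x0 y\<bar> \<le> e'" for y
      proof -
        have *: "\<exists>z. z \<in> closed_segment x0 x \<and> k x y - k x0 y = (x - x0) * kd z y"
        proof -
          have rng: "z \<in> closed_segment x0 x \<Longrightarrow> x0 / 2 < z \<and> z < B" for z
            using x x0 by (auto simp: closed_segment_eq_real_ivl d'_def dist_real_def abs_if split: if_splits)
          show ?thesis
          proof (cases "x0 < x")
            case True
            have "\<exists>z>x0. z < x \<and> k x y - k x0 y = (x - x0) * kd z y"
              by (rule MVT2[OF True]) (use Dk rng True in \<open>auto simp: closed_segment_eq_real_ivl\<close>)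
            then obtain z where z: "z > x0" "z < x" "k x y - k x0 y = (x - x0) * kd z y" by blast
            then show ?thesis using True by (intro exI[of _ z]) (auto simp: closed_segment_eq_real_ivl)
          next
            case False
            then have lt: "x < x0" using x by simp
            have "\<exists>z>x. z < x0 \<and> k x0 y - k x y = (x0 - x) * kd z y"
              by (rule MVT2[OF lt]) (use Dk rng lt in \<open>auto simp: closed_segment_eq_real_ivl\<close>)
            then obtain z where z: "z > x" "z < x0" "k x0 y - k x y = (x0 - x) * kd z y" by blast
            then have "k x y - k x0 y = (x - x0) * kd z y" by (simp add: algebra_simps)
            then show ?thesis using z lt by (intro exI[of _ z]) (auto simp: closed_segment_eq_real_ivl)
          qed
        qed
        then obtain z where z: "z \<in> closed_segment x0 x" "k x y - k x0 y = (x - x0) * kd z y" by blast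
        have "\<bar>z - x0\<bar> < d" using z(1) x
          by (auto simp: closed_segment_eq_real_ivl d'_def dist_real_def abs_if split: if_splits)
        from d(2)[OF this, of y] z(2) x show ?thesis by simp
      qed
      have "(?F x - ?F x0) / (x - x0) - (\<integral>y. kd x0 y * q y \<partial>M) =
          (\<integral>y. ((k x y - k x0 y) / (x - x0) - kd x0 y) * q y \<partial>M)"
      proof -
        have "((k x y - k x0 y) / (x - x0) - kd x0 y) * q y =
            (1 / (x - x0)) * (k x y * q y - k x0 y * q y) - kd x0 y * q y" for y
          by (simp add: algebra_simps diff_divide_distrib)
        then show ?thesis by (simp add: integrable_bcont bc)
      qed
      also have "\<bar>\<dots>\<bar> \<le> (e' * c) * measure M UNIV"
      proof (rule abs_integral_le)
        have "(\<lambda>y. (1 / (x - x0)) * (k x y - k x0 y) - kd x0 y) \<in> bcont"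
          by (intro bcont_diff bcont_cmult clamped_kernel_bcont1[OF k] clamped_kernel_bcont1[OF kd])
        then show "(\<lambda>y. ((k x y - k x0 y) / (x - x0) - kd x0 y) * q y) \<in> bcont"
          by (intro bcont_mult q) simp
        show "\<bar>((k x y - k x0 y) / (x - x0) - kd x0 y) * q y\<bar> \<le> e' * c" for y
          unfolding abs_mult using bd[of y] c e'(1) by (intro mult_mono) auto
      qed
      finally show ?thesis using e'(2) by (simp add: dist_real_def mult.assoc)
    qed
    then show "\<forall>\<^sub>F x in at x0. dist ((?F x - ?F x0) / (x - x0)) (\<integral>y. kd x0 y * q y \<partial>M) < e"
      unfolding eventually_at using d' by blast
  qed
  then have "(?F has_real_derivative (\<integral>y. kd x0 y * q y \<partial>M)) (at x0)"
    by (simp add: has_field_derivative_iff)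
  also have "(\<integral>y. kd x0 y * q y \<partial>M) = (\<integral>y. kx x0 y * q y \<partial>M) / x0"
  proof -
    have "(\<lambda>y. kd x0 y * q y) = (\<lambda>y. kx x0 y * q y / x0)" using x0 by (simp add: kd_eq fun_eq_iff)
    then show ?thesis by simp
  qed
  finally show "(?F has_real_derivative (\<integral>y. kx x0 y * q y \<partial>M) / x0) (at x0)" .
qed

context endpoint_system
begin

lemma transpose_Q: "endpoint_system.Q s p (\<lambda>x y. k y x) = P"
  by (simp add: fun_eq_iff endpoint_system.Q_def[OF transpose] P_def)

lemma transpose_P: "endpoint_system.P s p (\<lambda>x y. k y x) = Q"
  by (simp add: fun_eq_iff endpoint_system.P_def[OF transpose] Q_def)

lemma transpose_R: "a \<in> E \<Longrightarrow> endpoint_system.R s p (\<lambda>x y. k y x) a x y = R a y x"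
  using endpoint_system.P_kernel[OF transpose, of a x] Q_kernel[of a x y]
  by (simp add: transpose_P)

lemma Q_unique:
  assumes "a \<in> E" "h \<in> bcont" "q \<in> bcont" "\<And>x. q x = h x + (\<integral>y. k x y * q y \<partial>M a)"
  shows "q = Q a h"
  unfolding Q_def
  by (rule fredholm_kernel.sol_unique[OF fredholm_pair.axioms(1)[OF fredholm_pair] assms(2-4)]) fact

lemma Q_add: "a \<in> E \<Longrightarrow> g \<in> bcont \<Longrightarrow> h \<in> bcont \<Longrightarrow> Q a (\<lambda>x. g x + h x) x = Q a g x + Q a h x"
  unfolding Q_def by (rule fredholm_kernel.sol_add[OF fredholm_pair.axioms(1)[OF fredholm_pair]])

lemma Q_diff_fun: "a \<in> E \<Longrightarrow> g \<in> bcont \<Longrightarrow> h \<in> bcont \<Longrightarrow> Q a (\<lambda>x. g x - h x) x = Q a g x - Q a h x"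
  unfolding Q_def by (rule fredholm_kernel.sol_diff[OF fredholm_pair.axioms(1)[OF fredholm_pair]])

lemma Q_cmult: "a \<in> E \<Longrightarrow> h \<in> bcont \<Longrightarrow> Q a (\<lambda>x. c * h x) x = c * Q a h x"
  unfolding Q_def by (rule fredholm_kernel.sol_cmult[OF fredholm_pair.axioms(1)[OF fredholm_pair]])

lemma Q_sum: "a \<in> E \<Longrightarrow> (\<And>i. i \<in> A \<Longrightarrow> h i \<in> bcont) \<Longrightarrow> Q a (\<lambda>x. \<Sum>i\<in>A. h i x) x = (\<Sum>i\<in>A. Q a (h i) x)"
  unfolding Q_def by (rule fredholm_kernel.sol_sum[OF fredholm_pair.axioms(1)[OF fredholm_pair]])

lemma finite_borel_M: "a \<in> E \<Longrightarrow> finite_borel (M a)"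
  by (intro finite_borel_mb_measure s) (simp add: endpoints_upto_def)

lemma integrable_M: "a \<in> E \<Longrightarrow> h \<in> bcont \<Longrightarrow> integrable (M a) h"
  by (rule finite_borel.integrable_bcont[OF finite_borel_M])

end

text \<open>The assumption \<open>rank_one\<close> is the infinitesimal form of the scaling property of the kernel; it replaces
  the commutator of the integral operator with the Euler operator.\<close>

locale euler_system = endpoint_system +
  fixes kx ky :: "real \<Rightarrow> real \<Rightarrow> real" and u v :: "real \<Rightarrow> real"
  assumes kx: "clamped_kernel B kx" and ky: "clamped_kernel B ky"
    and u: "u \<in> bcont" and v: "v \<in> bcont"
    and deriv_kx: "\<And>y. euler_deriv B (\<lambda>x. k x y) (\<lambda>x. kx x y)"
    and deriv_ky: "\<And>x. euler_deriv B (\<lambda>y. k x y) (\<lambda>y. ky x y)"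
    and rank_one: "\<And>x y. kx x y + ky x y + (1 - s) * k x y = u x * v y"
begin

lemma euler_transpose: "euler_system s B p (\<lambda>x y. k y x) (\<lambda>x y. ky y x) (\<lambda>x y. kx y x) v u"
proof (intro euler_system.intro transpose euler_system_axioms.intro clamped_kernel_transpose[OF kx]
       clamped_kernel_transpose[OF ky] u v deriv_kx deriv_ky)
  show "ky y x + kx y x + (1 - s) * k y x = v x * u y" for x y
    using rank_one[of y x] mult.commute[of "u y" "v x"] by linarith
qed

text \<open>The Euler derivative that the solution must have, found by differentiating the integral
  equation in its first variable.\<close>

definition Q' :: "(nat \<Rightarrow> real) \<Rightarrow> (real \<Rightarrow> real) \<Rightarrow> (real \<Rightarrow> real) \<Rightarrow> real \<Rightarrow> real" where
  "Q' a h h1 x = h1 x + (\<integral>y. kx x y * Q a h y \<partial>M a)"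

lemma Q'_bcont: "a \<in> E \<Longrightarrow> h \<in> bcont \<Longrightarrow> h1 \<in> bcont \<Longrightarrow> Q' a h h1 \<in> bcont"
proof -
  assume a: "a \<in> E" and h: "h \<in> bcont" "h1 \<in> bcont"
  interpret finite_borel "M a" by (rule finite_borel_M[OF a])
  have "Q' a h h1 = (\<lambda>x. h1 x + intop kx (Q a h) x)" by (simp add: fun_eq_iff Q'_def intop_def)
  then show "Q' a h h1 \<in> bcont" by (simp only: bcont_add h intop_bcont[OF kx Q_bcont[OF a]])
qed

lemma Q_euler_deriv:
  assumes a: "a \<in> E" and h: "h \<in> bcont" and der: "euler_deriv B h h1"
  shows "euler_deriv B (Q a h) (Q' a h h1)"
  unfolding euler_deriv_def
proof (intro allI impI)
  fix x assume x: "0 < x" "x < B"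
  have "((\<lambda>x. h x + (\<integral>y. k x y * Q a h y \<partial>M a)) has_real_derivative
     h1 x / x + (\<integral>y. kx x y * Q a h y \<partial>M a) / x) (at x)"
    by (intro DERIV_add euler_derivD[OF der x]
      euler_derivD[OF finite_borel.integral_kernel_deriv[OF finite_borel_M[OF a] kernel kx Q_bcont[OF a h] deriv_kx] x])
  then show "(Q a h has_real_derivative Q' a h h1 x / x) (at x)"
    unfolding Q_eq[OF a h, symmetric] by (simp add: Q'_def add_divide_distrib)
qed

text \<open>Integration by parts with \<open>y * wt s y = y powr (1 - s)\<close>: the weight
  contributes the term \<open>(1 - s) * k\<close>, and the primitive \<open>?F\<close> vanishes at 0
  because \<open>s < 1\<close>.\<close>

lemma integral_euler:
  assumes a: "a \<in> E" and q: "q \<in> bcont" and r: "r \<in> bcont" and der: "euler_deriv B q r"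
  shows "(\<integral>y. ((1 - s) * k x y + ky x y) * q y + k x y * r y \<partial>M a) =
    (\<Sum>i=1..2 * p. (-1) ^ i * (a i * wt s (a i) * (k x (a i) * q (a i))))"
proof -
  let ?f = "\<lambda>y. ((1 - s) * k x y + ky x y) * q y + k x y * r y"
  let ?F = "\<lambda>y. y powr (1 - s) * (k x y * q y)"
  have f: "?f \<in> bcont"
    by (intro bcont_add bcont_mult bcont_const kernel_bcont clamped_kernel_bcont1[OF ky] q r)
  have kq: "continuous_on UNIV (\<lambda>y. k x y * q y)" by (intro bcontD(1) bcont_mult kernel_bcont q)
  have prim: "prim s ?f t = ?F t" if t: "0 \<le> t" "t \<le> B" for t
  proof -
    have "((\<lambda>y. wt s y * ?f y) has_integral ?F t - ?F 0) {0..t}"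
    proof (rule fundamental_theorem_of_calculus_interior[OF t(1)])
      show "continuous_on {0..t} ?F"
        using s by (intro continuous_intros continuous_on_powr' continuous_on_subset[OF kq]) auto
      fix y assume y: "y \<in> {0<..<t}"
      then have y': "0 < y" "y < B" using t by auto
      have "(?F has_real_derivative ((1 - s) * y powr (1 - s - 1)) * (k x y * q y)
          + (ky x y / y * q y + r y / y * k x y) * y powr (1 - s)) (at y)"
        by (intro DERIV_mult has_real_derivative_powr y' euler_derivD[OF deriv_ky] euler_derivD[OF der])
      also have "((1 - s) * y powr (1 - s - 1)) * (k x y * q y)
          + (ky x y / y * q y + r y / y * k x y) * y powr (1 - s) = wt s y * ?f y"
      proof -
        have w: "y powr (1 - s - 1) = wt s y" "y powr (1 - s) = y * wt s y"
          using y' id_mult_wt[OF s(1), of y] by (auto simp: wt_def)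
        show ?thesis unfolding w using y'(1) by (simp add: algebra_simps)
      qed
      finally show "(?F has_vector_derivative wt s y * ?f y) (at y)"
        by (simp add: has_real_derivative_iff_has_vector_derivative)
    qed
    then show ?thesis using s by (simp add: prim_def integral_unique)
  qed
  have "(\<integral>y. ?f y \<partial>M a) = (\<Sum>i=1..2 * p. (-1) ^ i * prim s ?f (a i))" by (rule integral_M[OF a f])
  also have "\<dots> = (\<Sum>i=1..2 * p. (-1) ^ i * (a i * wt s (a i) * (k x (a i) * q (a i))))"
  proof (rule sum.cong)
    fix i assume "i \<in> {1..2 * p}"
    then have "0 \<le> a i" "a i \<le> B" using endpoints_upto_bounds[OF a] by auto
    then show "(-1) ^ i * prim s ?f (a i) = (-1) ^ i * (a i * wt s (a i) * (k x (a i) * q (a i)))"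
      by (simp only: prim id_mult_wt[OF s(1)])
  qed simp
  finally show ?thesis .
qed

text \<open>Integrating by parts, the Euler derivative of a solution solves the same integral equation; its
  right-hand side acquires a multiple of \<open>u\<close> and the boundary terms at the endpoints.\<close>

lemma Q_euler:
  assumes a: "a \<in> E" and h: "h \<in> bcont" and h1: "h1 \<in> bcont" and der: "euler_deriv B h h1"
  shows "Q' a h h1 x = Q a h1 x + (\<integral>y. v y * Q a h y \<partial>M a) * Q a u x
    - (\<Sum>i=1..2 * p. (-1) ^ i * (a i * wt s (a i) * Q a h (a i)) * R a x (a i))"
proof -
  define q r where "q = Q a h" and "r = Q' a h h1"
  define c where "c = (\<integral>y. v y * q y \<partial>M a)"
  define e where "e i = (-1) ^ i * (a i * wt s (a i) * q (a i))" for i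
  have q: "q \<in> bcont" unfolding q_def by (rule Q_bcont[OF a h])
  have r: "r \<in> bcont" unfolding r_def by (rule Q'_bcont[OF a h h1])
  have dq: "euler_deriv B q r" unfolding q_def r_def by (rule Q_euler_deriv[OF a h der])
  have bc: "(\<lambda>x. c * u x) \<in> bcont" "(\<lambda>x. h1 x + c * u x) \<in> bcont"
     "(\<lambda>x. \<Sum>i=1..2 * p. e i * k x (a i)) \<in> bcont"
    by (intro bcont_add bcont_cmult bcont_sum h1 u kernel_bcont)+
  have "r = Q a (\<lambda>x. (h1 x + c * u x) - (\<Sum>i=1..2 * p. e i * k x (a i)))"
  proof (rule Q_unique[OF a _ r])
    show "(\<lambda>x. (h1 x + c * u x) - (\<Sum>i=1..2 * p. e i * k x (a i))) \<in> bcont" by (intro bcont_diff bc)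
    fix x
    have int: "integrable (M a) (\<lambda>y. v y * q y)" "integrable (M a) (\<lambda>y. kx x y * q y)" "integrable (M a) (\<lambda>y. k x y * r y)"
      by (intro integrable_M[OF a] bcont_mult v q r kernel_bcont clamped_kernel_bcont1[OF kx])+
    have "((1 - s) * k x y + ky x y) * q y + k x y * r y = u x * (v y * q y) - kx x y * q y + k x y * r y" for y
    proof -
      have "(1 - s) * k x y + ky x y = u x * v y - kx x y" using rank_one[of x y] by simp
      then show ?thesis by (simp only:) (simp add: algebra_simps)
    qed
    then have "(\<integral>y. ((1 - s) * k x y + ky x y) * q y + k x y * r y \<partial>M a) =
        u x * c - (\<integral>y. kx x y * q y \<partial>M a) + (\<integral>y. k x y * r y \<partial>M a)"
      using int by (simp add: c_def)
    moreover have "r x = h1 x + (\<integral>y. kx x y * q y \<partial>M a)" by (simp add: r_def Q'_def q_def)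
    moreover have "(\<Sum>i=1..2 * p. (-1) ^ i * (a i * wt s (a i) * (k x (a i) * q (a i)))) = (\<Sum>i=1..2 * p. e i * k x (a i))"
      by (intro sum.cong) (auto simp: e_def)
    ultimately show "r x = (h1 x + c * u x) - (\<Sum>i=1..2 * p. e i * k x (a i)) + (\<integral>y. k x y * r y \<partial>M a)"
      using integral_euler[OF a q r dq, of x] by (simp add: mult.commute)
  qed
  then have "r x = Q a (\<lambda>x. (h1 x + c * u x) - (\<Sum>i=1..2 * p. e i * k x (a i))) x" by simp
  also have "\<dots> = (Q a h1 x + c * Q a u x) - (\<Sum>i=1..2 * p. e i * R a x (a i))"
    by (simp only: Q_diff_fun[OF a bc(2,3)] Q_add[OF a h1 bc(1)] Q_cmult[OF a u]
       Q_sum[OF a bcont_cmult[OF kernel_bcont(2)]] Q_cmult[OF a kernel_bcont(2)] Q_kernel[OF a])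
  finally show ?thesis by (simp add: r_def c_def q_def e_def)
qed

end

context endpoint_system
begin

text \<open>Multiplication by the variable commutes with the integral operator up to finite rank,
  because \<open>(x - y) * k\<close> is a finite sum of products. It handles the equations in which
  \<open>x * f 0 x\<close> and \<open>y * g (N - 1) y\<close> occur.\<close>

lemma Q_mult_clamp0:
  fixes F G :: "nat \<Rightarrow> real \<Rightarrow> real"
  assumes a: "a \<in> E" and h: "h \<in> bcont"
    and F: "\<And>l. l < N \<Longrightarrow> F l \<in> bcont" and G: "\<And>l. l < N \<Longrightarrow> G l \<in> bcont"
    and int: "\<And>x y. (clamp0 B x - clamp0 B y) * k x y = (\<Sum>l<N. F l x * G l y)"
  shows "Q a (\<lambda>x. clamp0 B x * h x) x = clamp0 B x * Q a h x - (\<Sum>l<N. Q a (F l) x * (\<integral>y. G l y * Q a h y \<partial>M a))"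
proof -
  let ?e = "clamp0 B"
  define q where "q = Q a h"
  define c where "c l = (\<integral>y. G l y * q y \<partial>M a)" for l
  have q: "q \<in> bcont" unfolding q_def by (rule Q_bcont[OF a h])
  have B: "0 \<le> B" using kernel by (simp add: clamped_kernel_def)
  have e: "?e \<in> bcont" using bcont_clamp0[of "\<lambda>x. x" B] B by simp
  have eh: "(\<lambda>x. ?e x * h x) \<in> bcont" by (intro bcont_mult e h)
  have cF: "(\<lambda>x. \<Sum>l<N. c l * F l x) \<in> bcont" by (intro bcont_sum bcont_cmult F) simp
  have eq: "?e x * q x = (?e x * h x + (\<Sum>l<N. c l * F l x)) + (\<integral>y. k x y * (?e y * q y) \<partial>M a)" for x
  proof -
    have "k x y * (?e y * q y) = ?e x * (k x y * q y) - (\<Sum>l<N. F l x * (G l y * q y))" for y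
    proof -
      have "k x y * (?e y * q y) = ?e x * (k x y * q y) - ((?e x - ?e y) * k x y) * q y" by (simp add: algebra_simps)
      then show ?thesis unfolding int by (simp add: sum_distrib_right mult.assoc)
    qed
    then have "(\<integral>y. k x y * (?e y * q y) \<partial>M a) = (\<integral>y. ?e x * (k x y * q y) - (\<Sum>l<N. F l x * (G l y * q y)) \<partial>M a)"
      by simp
    also have "\<dots> = ?e x * (\<integral>y. k x y * q y \<partial>M a) - (\<Sum>l<N. F l x * c l)"
    proof -
      have ig: "integrable (M a) (\<lambda>y. G l y * q y)" if "l < N" for l
        by (intro integrable_M[OF a] bcont_mult q G that)
      have ik: "integrable (M a) (\<lambda>y. k x y * q y)" by (intro integrable_M[OF a] bcont_mult kernel_bcont q)
      show ?thesis unfolding c_def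
        by (subst Bochner_Integration.integral_diff) (auto simp: integral_sum ig ik)
    qed
    also have "(\<integral>y. k x y * q y \<partial>M a) = q x - h x" using Q_eq[OF a h, of x] by (simp add: q_def)
    also have "(\<Sum>l<N. F l x * c l) = (\<Sum>l<N. c l * F l x)" by (simp add: mult.commute)
    finally show ?thesis by (simp add: right_diff_distrib)
  qed
  have "(\<lambda>x. ?e x * q x) = Q a (\<lambda>x. ?e x * h x + (\<Sum>l<N. c l * F l x))"
    by (rule Q_unique[OF a bcont_add[OF eh cF] bcont_mult[OF e q] eq])
  then have "?e x * q x = Q a (\<lambda>x. ?e x * h x + (\<Sum>l<N. c l * F l x)) x" by (simp add: fun_eq_iff)
  also have "\<dots> = Q a (\<lambda>x. ?e x * h x) x + Q a (\<lambda>x. \<Sum>l<N. c l * F l x) x"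
    by (rule Q_add[OF a eh cF])
  also have "Q a (\<lambda>x. \<Sum>l<N. c l * F l x) x = (\<Sum>l<N. c l * Q a (F l) x)"
    by (subst Q_sum[OF a]) (auto intro!: sum.cong bcont_cmult F simp: Q_cmult[OF a F])
  finally show ?thesis by (simp add: q_def c_def mult.commute)
qed

end

text \<open>What the differential equations use of the special functions. Removing the weight from
  the \<open>\<phi>\<close> adds \<open>s * f j\<close> to their Euler derivatives.\<close>

locale ide_system = euler_system +
  fixes N n :: nat and \<beta> :: "nat \<Rightarrow> real" and f g :: "nat \<Rightarrow> real \<Rightarrow> real"
  assumes N: "2 \<le> N"
    and f: "\<And>j. j < N \<Longrightarrow> f j \<in> bcont" and g: "\<And>j. j < N \<Longrightarrow> g j \<in> bcont"
    and integrable_form: "\<And>x y. (clamp0 B x - clamp0 B y) * k x y = (\<Sum>l<N. f l x * g l y)"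
    and u_eq: "u = (\<lambda>x. - ((-1) ^ n) * f 0 x)" and v_eq: "v = g (N - 1)"
    and f_euler: "\<And>j. j + 1 < N \<Longrightarrow> euler_deriv B (f j) (\<lambda>x. s * f j x - f (j + 1) x)"
    and f_euler_last: "euler_deriv B (f (N - 1))
       (\<lambda>x. s * f (N - 1) x - (-1) ^ n * (clamp0 B x * f 0 x) + (\<Sum>i<N. \<beta> i * f i x))"
    and g_euler: "\<And>j. 1 \<le> j \<Longrightarrow> j < N \<Longrightarrow> euler_deriv B (g j) (\<lambda>y. g (j - 1) y - \<beta> j * g (N - 1) y)"
    and g_euler_0: "euler_deriv B (g 0) (\<lambda>y. (-1) ^ n * (clamp0 B y * g (N - 1) y))"
    and \<beta>_0: "\<beta> 0 = 0"
begin

section \<open>Euler equations for the solutions of both integral equations\<close>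

definition "X a j = Q a (f j)"
definition "Y a j = P a (g j)"
definition "U a j = (-1) ^ n * (\<integral>x. f 0 x * Y a j x \<partial>M a) + \<beta> j"
definition "V a j = (-1) ^ n * (\<integral>x. f j x * Y a (N - 1) x \<partial>M a)"

lemma clamp0_bcont: "clamp0 B \<in> bcont"
  using bcont_clamp0[of "\<lambda>x. x" B] kernel by (simp add: clamped_kernel_def)

lemma V_eq: "a \<in> E \<Longrightarrow> j < N \<Longrightarrow> (\<integral>y. v y * X a j y \<partial>M a) = (-1) ^ n * V a j"
  using duality[of a "f j" v] f[of j] g[of "N - 1"] N by (simp add: X_def Y_def V_def v_eq)

lemma f0_Y: "a \<in> E \<Longrightarrow> j < N \<Longrightarrow> (\<integral>y. f 0 y * Y a j y \<partial>M a) = (-1) ^ n * (U a j - \<beta> j)"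
  by (simp add: U_def)

lemma R_form:
  assumes a: "a \<in> E" shows "(clamp0 B x - clamp0 B y) * R a x y = (\<Sum>l<N. X a l x * Y a l y)"
  using fredholm_pair.res_integrable_form[OF fredholm_pair[OF a] f g clamp0_bcont integrable_form]
  by (simp add: R_def X_def Y_def Q_def P_def)

text \<open>The boundary terms of the integration by parts. The one at the endpoint where the
  function is evaluated will be cancelled by the derivative with respect to that endpoint.\<close>

definition "edge a x h = (\<Sum>i=1..2 * p. (-1) ^ i * (a i * wt s (a i) * h (a i)) * R a x (a i))"
definition "edge_tr a y h = (\<Sum>i=1..2 * p. (-1) ^ i * (a i * wt s (a i) * h (a i)) * R a (a i) y)"

lemma Q_u: "a \<in> E \<Longrightarrow> Q a u x = - ((-1) ^ n) * X a 0 x"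
  using Q_cmult[of a "f 0" "- ((-1) ^ n)" x] f[of 0] N by (simp add: u_eq X_def)

lemma X_euler:
  assumes a: "a \<in> E" and j: "j + 1 < N"
  shows "euler_deriv B (X a j) (\<lambda>x. s * X a j x - X a (j + 1) x - V a j * X a 0 x - edge a x (X a j))"
proof -
  have fj: "f j \<in> bcont" "f (j + 1) \<in> bcont" using f j by auto
  let ?h1 = "\<lambda>x. s * f j x - f (j + 1) x"
  have h1: "?h1 \<in> bcont" by (intro bcont_diff bcont_cmult fj)
  have "Q' a (f j) ?h1 x = s * X a j x - X a (j + 1) x - V a j * X a 0 x - edge a x (X a j)" for x
  proof -
    have "Q a ?h1 x = s * X a j x - X a (j + 1) x"
      unfolding Q_diff_fun[OF a bcont_cmult[OF fj(1)] fj(2)] Q_cmult[OF a fj(1)] X_def ..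
    moreover have "(\<integral>y. v y * Q a (f j) y \<partial>M a) * Q a u x = - (V a j * X a 0 x)"
      using V_eq[OF a, of j] j by (simp add: Q_u[OF a] X_def[symmetric] mult.assoc mult.left_commute)
    moreover have "edge a x (X a j) =
        (\<Sum>i=1..2 * p. (-1) ^ i * (a i * wt s (a i) * Q a (f j) (a i)) * R a x (a i))"
      by (simp add: edge_def X_def)
    ultimately show ?thesis
      using Q_euler[OF a fj(1) h1 f_euler[OF j], of x] by linarith
  qed
  then have "Q' a (f j) ?h1 = (\<lambda>x. s * X a j x - X a (j + 1) x - V a j * X a 0 x - edge a x (X a j))" by (rule ext)
  with Q_euler_deriv[OF a fj(1) f_euler[OF j]] show ?thesis by (simp only: X_def[of a j, symmetric])
qed

text \<open>The \<open>\<beta> i\<close> in the equation of \<open>f (N - 1)\<close> turn into the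
  \<open>U a i\<close>: taking the factor \<open>x\<close> out of the solution for
  \<open>x * f 0 x\<close> leaves the integrals of \<open>g l * Q a (f 0)\<close>, which by duality
  are \<open>(-1) ^ n * (U a l - \<beta> l)\<close>.\<close>

lemma X_euler_last:
  assumes a: "a \<in> E"
  shows "euler_deriv B (X a (N - 1)) (\<lambda>x. s * X a (N - 1) x + ((-1) ^ (n + 1) * clamp0 B x - V a (N - 1)) * X a 0 x
     + (\<Sum>i<N. U a i * X a i x) - edge a x (X a (N - 1)))"
proof -
  have f0: "f 0 \<in> bcont" "f (N - 1) \<in> bcont" using f N by auto
  let ?h0 = "\<lambda>x. clamp0 B x * f 0 x" let ?h2 = "\<lambda>x. \<Sum>i<N. \<beta> i * f i x"
  have h0: "?h0 \<in> bcont" by (intro bcont_mult clamp0_bcont f0)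
  have h2: "?h2 \<in> bcont" by (intro bcont_sum bcont_cmult f) auto
  have h3: "(\<lambda>x. s * f (N - 1) x - (-1) ^ n * ?h0 x) \<in> bcont" by (intro bcont_diff bcont_cmult f0 h0)
  have h1: "(\<lambda>x. s * f (N - 1) x - (-1) ^ n * ?h0 x + ?h2 x) \<in> bcont" by (intro bcont_add h3 h2)
  have "Q' a (f (N - 1)) (\<lambda>x. s * f (N - 1) x - (-1) ^ n * ?h0 x + ?h2 x) x =
      s * X a (N - 1) x + ((-1) ^ (n + 1) * clamp0 B x - V a (N - 1)) * X a 0 x
     + (\<Sum>i<N. U a i * X a i x) - edge a x (X a (N - 1))" for x
  proof -
    have "Q a ?h2 x = (\<Sum>i<N. \<beta> i * X a i x)"
      by (subst Q_sum[OF a]) (auto intro!: sum.cong bcont_cmult f simp: Q_cmult[OF a f] X_def)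
    moreover have "Q a ?h0 x = clamp0 B x * X a 0 x - (\<Sum>l<N. X a l x * ((-1) ^ n * (U a l - \<beta> l)))"
    proof -
      have "(\<integral>y. g l y * Q a (f 0) y \<partial>M a) = (-1) ^ n * (U a l - \<beta> l)" if "l < N" for l
        using duality[OF a f0(1) g[OF that]] f0_Y[OF a that] by (simp add: Y_def)
      then show ?thesis
        using Q_mult_clamp0[OF a f0(1) f g integrable_form, where x = x] by (simp add: X_def cong: sum.cong_simp)
    qed
    ultimately have "Q a (\<lambda>x. s * f (N - 1) x - (-1) ^ n * ?h0 x + ?h2 x) x = s * X a (N - 1) x
        - (-1) ^ n * (clamp0 B x * X a 0 x) + (\<Sum>i<N. U a i * X a i x)"
      unfolding Q_add[OF a h3 h2] Q_diff_fun[OF a bcont_cmult[OF f0(2)] bcont_cmult[OF h0]]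
        Q_cmult[OF a f0(2)] Q_cmult[OF a h0]
      by (simp add: X_def[symmetric] right_diff_distrib sum_distrib_left sum_subtractf left_diff_distrib mult_ac flip: power_add)
    moreover have "(\<integral>y. v y * Q a (f (N - 1)) y \<partial>M a) * Q a u x = - V a (N - 1) * X a 0 x"
      using V_eq[OF a, of "N - 1"] N by (simp add: Q_u[OF a] X_def[symmetric] mult_ac flip: power_add)
    moreover have "edge a x (X a (N - 1)) =
        (\<Sum>i=1..2 * p. (-1) ^ i * (a i * wt s (a i) * Q a (f (N - 1)) (a i)) * R a x (a i))"
      by (simp add: edge_def X_def)
    ultimately show ?thesis
      using Q_euler[OF a f0(2) h1 f_euler_last, of x] by (simp add: algebra_simps)
  qed
  then have "Q' a (f (N - 1)) (\<lambda>x. s * f (N - 1) x - (-1) ^ n * ?h0 x + ?h2 x) =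
      (\<lambda>x. s * X a (N - 1) x + ((-1) ^ (n + 1) * clamp0 B x - V a (N - 1)) * X a 0 x
     + (\<Sum>i<N. U a i * X a i x) - edge a x (X a (N - 1)))" by (rule ext)
  with Q_euler_deriv[OF a f0(2) f_euler_last] show ?thesis
    by (simp only: X_def[of a "N - 1", symmetric])
qed

text \<open>Transposition exchanges \<open>u\<close> with \<open>v\<close> and the two Euler
  derivatives of the kernel, so the results on \<open>Q\<close> become results on
  \<open>P\<close>.\<close>

interpretation tr: euler_system s B p "\<lambda>x y. k y x" "\<lambda>x y. ky y x" "\<lambda>x y. kx y x" v u
  by (rule euler_transpose)

lemma P_v: "P a v x = Y a (N - 1) x"
  by (simp add: v_eq Y_def)

lemma P_euler:
  assumes a: "a \<in> E" and j: "j < N" and h1: "h1 \<in> bcont" and der: "euler_deriv B (g j) h1"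
  shows "euler_deriv B (Y a j) (\<lambda>y. P a h1 y - (U a j - \<beta> j) * Y a (N - 1) y - edge_tr a y (Y a j))"
proof -
  have "(\<integral>y. u y * Y a j y \<partial>M a) = - (U a j - \<beta> j)"
    using f0_Y[OF a j] by (simp add: u_eq mult.assoc)
  then have "tr.Q' a (g j) h1 y = P a h1 y - (U a j - \<beta> j) * Y a (N - 1) y - edge_tr a y (Y a j)" for y
    using tr.Q_euler[OF a g[OF j] h1 der, of y] transpose_R[OF a]
    by (simp add: transpose_Q P_v edge_tr_def left_diff_distrib flip: Y_def)
  then have "tr.Q' a (g j) h1 = (\<lambda>y. P a h1 y - (U a j - \<beta> j) * Y a (N - 1) y - edge_tr a y (Y a j))" by (rule ext)
  with tr.Q_euler_deriv[OF a g[OF j] der] show ?thesis by (simp add: transpose_Q flip: Y_def)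
qed

lemma Y_euler:
  assumes a: "a \<in> E" and j: "1 \<le> j" "j < N"
  shows "euler_deriv B (Y a j) (\<lambda>y. Y a (j - 1) y - U a j * Y a (N - 1) y - edge_tr a y (Y a j))"
proof -
  have gj: "g (j - 1) \<in> bcont" "g (N - 1) \<in> bcont" using g j by auto
  have "P a (\<lambda>y. g (j - 1) y - \<beta> j * g (N - 1) y) y = Y a (j - 1) y - \<beta> j * Y a (N - 1) y" for y
    using tr.Q_diff_fun[OF a gj(1) bcont_cmult[OF gj(2)], of "\<beta> j" y] tr.Q_cmult[OF a gj(2), of "\<beta> j" y]
    by (simp add: transpose_Q Y_def)
  with P_euler[OF a j(2) bcont_diff[OF gj(1) bcont_cmult[OF gj(2)]] g_euler[OF j]]
  show ?thesis by (simp add: left_diff_distrib)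
qed

lemma Y_euler_0:
  assumes a: "a \<in> E"
  shows "euler_deriv B (Y a 0) (\<lambda>y. (\<Sum>i<N. V a i * Y a i y) + ((-1) ^ n * clamp0 B y - U a 0) * Y a (N - 1) y
     - edge_tr a y (Y a 0))"
proof -
  have N0: "0 < N" "N - 1 < N" using N by auto
  let ?h = "\<lambda>y. clamp0 B y * g (N - 1) y"
  have h: "?h \<in> bcont" by (intro bcont_mult clamp0_bcont g N0)
  \<comment> \<open>Exchanging the variables reverses the sign of \<open>x - y\<close>; it is
    absorbed into the \<open>f l\<close>.\<close>
  have int': "(clamp0 B x - clamp0 B y) * k y x = (\<Sum>l<N. g l x * (- 1 * f l y))" for x y
  proof -
    have "(clamp0 B x - clamp0 B y) * k y x = - ((clamp0 B y - clamp0 B x) * k y x)" by (simp add: algebra_simps)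
    then show ?thesis unfolding integrable_form by (simp add: sum_negf mult.commute)
  qed
  have V: "(\<integral>x. - 1 * f l x * Y a (N - 1) x \<partial>M a) = - ((-1) ^ n * V a l)" for l
    by (simp add: V_def)
  have "P a (\<lambda>y. (-1) ^ n * ?h y) y = (-1) ^ n * clamp0 B y * Y a (N - 1) y + (\<Sum>i<N. V a i * Y a i y)" for y
  proof -
    have "P a ?h y = clamp0 B y * Y a (N - 1) y - (\<Sum>l<N. Y a l y * (- ((-1) ^ n * V a l)))"
      using tr.Q_mult_clamp0[OF a g[OF N0(2)] g bcont_cmult[OF f, of _ "-1"] int', where x = y]
      unfolding transpose_Q Y_def[symmetric] V by simp
    moreover have "P a (\<lambda>y. (-1) ^ n * ?h y) y = (-1) ^ n * P a ?h y"
      using tr.Q_cmult[OF a h, of "(-1) ^ n" y] by (simp add: transpose_Q)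
    ultimately show ?thesis
      by (simp add: distrib_left sum_negf sum_distrib_left mult_ac flip: power_add)
  qed
  with P_euler[OF a N0(1) bcont_cmult[OF h] g_euler_0] \<beta>_0
  show ?thesis by (simp add: algebra_simps)
qed

end

section \<open>Residue expansion of the Meijer G-function\<close>

text \<open>The denominator is written with the entire function \<open>rGamma\<close>, so that only
  the factors from \<open>A\<close> have poles.\<close>

definition mellin :: "real list \<Rightarrow> real list \<Rightarrow> complex \<Rightarrow> complex" where
  "mellin A D u = (\<Prod>\<beta>\<leftarrow>A. Gamma (of_real \<beta> + u)) * (\<Prod>\<beta>\<leftarrow>D. rGamma (1 - of_real \<beta> - u))"

lemma meijer_integrand_eq:
  "meijer_integrand k \<beta>s z u = mellin (take k \<beta>s) (drop k \<beta>s) u * of_real z powr (- u)"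
proof -
  have "1 / (\<Prod>\<beta>\<leftarrow>D. Gamma (1 - of_real \<beta> - u)) = (\<Prod>\<beta>\<leftarrow>D. rGamma (1 - of_real \<beta> - u))" for D
    by (induction D) (simp_all add: rGamma_inverse_Gamma divide_inverse inverse_mult_distrib)
  from this[of "drop k \<beta>s"] show ?thesis
    by (simp add: meijer_integrand_def mellin_def divide_inverse)
qed

text \<open>At the negative integers both sides are 0 by the default value of \<open>Gamma\<close>.
  At \<open>w = 0\<close> they would be 1 and 0.\<close>

lemma Gamma_plus1_nonzero: "w \<noteq> 0 \<Longrightarrow> Gamma (w + 1) = w * Gamma (w :: complex)"
proof (cases "w \<in> \<int>\<^sub>\<le>\<^sub>0")
  case True
  assume "w \<noteq> 0"
  moreover from True obtain q where q: "w = - of_nat q" by (auto elim: nonpos_Ints_cases')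
  ultimately obtain q' where "q = Suc q'" by (cases q) auto
  then have "w + 1 = - of_nat q'" using q by simp
  then have "w + 1 \<in> \<int>\<^sub>\<le>\<^sub>0" by simp
  then show ?thesis using True by (simp add: Gamma_eq_zero_iff[THEN iffD2])
qed (simp add: Gamma_plus1)

text \<open>The functional equation of the Gamma function, where each reciprocal factor contributes
  a sign. The identity yields both the recurrence of the residues, hence the differential equations,
  and the decay of the integrand to the left.\<close>

lemma mellin_shift:
  assumes "\<And>\<beta>. \<beta> \<in> set A \<Longrightarrow> u \<noteq> 1 - of_real \<beta>"
  shows "mellin A D (u - 1) * (\<Prod>\<beta>\<leftarrow>A @ D. u - 1 + of_real \<beta>) = (-1) ^ length D * mellin A D u"
proof -
  have A: "(\<Prod>\<beta>\<leftarrow>A. Gamma (of_real \<beta> + (u - 1))) * (\<Prod>\<beta>\<leftarrow>A. u - 1 + of_real \<beta>) = (\<Prod>\<beta>\<leftarrow>A. Gamma (of_real \<beta> + u))"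
    using assms
  proof (induction A)
    case (Cons \<beta> A)
    have "of_real \<beta> + (u - 1) \<noteq> 0" using Cons.prems[of \<beta>] by (auto simp: algebra_simps)
    from Gamma_plus1_nonzero[OF this]
    have "Gamma (of_real \<beta> + (u - 1)) * (u - 1 + of_real \<beta>) = Gamma (of_real \<beta> + u)" by (simp add: algebra_simps)
    then show ?case using Cons by (simp add: mult_ac)
  qed simp
  have D: "(\<Prod>\<beta>\<leftarrow>D. rGamma (1 - of_real \<beta> - (u - 1))) * (\<Prod>\<beta>\<leftarrow>D. u - 1 + of_real \<beta>) =
      (-1) ^ length D * (\<Prod>\<beta>\<leftarrow>D. rGamma (1 - of_real \<beta> - u))"
  proof (induction D)
    case (Cons \<beta> D)
    have 1: "rGamma (1 - of_real \<beta> - (u - 1)) * (u - 1 + of_real \<beta>) = - rGamma (1 - of_real \<beta> - u)"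
      using rGamma_plus1[of "1 - of_real \<beta> - u"] by (simp add: algebra_simps)
    have "(\<Prod>\<beta>\<leftarrow>\<beta> # D. rGamma (1 - of_real \<beta> - (u - 1))) * (\<Prod>\<beta>\<leftarrow>\<beta> # D. u - 1 + of_real \<beta>) =
        (rGamma (1 - of_real \<beta> - (u - 1)) * (u - 1 + of_real \<beta>)) *
        ((\<Prod>\<beta>\<leftarrow>D. rGamma (1 - of_real \<beta> - (u - 1))) * (\<Prod>\<beta>\<leftarrow>D. u - 1 + of_real \<beta>))"
      by (simp only: list.map prod_list.Cons mult_ac)
    also have "\<dots> = (-1) ^ length (\<beta> # D) * (\<Prod>\<beta>\<leftarrow>\<beta> # D. rGamma (1 - of_real \<beta> - u))"
      unfolding 1 Cons.IH by simp
    finally show ?case .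
  qed simp
  have "mellin A D (u - 1) * (\<Prod>\<beta>\<leftarrow>A @ D. u - 1 + of_real \<beta>) =
     ((\<Prod>\<beta>\<leftarrow>A. Gamma (of_real \<beta> + (u - 1))) * (\<Prod>\<beta>\<leftarrow>A. u - 1 + of_real \<beta>)) *
     ((\<Prod>\<beta>\<leftarrow>D. rGamma (1 - of_real \<beta> - (u - 1))) * (\<Prod>\<beta>\<leftarrow>D. u - 1 + of_real \<beta>))"
    by (simp add: mellin_def mult_ac)
  then show ?thesis unfolding A D by (simp add: mellin_def mult_ac)
qed

text \<open>Parameters in \<open>A\<close> do not differ by integers, so the poles are simple and
  the expansion contains no logarithms.\<close>

locale meijer_simple =
  fixes A D :: "real list"
  assumes distinct: "distinct A" and not_int: "\<And>x y. x \<in> set A \<Longrightarrow> y \<in> set A \<Longrightarrow> x \<noteq> y \<Longrightarrow> x - y \<notin> \<int>"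
    and nonempty: "A \<noteq> []"
begin

definition pole :: "real \<Rightarrow> nat \<Rightarrow> complex" where
  "pole e r = - of_real e - of_nat r"

text \<open>The residue of \<open>mellin A D\<close> at \<open>pole e r\<close>.\<close>

definition res_coeff :: "real \<Rightarrow> nat \<Rightarrow> complex" where
  "res_coeff e r = (-1) ^ r / fact r * (\<Prod>\<beta>\<in>set A - {e}. Gamma (of_real \<beta> + pole e r)) *
     (\<Prod>\<beta>\<leftarrow>D. rGamma (1 - of_real \<beta> - pole e r))"

lemma pole_Gamma: "of_real \<beta> + u \<in> \<int>\<^sub>\<le>\<^sub>0 \<longleftrightarrow> (\<exists>r. u = pole \<beta> r)"
proof
  assume "of_real \<beta> + u \<in> \<int>\<^sub>\<le>\<^sub>0"
  then obtain r where "of_real \<beta> + u = - of_nat r" by (auto elim: nonpos_Ints_cases')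
  then have "u = pole \<beta> r" by (simp add: pole_def algebra_simps eq_neg_iff_add_eq_0)
  then show "\<exists>r. u = pole \<beta> r" ..
qed (auto simp: pole_def)

lemma pole_inj:
  assumes "e \<in> set A" "e' \<in> set A" "pole e r = pole e' r'" shows "e = e' \<and> r = r'"
proof -
  have "complex_of_real (e - e') = of_real (real r' - real r)" using assms(3) by (simp add: pole_def algebra_simps)
  then have eq: "e - e' = real r' - real r" using of_real_eq_iff by blast
  then have "e - e' \<in> \<int>" by simp
  with not_int[OF assms(1,2)] have "e = e'" by blast
  with eq show ?thesis by simp
qed

lemma mellin_holomorphic:
  assumes "\<And>e r. e \<in> set A \<Longrightarrow> pole e r \<notin> S"
  shows "mellin A D holomorphic_on S"
proof -
  have "(\<lambda>u. \<Prod>\<beta>\<leftarrow>xs. Gamma (of_real \<beta> + u)) holomorphic_on S" if "set xs \<subseteq> set A" for xs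
    using that assms pole_Gamma by (induction xs) (auto intro!: holomorphic_intros)
  moreover have "(\<lambda>u. \<Prod>\<beta>\<leftarrow>xs. rGamma (1 - of_real \<beta> - u)) holomorphic_on S" for xs
    by (induction xs) (auto intro!: holomorphic_intros)
  ultimately show ?thesis unfolding mellin_def by (intro holomorphic_on_mult) auto
qed

lemma mellin_residue_tendsto:
  assumes e: "e \<in> set A"
  shows "((\<lambda>u. mellin A D u * (u - pole e r)) \<longlongrightarrow> res_coeff e r) (at (pole e r))"
proof -
  have "((\<lambda>u. Gamma (u + of_real e) * (u + of_real e + of_nat r)) \<longlongrightarrow> (-1) ^ r / fact r) (at (- of_nat r - of_real e :: complex))"
    by (rule LIM_offset[OF Gamma_residues])
  moreover have "- of_nat r - of_real e = pole e r" by (simp add: pole_def)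
  moreover have "Gamma (u + of_real e) * (u + of_real e + of_nat r) = Gamma (of_real e + u) * (u - pole e r)" for u
    by (simp add: pole_def add_ac)
  ultimately have 1: "((\<lambda>u. Gamma (of_real e + u) * (u - pole e r)) \<longlongrightarrow> (-1) ^ r / fact r) (at (pole e r))"
    by (simp only:)
  have 2: "((\<lambda>u. \<Prod>\<beta>\<in>set A - {e}. Gamma (of_real \<beta> + u)) \<longlongrightarrow> (\<Prod>\<beta>\<in>set A - {e}. Gamma (of_real \<beta> + pole e r))) (at (pole e r))"
  proof (intro tendsto_prod tendsto_Gamma tendsto_intros)
    fix \<beta> assume "\<beta> \<in> set A - {e}"
    then show "of_real \<beta> + pole e r \<notin> \<int>\<^sub>\<le>\<^sub>0"
      using pole_inj[OF e, of \<beta> r] by (auto simp: pole_Gamma)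
  qed
  have 3: "((\<lambda>u. \<Prod>\<beta>\<leftarrow>xs. rGamma (1 - of_real \<beta> - u)) \<longlongrightarrow> (\<Prod>\<beta>\<leftarrow>xs. rGamma (1 - of_real \<beta> - pole e r))) (at (pole e r))" for xs
  proof (induction xs)
    case (Cons \<beta> xs)
    have "isCont (\<lambda>u. rGamma (1 - of_real \<beta> - u)) (pole e r)" by (intro isCont_rGamma continuous_intros)
    then show ?case using Cons by (simp add: isCont_def tendsto_mult)
  qed simp
  have "mellin A D u * (u - pole e r) = Gamma (of_real e + u) * (u - pole e r) *
     (\<Prod>\<beta>\<in>set A - {e}. Gamma (of_real \<beta> + u)) * (\<Prod>\<beta>\<leftarrow>D. rGamma (1 - of_real \<beta> - u))" for u
    using e prod.remove[of "set A" e "\<lambda>\<beta>. Gamma (of_real \<beta> + u)"]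
    by (simp add: mellin_def prod.distinct_set_conv_list[OF distinct, symmetric] mult_ac)
  then show ?thesis unfolding res_coeff_def by (simp only:) (intro tendsto_mult 1 2 3)
qed

text \<open>Multiplied by \<open>u - pole e r\<close>, the two sides of \<open>mellin_shift\<close>
  have these limits at the pole.\<close>

lemma res_coeff_Suc:
  assumes e: "e \<in> set A"
  shows "res_coeff e (Suc r) * (\<Prod>\<beta>\<leftarrow>A @ D. of_real \<beta> - of_real e - of_nat (Suc r)) = (-1) ^ length D * res_coeff e r"
proof (rule tendsto_unique)
  let ?p = "pole e r"
  show "((\<lambda>u. (-1) ^ length D * (mellin A D u * (u - ?p))) \<longlongrightarrow> (-1) ^ length D * res_coeff e r) (at ?p)"
    by (intro tendsto_mult_left mellin_residue_tendsto e)
  have "((\<lambda>u. mellin A D (u + (-1)) * (u + (-1) - pole e (Suc r))) \<longlongrightarrow> res_coeff e (Suc r)) (at (pole e (Suc r) - (-1)))"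
    by (rule LIM_offset[OF mellin_residue_tendsto[OF e]])
  moreover have "pole e (Suc r) - (-1) = ?p" by (simp add: pole_def)
  moreover have "mellin A D (u + (-1)) * (u + (-1) - pole e (Suc r)) = mellin A D (u - 1) * (u - ?p)" for u
    by (simp add: pole_def)
  ultimately have 1: "((\<lambda>u. mellin A D (u - 1) * (u - ?p)) \<longlongrightarrow> res_coeff e (Suc r)) (at ?p)"
    by (simp only:)
  have 2: "((\<lambda>u. \<Prod>\<beta>\<leftarrow>xs. u - 1 + of_real \<beta>) \<longlongrightarrow> (\<Prod>\<beta>\<leftarrow>xs. of_real \<beta> - of_real e - of_nat (Suc r))) (at ?p)" for xs
  proof (induction xs)
    case (Cons \<beta> xs)
    have "((\<lambda>u. u - 1 + of_real \<beta>) \<longlongrightarrow> ?p - 1 + of_real \<beta>) (at ?p)" by (intro tendsto_intros)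
    also have "?p - 1 + of_real \<beta> = of_real \<beta> - of_real e - of_nat (Suc r)" by (simp add: pole_def)
    finally show ?case using Cons by (simp add: tendsto_mult)
  qed simp
  have "((\<lambda>u. mellin A D (u - 1) * (u - ?p) * (\<Prod>\<beta>\<leftarrow>A @ D. u - 1 + of_real \<beta>)) \<longlongrightarrow>
      res_coeff e (Suc r) * (\<Prod>\<beta>\<leftarrow>A @ D. of_real \<beta> - of_real e - of_nat (Suc r))) (at ?p)"
    by (intro tendsto_mult 1 2)
  moreover have "\<forall>\<^sub>F u in at ?p. mellin A D (u - 1) * (u - ?p) * (\<Prod>\<beta>\<leftarrow>A @ D. u - 1 + of_real \<beta>) =
      (-1) ^ length D * (mellin A D u * (u - ?p))"
  proof -
    \<comment> \<open>The points excluded in \<open>mellin_shift\<close> are finitely many, so a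
      punctured neighbourhood of the pole avoids them.\<close>
    have "open (- ((\<lambda>\<beta>. 1 - complex_of_real \<beta>) ` set A - {?p}))"
      by (rule open_Compl, rule finite_imp_closed) simp
    then have "\<forall>\<^sub>F u in at ?p. u \<notin> (\<lambda>\<beta>. 1 - complex_of_real \<beta>) ` set A"
      unfolding eventually_at_topological
      by (intro exI[of _ "- ((\<lambda>\<beta>. 1 - complex_of_real \<beta>) ` set A - {?p})"] conjI) auto
    then show ?thesis
    proof eventually_elim
      case (elim u)
      have "mellin A D (u - 1) * (u - ?p) * (\<Prod>\<beta>\<leftarrow>A @ D. u - 1 + of_real \<beta>) =
        (mellin A D (u - 1) * (\<Prod>\<beta>\<leftarrow>A @ D. u - 1 + of_real \<beta>)) * (u - ?p)" by (simp only: mult_ac)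
      also have "\<dots> = ((-1) ^ length D * mellin A D u) * (u - ?p)"
        by (subst mellin_shift) (use elim in auto)
      finally show ?case by (simp only: mult_ac)
    qed
  qed
  ultimately show "((\<lambda>u. (-1) ^ length D * (mellin A D u * (u - ?p))) \<longlongrightarrow>
      res_coeff e (Suc r) * (\<Prod>\<beta>\<leftarrow>A @ D. of_real \<beta> - of_real e - of_nat (Suc r))) (at ?p)"
    by (rule Lim_transform_eventually)
qed simp

lemma norm_prod_list_ge:
  fixes h :: "real \<Rightarrow> complex"
  assumes "xs \<noteq> []" "1 \<le> t" "\<And>\<beta>. \<beta> \<in> set xs \<Longrightarrow> t \<le> norm (h \<beta>)"
  shows "t \<le> norm (\<Prod>\<beta>\<leftarrow>xs. h \<beta>)"
  using assms
proof (induction xs)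
  case (Cons \<beta> xs)
  show ?case
  proof (cases "xs = []")
    case False
    then have "t \<le> norm (\<Prod>\<beta>\<leftarrow>xs. h \<beta>)" using Cons by auto
    then have "t * 1 \<le> norm (h \<beta>) * norm (\<Prod>\<beta>\<leftarrow>xs. h \<beta>)"
      using Cons.prems by (intro mult_mono) auto
    then show ?thesis by (simp add: norm_mult)
  qed (use Cons in auto)
qed simp

text \<open>The product in the recurrence grows at least linearly in \<open>r\<close>, so the ratio
  of successive terms tends to 0.\<close>

lemma res_coeff_summable:
  assumes e: "e \<in> set A"
  shows "summable (\<lambda>r. norm (res_coeff e r * z ^ r))"
proof -
  define K where "K = Max ((\<lambda>\<beta>. \<bar>\<beta> - e\<bar>) ` set (A @ D))"
  have K: "\<bar>\<beta> - e\<bar> \<le> K" if "\<beta> \<in> set (A @ D)" for \<beta>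
    unfolding K_def using that by (intro Max_ge) auto
  \<comment> \<open>From \<open>N\<close> on the product is at least \<open>1 + 2 * norm z\<close>.
    This gives the ratio 1/2; the summand 1 is for \<open>norm_prod_list_ge\<close>.\<close>
  obtain N where N: "real N \<ge> K + 1 + 2 * norm z" using real_arch_simple by blast
  show ?thesis
  proof (rule summable_ratio_test[of "1/2" N])
    fix r assume r: "N \<le> r"
    define t where "t = real (Suc r) - K"
    have t: "1 + 2 * norm z \<le> t" using N r by (simp add: t_def)
    have t1: "1 \<le> t" using t norm_ge_zero[of z] by linarith
    have "t \<le> norm (\<Prod>\<beta>\<leftarrow>A @ D. complex_of_real \<beta> - of_real e - of_nat (Suc r))"
    proof (rule norm_prod_list_ge[OF _ t1])
      fix \<beta> assume "\<beta> \<in> set (A @ D)"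
      then have "t \<le> \<bar>\<beta> - e - real (Suc r)\<bar>" using K[of \<beta>] by (simp add: t_def)
      also have "\<dots> = norm (complex_of_real (\<beta> - e - real (Suc r)))" by (simp only: norm_of_real)
      finally show "t \<le> norm (complex_of_real \<beta> - of_real e - of_nat (Suc r))" by simp
    qed (use nonempty in auto)
    then have "norm (res_coeff e (Suc r)) * t \<le>
        norm (res_coeff e (Suc r) * (\<Prod>\<beta>\<leftarrow>A @ D. complex_of_real \<beta> - of_real e - of_nat (Suc r)))"
      unfolding norm_mult by (intro mult_left_mono) auto
    also have "\<dots> = norm (res_coeff e r)" unfolding res_coeff_Suc[OF e] by (simp add: norm_mult norm_power)
    finally have le: "norm (res_coeff e (Suc r)) * t \<le> norm (res_coeff e r)" .
    have "norm (res_coeff e (Suc r)) * (2 * norm z) \<le> norm (res_coeff e (Suc r)) * t"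
      using t by (intro mult_left_mono) auto
    with le have "norm (res_coeff e (Suc r)) * (2 * norm z) \<le> norm (res_coeff e r)" by linarith
    then have "norm (res_coeff e (Suc r)) * (2 * norm z) * norm (z ^ r) \<le> norm (res_coeff e r) * norm (z ^ r)"
      by (intro mult_right_mono) auto
    then show "norm (norm (res_coeff e (Suc r) * z ^ Suc r)) \<le> 1/2 * norm (norm (res_coeff e r * z ^ r))"
      by (simp add: norm_mult mult_ac)
  qed simp
qed

definition integrand :: "real \<Rightarrow> complex \<Rightarrow> complex" where
  "integrand z u = mellin A D u * of_real z powr (- u)"

lemma integrand_holomorphic:
  assumes "0 < z" "\<And>e r. e \<in> set A \<Longrightarrow> pole e r \<notin> S"
  shows "integrand z holomorphic_on S"
  unfolding integrand_def using assms(1)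
  by (intro holomorphic_on_mult mellin_holomorphic assms(2) holomorphic_intros) auto

text \<open>This stands in for Stirling's formula: step number \<open>r + 1\<close> to the left
  divides by a product whose factors all have modulus at least \<open>r + 1\<close>, so
  \<open>r\<close> steps gain a factorial.\<close>

lemma integrand_shift_bound:
  assumes z: "0 < z" and u: "\<And>\<beta>. \<beta> \<in> set (A @ D) \<Longrightarrow> Re u + \<beta> \<le> 0"
  shows "norm (integrand z (u - of_nat r)) \<le> z ^ r / fact r * norm (integrand z u)"
proof (induction r)
  case (Suc r)
  define w where "w = u - of_nat r"
  have w: "Re w + \<beta> \<le> - real r" if "\<beta> \<in> set (A @ D)" for \<beta>
    using u[OF that] by (simp add: w_def)
  have "integrand z (w - 1) * (\<Prod>\<beta>\<leftarrow>A @ D. w - 1 + of_real \<beta>) =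
      (mellin A D (w - 1) * (\<Prod>\<beta>\<leftarrow>A @ D. w - 1 + of_real \<beta>)) * of_real z powr (- (w - 1))"
    by (simp only: integrand_def mult_ac)
  also have "of_real z powr (- (w - 1)) = of_real z powr (- w) * of_real z"
    using z powr_add[of "of_real z" "- w" 1] by simp
  also have "mellin A D (w - 1) * (\<Prod>\<beta>\<leftarrow>A @ D. w - 1 + of_real \<beta>) = (-1) ^ length D * mellin A D w"
  proof (rule mellin_shift)
    fix \<beta> assume "\<beta> \<in> set A"
    then show "w \<noteq> 1 - of_real \<beta>" using w[of \<beta>] by auto
  qed
  finally have eq: "norm (integrand z (w - 1)) * norm (\<Prod>\<beta>\<leftarrow>A @ D. w - 1 + of_real \<beta>) = z * norm (integrand z w)"
    using z unfolding norm_mult[symmetric] by (simp add: integrand_def norm_mult norm_power)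
  have "real (Suc r) \<le> norm (\<Prod>\<beta>\<leftarrow>A @ D. w - 1 + of_real \<beta>)"
  proof (rule norm_prod_list_ge)
    fix \<beta> assume "\<beta> \<in> set (A @ D)"
    from w[OF this] have "real (Suc r) \<le> \<bar>Re (w - 1 + of_real \<beta>)\<bar>" by simp
    also have "\<dots> \<le> norm (w - 1 + of_real \<beta>)" by (rule abs_Re_le_cmod)
    finally show "real (Suc r) \<le> norm (w - 1 + of_real \<beta>)" .
  qed (use nonempty in auto)
  then have "norm (integrand z (w - 1)) * real (Suc r) \<le> z * norm (integrand z w)"
    unfolding eq[symmetric] by (intro mult_left_mono) auto
  also have "\<dots> \<le> z * (z ^ r / fact r * norm (integrand z u))"
    using Suc z by (intro mult_left_mono) (auto simp: w_def)
  finally have "norm (integrand z (w - 1)) \<le> z * (z ^ r / fact r * norm (integrand z u)) / real (Suc r)"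
    by (subst pos_le_divide_eq) auto
  moreover have "w - 1 = u - of_nat (Suc r)" by (simp add: w_def)
  ultimately show ?case by (simp add: field_simps)
qed simp

text \<open>The real parts of the poles and their integer translates form a countable set, so some
  abscissa keeps all its integer translates free of poles.\<close>

lemma base_abscissa:
  obtains X where "\<And>\<beta>. \<beta> \<in> set (A @ D) \<Longrightarrow> X + \<beta> \<le> 0" "\<And>\<beta>. \<beta> \<in> set A \<Longrightarrow> X + \<beta> \<notin> \<int>"
proof -
  define L where "L = Min (uminus ` set (A @ D))"
  have L: "L \<le> - \<beta>" if "\<beta> \<in> set (A @ D)" for \<beta> unfolding L_def using that by (intro Min_le) auto
  have "uncountable {L - 1<..<L}" by (simp add: uncountable_open_interval)
  moreover have "countable (\<Union>e\<in>set A. range (\<lambda>n. real_of_int n - e))" by (rule countable_UN[OF countable_finite[OF finite_set]]) auto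
  ultimately have "\<not> {L - 1<..<L} \<subseteq> (\<Union>e\<in>set A. range (\<lambda>n. real_of_int n - e))"
    using countable_subset by blast
  then obtain X where X: "X \<in> {L - 1<..<L}" "X \<notin> (\<Union>e\<in>set A. range (\<lambda>n. real_of_int n - e))" by blast
  show ?thesis
  proof
    show "X + \<beta> \<le> 0" if "\<beta> \<in> set (A @ D)" for \<beta> using L[OF that] X(1) by auto
    show "X + \<beta> \<notin> \<int>" if "\<beta> \<in> set A" for \<beta>
    proof
      assume "X + \<beta> \<in> \<int>"
      then obtain n where "X + \<beta> = of_int n" by (auto elim: Ints_cases)
      then have "X = of_int n - \<beta>" by simp
      with X(2) that show False by blast
    qed
  qed
qed

end

section \<open>Closing the loop to the left by rectangles\<close>

locale meijer_contour = meijer_simple +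
  fixes z X c :: real
  assumes z: "0 < z"
    and X_le: "\<And>\<beta>. \<beta> \<in> set (A @ D) \<Longrightarrow> X + \<beta> \<le> 0" and X_int: "\<And>\<beta>. \<beta> \<in> set A \<Longrightarrow> X + \<beta> \<notin> \<int>"
    and c: "\<And>\<beta>. \<beta> \<in> set A \<Longrightarrow> 0 < c + \<beta>"
begin

abbreviation "I \<equiv> integrand z"

definition path :: "real \<Rightarrow> real \<Rightarrow> complex" where
  "path R = linepath (Complex (- R) (- 1)) (Complex c (- 1)) +++
        linepath (Complex c (- 1)) (Complex c 1) +++
        linepath (Complex c 1) (Complex (- R) 1)"

definition F :: "real \<Rightarrow> complex" where "F R = contour_integral (path R) I"

lemma Re_pole [simp]: "Re (pole e q) = - e - real q" and Im_pole [simp]: "Im (pole e q) = 0"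
  by (simp_all add: pole_def)

lemma X_less_c: "X < c"
proof -
  obtain \<beta> where "\<beta> \<in> set A" using nonempty by (cases A) auto
  then show ?thesis using c[of \<beta>] X_le[of \<beta>] by auto
qed

lemma I_cont:
  assumes "\<And>e r. e \<in> set A \<Longrightarrow> pole e r \<notin> S" shows "continuous_on S I"
  by (intro holomorphic_on_imp_continuous_on integrand_holomorphic z assms)

lemma X_not_pole: "e \<in> set A \<Longrightarrow> - e - real q \<noteq> X - real r"
proof
  assume e: "e \<in> set A" and "- e - real q = X - real r"
  then have "X + e = of_int (int r - int q)" by simp
  then have "X + e \<in> \<int>" by (simp only: Ints_of_int)
  with X_int[OF e] show False by simp
qed

text \<open>By \<open>integrand_shift_bound\<close> the integrand has to be bounded only on this compact set: its translates
  to the left cover the far ends of the contour and the left edges of the rectangles.\<close>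

definition base :: "complex set" where
  "base = cbox (Complex (X - 1) 1) (Complex X 1) \<union> cbox (Complex (X - 1) (- 1)) (Complex X (- 1))
     \<union> cbox (Complex X (- 1)) (Complex X 1)"

lemma base_bound: "\<exists>b\<ge>0. \<forall>u\<in>base. norm (I u) \<le> b"
proof -
  have "compact (I ` base)"
  proof (rule compact_continuous_image[OF I_cont])
    show "compact base" unfolding base_def by (intro compact_Un compact_cbox)
    show "pole e r \<notin> base" if "e \<in> set A" for e r
      using X_not_pole[OF that, of r 0] by (auto simp: base_def in_cbox_complex_iff)
  qed
  then obtain b where "\<forall>w\<in>I ` base. norm w \<le> b" using compact_imp_bounded bounded_iff by metis
  then show ?thesis by (intro exI[of _ "max b 0"]) auto
qed

lemma I_bound:
  assumes b: "\<forall>u\<in>base. norm (I u) \<le> b" and u: "u + of_nat r \<in> base"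
  shows "norm (I u) \<le> z ^ r / fact r * b"
proof -
  have "Re (u + of_nat r) \<le> X" using u by (auto simp: base_def in_cbox_complex_iff)
  then have "norm (I ((u + of_nat r) - of_nat r)) \<le> z ^ r / fact r * norm (I (u + of_nat r))"
    using X_le by (intro integrand_shift_bound z) (force)
  also have "\<dots> \<le> z ^ r / fact r * b" using b u z by (intro mult_left_mono) auto
  finally show ?thesis by simp
qed

lemma no_pole_horizontal:
  "e \<in> set A \<Longrightarrow> pole e r \<notin> closed_segment (Complex p 1) (Complex q 1)"
  "e \<in> set A \<Longrightarrow> pole e r \<notin> closed_segment (Complex p (- 1)) (Complex q (- 1))"
  by (auto simp: closed_segment_same_Im)

lemma no_pole_right: "e \<in> set A \<Longrightarrow> pole e r \<notin> closed_segment (Complex c (- 1)) (Complex c 1)"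
  using c[of e] by (auto simp: closed_segment_same_Re)

lemma no_pole_left: "e \<in> set A \<Longrightarrow> pole e q \<notin> closed_segment (Complex (X - real r) 1) (Complex (X - real r) (- 1))"
  using X_not_pole[of e q r] by (auto simp: closed_segment_same_Re)

lemma F_eq: "F R = contour_integral (linepath (Complex (- R) (- 1)) (Complex c (- 1))) I +
    (contour_integral (linepath (Complex c (- 1)) (Complex c 1)) I +
     contour_integral (linepath (Complex c 1) (Complex (- R) 1)) I)"
proof -
  have int: "I contour_integrable_on linepath (Complex (- R) (- 1)) (Complex c (- 1))"
    "I contour_integrable_on linepath (Complex c (- 1)) (Complex c 1)"
    "I contour_integrable_on linepath (Complex c 1) (Complex (- R) 1)"
    by (intro contour_integrable_continuous_linepath I_cont no_pole_horizontal no_pole_right; assumption)+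
  show ?thesis
    unfolding F_def path_def using int by (simp add: contour_integrable_join)
qed

lemma F_rect:
  "contour_integral (rectpath (Complex (X - real r) (- 1)) (Complex c 1)) I =
     F (real r - X) + contour_integral (linepath (Complex (X - real r) 1) (Complex (X - real r) (- 1))) I"
proof -
  let ?l = "X - real r"
  have int: "I contour_integrable_on linepath (Complex ?l (- 1)) (Complex c (- 1))"
    "I contour_integrable_on linepath (Complex c (- 1)) (Complex c 1)"
    "I contour_integrable_on linepath (Complex c 1) (Complex ?l 1)"
    "I contour_integrable_on linepath (Complex ?l 1) (Complex ?l (- 1))"
    by (intro contour_integrable_continuous_linepath I_cont no_pole_horizontal no_pole_right no_pole_left; assumption)+
  show ?thesis
    unfolding F_eq rectpath_def using int by (simp add: Let_def contour_integrable_join)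
qed

lemma left_edge_bound:
  assumes b: "0 \<le> b" "\<forall>u\<in>base. norm (I u) \<le> b"
  shows "norm (contour_integral (linepath (Complex (X - real r) 1) (Complex (X - real r) (- 1))) I) \<le> z ^ r / fact r * b * 2"
proof -
  have "norm (contour_integral (linepath (Complex (X - real r) 1) (Complex (X - real r) (- 1))) I) \<le>
     z ^ r / fact r * b * norm (Complex (X - real r) (- 1) - Complex (X - real r) 1)"
  proof (rule contour_integral_bound_linepath)
    show "I contour_integrable_on linepath (Complex (X - real r) 1) (Complex (X - real r) (- 1))"
      by (intro contour_integrable_continuous_linepath I_cont no_pole_left)
    fix u assume "u \<in> closed_segment (Complex (X - real r) 1) (Complex (X - real r) (- 1))"
    then have "u + of_nat r \<in> base"
      by (auto simp: closed_segment_same_Re closed_segment_eq_real_ivl base_def in_cbox_complex_iff)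
    then show "norm (I u) \<le> z ^ r / fact r * b" by (rule I_bound[OF b(2)])
  qed (use b z in auto)
  also have "norm (Complex (X - real r) (- 1) - Complex (X - real r) 1) = 2" by (simp add: cmod_def)
  finally show ?thesis .
qed

text \<open>The limit is taken over real \<open>R\<close>, while residues are counted at the
  abscissas \<open>X - r\<close>. This bridges the gap between consecutive ones.\<close>

lemma F_step_bound:
  assumes b: "0 \<le> b" "\<forall>u\<in>base. norm (I u) \<le> b" and R: "real r - X \<le> R" "R \<le> real r - X + 1"
  shows "norm (F R - F (real r - X)) \<le> 2 * (z ^ r / fact r * b)"
proof -
  let ?l = "X - real r" let ?b = "z ^ r / fact r * b"
  have b0: "0 \<le> ?b" using b z by auto
  have "?l \<le> c" using X_less_c by simp
  have "contour_integral (linepath (Complex (- R) (- 1)) (Complex c (- 1))) I =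
      contour_integral (linepath (Complex (- R) (- 1)) (Complex ?l (- 1))) I +
      contour_integral (linepath (Complex ?l (- 1)) (Complex c (- 1))) I"
    using R \<open>?l \<le> c\<close>
    by (intro contour_integral_split_linepath I_cont no_pole_horizontal)
       (auto simp: closed_segment_same_Im closed_segment_eq_real_ivl)
  moreover have "contour_integral (linepath (Complex c 1) (Complex (- R) 1)) I =
      contour_integral (linepath (Complex c 1) (Complex ?l 1)) I +
      contour_integral (linepath (Complex ?l 1) (Complex (- R) 1)) I"
    using R \<open>?l \<le> c\<close>
    by (intro contour_integral_split_linepath I_cont no_pole_horizontal)
       (auto simp: closed_segment_same_Im closed_segment_eq_real_ivl)
  ultimately have eq: "F R - F (real r - X) = contour_integral (linepath (Complex (- R) (- 1)) (Complex ?l (- 1))) I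
      + contour_integral (linepath (Complex ?l 1) (Complex (- R) 1)) I"
    by (simp add: F_eq)
  have "norm (contour_integral (linepath (Complex (- R) (- 1)) (Complex ?l (- 1))) I) \<le>
      ?b * norm (Complex ?l (- 1) - Complex (- R) (- 1))"
  proof (rule contour_integral_bound_linepath[OF _ b0])
    fix u assume "u \<in> closed_segment (Complex (- R) (- 1)) (Complex ?l (- 1))"
    then have "u + of_nat r \<in> base" using R
      by (auto simp: closed_segment_same_Im closed_segment_eq_real_ivl base_def in_cbox_complex_iff split: if_splits)
    then show "norm (I u) \<le> ?b" by (rule I_bound[OF b(2)])
  qed (intro contour_integrable_continuous_linepath I_cont no_pole_horizontal)
  also have "\<dots> \<le> ?b * 1" using R by (intro mult_left_mono b0) (auto simp: cmod_def)
  finally have 1: "norm (contour_integral (linepath (Complex (- R) (- 1)) (Complex ?l (- 1))) I) \<le> ?b" by simp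
  have "norm (contour_integral (linepath (Complex ?l 1) (Complex (- R) 1)) I) \<le> ?b * norm (Complex (- R) 1 - Complex ?l 1)"
  proof (rule contour_integral_bound_linepath[OF _ b0])
    fix u assume "u \<in> closed_segment (Complex ?l 1) (Complex (- R) 1)"
    then have "u + of_nat r \<in> base" using R
      by (auto simp: closed_segment_same_Im closed_segment_eq_real_ivl base_def in_cbox_complex_iff split: if_splits)
    then show "norm (I u) \<le> ?b" by (rule I_bound[OF b(2)])
  qed (intro contour_integrable_continuous_linepath I_cont no_pole_horizontal)
  also have "\<dots> \<le> ?b * 1" using R by (intro mult_left_mono b0) (auto simp: cmod_def)
  finally have 2: "norm (contour_integral (linepath (Complex ?l 1) (Complex (- R) 1)) I) \<le> ?b" by simp
  show ?thesis unfolding eq using norm_triangle_ineq 1 2 by (smt (verit) norm_triangle_ineq)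
qed

text \<open>The number of poles of the family of \<open>e\<close> to the right of \<open>X\<close>;
  moving the edge to \<open>X - r\<close> adds \<open>r\<close> more.\<close>

definition n_poles :: "real \<Rightarrow> nat" where "n_poles e = nat \<lceil>- e - X\<rceil>"

lemma n_poles: "e \<in> set A \<Longrightarrow> X - real r < - e - real q \<longleftrightarrow> q < r + n_poles e"
proof -
  assume "e \<in> set A"
  then have "0 \<le> - e - X" using X_le[of e] by simp
  then have "int (n_poles e) = \<lceil>- e - X\<rceil>" by (simp add: n_poles_def)
  then have "q < r + n_poles e \<longleftrightarrow> int q - int r < \<lceil>- e - X\<rceil>" by linarith
  also have "\<dots> \<longleftrightarrow> X - real r < - e - real q" by (simp add: less_ceiling_iff) linarith
  finally show ?thesis by simp
qed

lemma rect_integral: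
  "contour_integral (rectpath (Complex (X - real r) (- 1)) (Complex c 1)) I =
    2 * pi * \<i> * (\<Sum>e\<in>set A. \<Sum>q<r + n_poles e. of_real (z powr e) * (res_coeff e q * of_real z ^ q))"
proof -
  \<comment> \<open>\<open>S\<close> reaches one unit beyond the left edge in order to be an open
    set around the rectangle. The \<open>+ 2\<close> leaves room for the poles in this strip, whose
    winding number is 0.\<close>
  define T where "T = Sigma (set A) (\<lambda>e. {..<r + n_poles e + 2})"
  define pts where "pts = (\<lambda>(e, q). pole e q) ` T"
  define S where "S = {u. X - real r - 1 < Re u}"
  let ?g = "rectpath (Complex (X - real r) (- 1)) (Complex c 1)"
  have T: "finite T" by (simp add: T_def)
  have fin: "finite pts" using T by (simp add: pts_def)
  have inj: "inj_on (\<lambda>(e, q). pole e q) T"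
    by (auto simp: inj_on_def T_def dest: pole_inj)
  have in_pts: "pole e q \<in> pts" if "e \<in> set A" "pole e q \<in> S" for e q
  proof -
    have "X - real (r + 1) < - e - real q" using that(2) by (simp add: S_def)
    then have "q < r + 1 + n_poles e" using n_poles[OF that(1), of "r + 1" q] by simp
    then show ?thesis using that(1) by (force simp: pts_def T_def)
  qed
  have S: "open S" "convex S" unfolding S_def by (auto intro: open_halfspace_Re_gt convex_halfspace_Re_gt)
  have img: "path_image ?g \<subseteq> S - pts"
  proof
    fix u assume u: "u \<in> path_image ?g"
    have u': "Re u \<in> {X - real r, c} \<and> Im u \<in> {- 1..1} \<or> Im u \<in> {- 1, 1} \<and> Re u \<in> {X - real r..c}"
      using u X_less_c by (auto simp: path_image_rectpath)
    have "u \<in> S" using u' X_less_c by (auto simp: S_def)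
    moreover have "u \<noteq> pole e q" if "e \<in> set A" for e q
      using u' X_not_pole[OF that, of q r] c[OF that] by auto
    ultimately show "u \<in> S - pts" by (auto simp: pts_def T_def)
  qed
  have "contour_integral ?g I = 2 * pi * \<i> * (\<Sum>p\<in>pts. winding_number ?g p * residue I p)"
  proof (rule Residue_theorem)
    show "I holomorphic_on S - pts" using in_pts by (intro integrand_holomorphic z) blast
    show "\<forall>w. w \<notin> S \<longrightarrow> winding_number ?g w = 0"
      using X_less_c by (intro allI impI winding_number_rectpath_outside) (auto simp: S_def in_cbox_complex_iff)
  qed (use S fin img in \<open>auto intro: convex_connected\<close>)
  also have "(\<Sum>p\<in>pts. winding_number ?g p * residue I p) =
      (\<Sum>(e, q)\<in>T. winding_number ?g (pole e q) * residue I (pole e q))"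
    unfolding pts_def by (subst sum.reindex[OF inj]) (simp add: case_prod_unfold o_def)
  also have "\<dots> = (\<Sum>e\<in>set A. \<Sum>q<r + n_poles e + 2. winding_number ?g (pole e q) * residue I (pole e q))"
    unfolding T_def by (subst sum.Sigma) auto
  also have "\<dots> = (\<Sum>e\<in>set A. \<Sum>q<r + n_poles e. of_real (z powr e) * (res_coeff e q * of_real z ^ q))"
  proof (rule sum.cong)
    fix e assume e: "e \<in> set A"
    have "(\<Sum>q<r + n_poles e + 2. winding_number ?g (pole e q) * residue I (pole e q)) =
        (\<Sum>q<r + n_poles e. winding_number ?g (pole e q) * residue I (pole e q))"
    proof (rule sum.mono_neutral_right)
      show "\<forall>q\<in>{..<r + n_poles e + 2} - {..<r + n_poles e}. winding_number ?g (pole e q) * residue I (pole e q) = 0"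
      proof
        fix q assume "q \<in> {..<r + n_poles e + 2} - {..<r + n_poles e}"
        then have "\<not> X - real r < - e - real q" using n_poles[OF e, of r q] by auto
        then have "- e - real q < X - real r" using X_not_pole[OF e, of q r] by linarith
        then have "winding_number ?g (pole e q) = 0"
          using X_less_c by (intro winding_number_rectpath_outside) (auto simp: in_cbox_complex_iff)
        then show "winding_number ?g (pole e q) * residue I (pole e q) = 0" by simp
      qed
    qed auto
    also have "\<dots> = (\<Sum>q<r + n_poles e. of_real (z powr e) * (res_coeff e q * of_real z ^ q))"
    proof (rule sum.cong)
      fix q assume "q \<in> {..<r + n_poles e}"
      then have gt: "X - real r < - e - real q" using n_poles[OF e, of r q] by auto
      let ?p = "pole e q"
      have "winding_number ?g ?p = 1"
        using gt c[OF e] by (intro winding_number_rectpath) (auto simp: in_box_complex_iff)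
      moreover have "residue I ?p = res_coeff e q * of_real z powr (- ?p)"
      proof (rule residue_simple')
        show "open (S - (pts - {?p}))" by (intro open_Diff S finite_imp_closed finite_Diff fin)
        show "?p \<in> S - (pts - {?p})" using gt by (simp add: S_def)
        show "I holomorphic_on S - (pts - {?p}) - {?p}"
          using in_pts by (intro integrand_holomorphic z) blast
        have "((\<lambda>u. (mellin A D u * (u - ?p)) * of_real z powr (- u)) \<longlongrightarrow> res_coeff e q * of_real z powr (- ?p)) (at ?p)"
        proof (intro tendsto_mult mellin_residue_tendsto e)
          have "isCont (\<lambda>u. complex_of_real z powr (- u)) ?p" using z by (intro continuous_intros) auto
          then show "((\<lambda>u. complex_of_real z powr (- u)) \<longlongrightarrow> of_real z powr (- ?p)) (at ?p)" by (simp add: isCont_def)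
        qed
        then show "((\<lambda>u. I u * (u - ?p)) \<longlongrightarrow> res_coeff e q * of_real z powr (- ?p)) (at ?p)"
          by (simp add: integrand_def mult_ac)
      qed
      moreover have "of_real z powr (- ?p) = of_real (z powr e) * of_real z ^ q"
      proof -
        have "- ?p = of_real (e + real q)" by (simp add: pole_def)
        then have "of_real z powr (- ?p) = of_real (z powr (e + real q))"
          using z by (simp only: powr_of_real less_imp_le)
        then show ?thesis using z by (simp add: powr_add powr_realpow)
      qed
      ultimately show "winding_number ?g ?p * residue I ?p = of_real (z powr e) * (res_coeff e q * of_real z ^ q)"
        by (simp add: mult_ac)
    qed simp
    finally show "(\<Sum>q<r + n_poles e + 2. winding_number ?g (pole e q) * residue I (pole e q)) =
      (\<Sum>q<r + n_poles e. of_real (z powr e) * (res_coeff e q * of_real z ^ q))" .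
  qed simp
  finally show ?thesis .
qed

definition limit_value :: complex where
  "limit_value = 2 * pi * \<i> * (\<Sum>e\<in>set A. of_real (z powr e) * (\<Sum>q. res_coeff e q * of_real z ^ q))"

lemma F_tendsto: "(F \<longlongrightarrow> limit_value) at_top"
proof -
  obtain b where b: "b \<ge> 0" "\<forall>u\<in>base. norm (I u) \<le> b" using base_bound by blast
  have fact0: "(\<lambda>r. z ^ r / fact r) \<longlonglongrightarrow> 0"
    using summable_LIMSEQ_zero[OF summable_exp[of z]] by (simp add: divide_inverse mult.commute)
  \<comment> \<open>The 4 is 2 from \<open>F_step_bound\<close> plus 2 from
    \<open>left_edge_bound\<close>.\<close>
  define G where "G r = norm (contour_integral (rectpath (Complex (X - real r) (- 1)) (Complex c 1)) I - limit_value)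
      + z ^ r / fact r * b * 4" for r
  have "(\<lambda>r. contour_integral (rectpath (Complex (X - real r) (- 1)) (Complex c 1)) I) \<longlonglongrightarrow> limit_value"
    unfolding rect_integral limit_value_def
  proof (intro tendsto_mult_left tendsto_sum)
    fix e assume e: "e \<in> set A"
    have "summable (\<lambda>q. res_coeff e q * of_real z ^ q)"
      by (rule summable_norm_cancel[OF res_coeff_summable[OF e]])
    then have "(\<lambda>r. \<Sum>q<r. res_coeff e q * of_real z ^ q) \<longlonglongrightarrow> (\<Sum>q. res_coeff e q * of_real z ^ q)"
      using summable_LIMSEQ by blast
    then have "(\<lambda>r. \<Sum>q<r + n_poles e. res_coeff e q * of_real z ^ q) \<longlonglongrightarrow> (\<Sum>q. res_coeff e q * of_real z ^ q)"
      by (rule LIMSEQ_ignore_initial_segment)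
    then have "(\<lambda>r. of_real (z powr e) * (\<Sum>q<r + n_poles e. res_coeff e q * of_real z ^ q)) \<longlonglongrightarrow>
        of_real (z powr e) * (\<Sum>q. res_coeff e q * of_real z ^ q)" by (rule tendsto_mult_left)
    then show "(\<lambda>r. \<Sum>q<r + n_poles e. of_real (z powr e) * (res_coeff e q * of_real z ^ q)) \<longlonglongrightarrow>
        of_real (z powr e) * (\<Sum>q. res_coeff e q * of_real z ^ q)" by (simp only: sum_distrib_left)
  qed
  then have "(\<lambda>r. contour_integral (rectpath (Complex (X - real r) (- 1)) (Complex c 1)) I - limit_value) \<longlonglongrightarrow> 0"
    by (rule LIM_zero)
  then have "G \<longlonglongrightarrow> 0 + 0 * b * 4"
    unfolding G_def by (intro tendsto_add tendsto_mult_right fact0 tendsto_norm_zero)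
  then have G: "G \<longlonglongrightarrow> 0" by simp
  have fl: "filterlim (\<lambda>R. nat \<lfloor>R + X\<rfloor>) sequentially at_top"
    unfolding filterlim_at_top
  proof
    fix q :: nat
    show "\<forall>\<^sub>F R in at_top. q \<le> nat \<lfloor>R + X\<rfloor>"
      using eventually_ge_at_top[of "real q - X"] by eventually_elim (simp add: le_nat_iff le_floor_iff)
  qed
  have G': "((\<lambda>R. G (nat \<lfloor>R + X\<rfloor>)) \<longlongrightarrow> 0) at_top" by (rule filterlim_compose[OF G fl])
  have "((\<lambda>R. F R - limit_value) \<longlongrightarrow> 0) at_top"
  proof (rule Lim_null_comparison[OF _ G'])
    show "\<forall>\<^sub>F R in at_top. norm (F R - limit_value) \<le> G (nat \<lfloor>R + X\<rfloor>)"
      using eventually_ge_at_top[of "- X"]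
    proof eventually_elim
      case (elim R)
      define r where "r = nat \<lfloor>R + X\<rfloor>"
      have r: "real r = of_int \<lfloor>R + X\<rfloor>" using elim by (simp add: r_def)
      have R: "real r - X \<le> R" "R \<le> real r - X + 1" using floor_correct[of "R + X"] unfolding r by linarith+
      define cr where "cr = contour_integral (rectpath (Complex (X - real r) (- 1)) (Complex c 1)) I"
      define cl where "cl = contour_integral (linepath (Complex (X - real r) 1) (Complex (X - real r) (- 1))) I"
      have "cr = F (real r - X) + cl" unfolding cr_def cl_def by (rule F_rect)
      then have eq: "F R - limit_value = (F R - F (real r - X)) + (cr - limit_value) - cl" by simp
      have "norm (F R - limit_value) \<le> norm (F R - F (real r - X)) + norm (cr - limit_value) + norm cl"
        unfolding eq using norm_triangle_ineq4[of "(F R - F (real r - X)) + (cr - limit_value)" cl]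
          norm_triangle_ineq[of "F R - F (real r - X)" "cr - limit_value"] by linarith
      also have "\<dots> \<le> G r"
      proof -
        define t where "t = z ^ r / fact r * b"
        have "norm (F R - F (real r - X)) \<le> 2 * t" "norm cl \<le> t * 2" "G r = norm (cr - limit_value) + t * 4"
          unfolding t_def cl_def cr_def G_def by (rule F_step_bound[OF b R], rule left_edge_bound[OF b], rule refl)
        then show ?thesis by simp
      qed
      finally show ?case by (simp add: r_def)
    qed
  qed
  then show ?thesis by (rule LIM_zero_cancel)
qed

end

lemma meijer_G_expansion:
  assumes A: "meijer_simple (take k \<beta>s)" and z: "0 < z"
  defines "r \<equiv> meijer_simple.res_coeff (take k \<beta>s) (drop k \<beta>s)"
  shows "meijer_G k \<beta>s z = (\<Sum>e\<in>set (take k \<beta>s). of_real (z powr e) * (\<Sum>q. r e q * of_real z ^ q))"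
proof -
  interpret m: meijer_simple "take k \<beta>s" "drop k \<beta>s" by (rule A)
  obtain X where X: "\<And>\<beta>. \<beta> \<in> set (take k \<beta>s @ drop k \<beta>s) \<Longrightarrow> X + \<beta> \<le> 0" "\<And>\<beta>. \<beta> \<in> set (take k \<beta>s) \<Longrightarrow> X + \<beta> \<notin> \<int>"
    using m.base_abscissa by blast
  define c where "c = 1 + Max (uminus ` set (take k \<beta>s))"
  have c: "0 < c + \<beta>" if "\<beta> \<in> set (take k \<beta>s)" for \<beta>
  proof -
    have "- \<beta> \<le> Max (uminus ` set (take k \<beta>s))" using that by (intro Max_ge) auto
    then show ?thesis by (simp add: c_def)
  qed
  interpret m: meijer_contour "take k \<beta>s" "drop k \<beta>s" z X c by unfold_locales (rule z X c, assumption?)+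
  have mi: "meijer_integrand k \<beta>s z = m.I"
    by (rule ext) (simp add: meijer_integrand_eq m.integrand_def)
  have "m.F = (\<lambda>R. contour_integral (meijer_path k \<beta>s R) (meijer_integrand k \<beta>s z))"
    unfolding mi meijer_path_def Let_def c_def[symmetric] by (rule ext) (simp only: m.F_def m.path_def)
  with m.F_tendsto have "((\<lambda>R. contour_integral (meijer_path k \<beta>s R) (meijer_integrand k \<beta>s z)) \<longlongrightarrow> m.limit_value) at_top"
    by simp
  then have "Lim at_top (\<lambda>R. contour_integral (meijer_path k \<beta>s R) (meijer_integrand k \<beta>s z)) = m.limit_value"
    by (intro tendsto_Lim) auto
  then show ?thesis by (simp add: meijer_G_def m.limit_value_def r_def)
qed

section \<open>Frobenius series\<close>

text \<open>As for \<open>wt\<close>, the case distinction avoids the value \<open>0 powr 0 = 0\<close>.\<close>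

definition pw :: "real \<Rightarrow> real \<Rightarrow> real" where
  "pw x a = (if a = 0 then 1 else x powr a)"

lemma pw_pos: "0 < x \<Longrightarrow> pw x a = x powr a"
  by (simp add: pw_def)

lemma continuous_on_pw: "0 \<le> a \<Longrightarrow> continuous_on {0..} (\<lambda>x. pw x a)"
proof (cases "a = 0")
  case False
  assume "0 \<le> a"
  with False have "continuous_on {0..} (\<lambda>x. x powr a)"
    by (intro continuous_on_powr' continuous_intros) auto
  with False show ?thesis by (simp add: pw_def)
qed (simp add: pw_def)

text \<open>A Frobenius series with exponents in \<open>A\<close>, multiplied by \<open>x\<close> to the power \<open>s\<close> in order to make it
  continuous at \<open>0\<close>.\<close>

definition hat :: "real \<Rightarrow> real set \<Rightarrow> (real \<Rightarrow> nat \<Rightarrow> real) \<Rightarrow> real \<Rightarrow> real" where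
  "hat s A c x = (\<Sum>e\<in>A. pw x (e + s) * (\<Sum>r. c e r * x ^ r))"

definition entire_coeffs :: "real set \<Rightarrow> (real \<Rightarrow> nat \<Rightarrow> real) \<Rightarrow> bool" where
  "entire_coeffs A c \<longleftrightarrow> (\<forall>e\<in>A. \<forall>x. summable (\<lambda>r. c e r * x ^ r))"

lemma entire_coeffsD: "entire_coeffs A c \<Longrightarrow> e \<in> A \<Longrightarrow> summable (\<lambda>r. c e r * x ^ r)"
  by (simp add: entire_coeffs_def)

lemma entire_coeffs_add: "entire_coeffs A c \<Longrightarrow> entire_coeffs A d \<Longrightarrow> entire_coeffs A (\<lambda>e r. c e r + d e r)"
  by (auto simp: entire_coeffs_def distrib_right intro: summable_add)

lemma entire_coeffs_cmult: "entire_coeffs A c \<Longrightarrow> entire_coeffs A (\<lambda>e r. a e * c e r)"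
  by (auto simp: entire_coeffs_def mult.assoc intro: summable_mult)

lemma entire_coeffs_sum:
  "(\<And>i. i \<in> J \<Longrightarrow> entire_coeffs A (c i)) \<Longrightarrow> entire_coeffs A (\<lambda>e r. \<Sum>i\<in>J. c i e r)"
  by (auto simp: entire_coeffs_def sum_distrib_right intro!: summable_sum)

lemma hat_add:
  assumes "entire_coeffs A c" "entire_coeffs A d"
  shows "hat s A (\<lambda>e r. c e r + d e r) x = hat s A c x + hat s A d x"
  using assms unfolding hat_def sum.distrib[symmetric]
  by (intro sum.cong) (auto simp: distrib_right distrib_left suminf_add[symmetric] entire_coeffsD)

lemma hat_cmult:
  assumes "entire_coeffs A c" shows "hat s A (\<lambda>e r. a * c e r) x = a * hat s A c x"
  using assms unfolding hat_def sum_distrib_left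
  by (intro sum.cong) (auto simp: mult.assoc suminf_mult entire_coeffsD)

lemma hat_sum:
  assumes "\<And>i. i \<in> J \<Longrightarrow> entire_coeffs A (c i)"
  shows "hat s A (\<lambda>e r. \<Sum>i\<in>J. c i e r) x = (\<Sum>i\<in>J. hat s A (c i) x)"
  using assms
proof (induction J rule: infinite_finite_induct)
  case (insert i J)
  then have "hat s A (\<lambda>e r. c i e r + (\<Sum>i\<in>J. c i e r)) x = hat s A (c i) x + hat s A (\<lambda>e r. \<Sum>i\<in>J. c i e r) x"
    by (intro hat_add entire_coeffs_sum) auto
  then show ?case using insert by simp
qed (auto simp: hat_def)

text \<open>The Euler operator multiplies the term of exponent \<open>e + s + r\<close> by this
  exponent; convergence is that of the differentiated power series.\<close>

lemma entire_coeffs_euler: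
  assumes c: "entire_coeffs A c" shows "entire_coeffs A (\<lambda>e r. (e + s + real r) * c e r)"
proof -
  have "summable (\<lambda>r. real r * c e r * x ^ r)" if e: "e \<in> A" for e x
  proof -
    have "summable (\<lambda>r. diffs (c e) r * x ^ r)"
      by (rule termdiff_converges_all) (rule entire_coeffsD[OF c e])
    then have "summable (\<lambda>r. x * (diffs (c e) r * x ^ r))" by (rule summable_mult)
    then have "summable (\<lambda>r. real (Suc r) * c e (Suc r) * x ^ Suc r)" by (simp add: diffs_def mult_ac)
    then show ?thesis by (rule summable_Suc_iff[THEN iffD1])
  qed
  then have "entire_coeffs A (\<lambda>e r. real r * c e r)" by (simp add: entire_coeffs_def)
  from entire_coeffs_add[OF entire_coeffs_cmult[OF c, of "\<lambda>e. e + s"] this]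
  show ?thesis by (simp add: distrib_right)
qed

lemma entire_coeffs_power:
  assumes "entire_coeffs A c" shows "entire_coeffs A (\<lambda>e r. (e + s + real r) ^ j * c e r)"
  by (induction j) (use assms entire_coeffs_euler[of A _ s] in \<open>auto simp: mult.assoc\<close>)

lemma series_deriv:
  assumes c: "entire_coeffs A c" and e: "e \<in> A"
  shows "((\<lambda>x. \<Sum>r. c e r * x ^ r) has_real_derivative (\<Sum>r. diffs (c e) r * x ^ r)) (at x)"
  by (rule termdiffs_strong_converges_everywhere) (rule entire_coeffsD[OF c e])

lemma series_euler:
  assumes c: "entire_coeffs A c" and e: "e \<in> A"
  shows "(\<Sum>r. real r * c e r * x ^ r) = x * (\<Sum>r. diffs (c e) r * x ^ r)"
proof -
  have sm: "summable (\<lambda>r. diffs (c e) r * x ^ r)"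
    by (rule termdiff_converges_all) (rule entire_coeffsD[OF c e])
  have "summable (\<lambda>r. real r * c e r * x ^ r)"
    using entire_coeffsD[OF entire_coeffs_euler[OF c, of "- e"] e] by simp
  then have "(\<Sum>r. real r * c e r * x ^ r) = (\<Sum>r. real (Suc r) * c e (Suc r) * x ^ Suc r)"
    using suminf_split_head[of "\<lambda>r. real r * c e r * x ^ r"] by simp
  also have "\<dots> = (\<Sum>r. x * (diffs (c e) r * x ^ r))" by (simp add: diffs_def mult_ac)
  also have "\<dots> = x * (\<Sum>r. diffs (c e) r * x ^ r)" by (rule suminf_mult[OF sm])
  finally show ?thesis .
qed

lemma continuous_on_series:
  assumes c: "entire_coeffs A c" and e: "e \<in> A"
  shows "continuous_on S (\<lambda>x. \<Sum>r. c e r * x ^ r)"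
  by (intro DERIV_continuous_on[OF DERIV_subset[OF series_deriv[OF c e]]]) simp

lemma hat_deriv:
  assumes A: "finite A" and c: "entire_coeffs A c" and x: "0 < x"
  shows "(hat s A c has_real_derivative hat s A (\<lambda>e r. (e + s + real r) * c e r) x / x) (at x)"
proof -
  have "((\<lambda>x. pw x (e + s) * (\<Sum>r. c e r * x ^ r)) has_real_derivative
      pw x (e + s) * (\<Sum>r. (e + s + real r) * c e r * x ^ r) / x) (at x)" if e: "e \<in> A" for e
  proof -
    have "((\<lambda>x. x powr (e + s) * (\<Sum>r. c e r * x ^ r)) has_real_derivative
      (e + s) * x powr (e + s - 1) * (\<Sum>r. c e r * x ^ r) + (\<Sum>r. diffs (c e) r * x ^ r) * x powr (e + s)) (at x)"
      by (intro DERIV_mult has_real_derivative_powr x series_deriv[OF c e])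
    moreover have "(e + s) * x powr (e + s - 1) * (\<Sum>r. c e r * x ^ r) + (\<Sum>r. diffs (c e) r * x ^ r) * x powr (e + s)
       = pw x (e + s) * (\<Sum>r. (e + s + real r) * c e r * x ^ r) / x"
    proof -
      have sr: "summable (\<lambda>r. real r * c e r * x ^ r)"
        using entire_coeffsD[OF entire_coeffs_euler[OF c, of "- e"] e] by simp
      have "(\<Sum>r. (e + s + real r) * c e r * x ^ r) = (\<Sum>r. (e + s) * (c e r * x ^ r) + real r * c e r * x ^ r)"
        by (simp add: algebra_simps)
      also have "\<dots> = (e + s) * (\<Sum>r. c e r * x ^ r) + (\<Sum>r. real r * c e r * x ^ r)"
        by (subst suminf_add[symmetric]) (auto simp: suminf_mult entire_coeffsD[OF c e] sr summable_mult)
      finally show ?thesis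
        unfolding series_euler[OF c e] using x
        by (simp add: pw_pos powr_diff field_simps)
    qed
    ultimately have "((\<lambda>x. x powr (e + s) * (\<Sum>r. c e r * x ^ r)) has_real_derivative
      pw x (e + s) * (\<Sum>r. (e + s + real r) * c e r * x ^ r) / x) (at x)" by simp
    then show ?thesis
      by (rule has_field_derivative_transform_within_open[of _ _ _ "{0<..}"]) (use x in \<open>auto simp: pw_pos\<close>)
  qed
  then have "((\<lambda>x. \<Sum>e\<in>A. pw x (e + s) * (\<Sum>r. c e r * x ^ r)) has_real_derivative
      (\<Sum>e\<in>A. pw x (e + s) * (\<Sum>r. (e + s + real r) * c e r * x ^ r) / x)) (at x)"
    by (intro DERIV_sum)
  then show ?thesis by (simp add: hat_def[abs_def] sum_divide_distrib)
qed

lemma continuous_on_hat: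
  assumes "finite A" "entire_coeffs A c" "\<And>e. e \<in> A \<Longrightarrow> 0 \<le> e + s"
  shows "continuous_on {0..} (hat s A c)"
  unfolding hat_def[abs_def] using assms
  by (intro continuous_on_sum continuous_on_mult continuous_on_pw continuous_on_series) auto

lemma mult_hat:
  assumes "entire_coeffs A c"
  shows "x * hat s A c x = hat s A (\<lambda>e r. case r of 0 \<Rightarrow> 0 | Suc r \<Rightarrow> c e r) x"
    and entire_coeffs_shift: "entire_coeffs A (\<lambda>e r. case r of 0 \<Rightarrow> 0 | Suc r \<Rightarrow> c e r)"
proof -
  have sm: "summable (\<lambda>r. (case r of 0 \<Rightarrow> 0 | Suc r \<Rightarrow> c e r) * x ^ r)" if "e \<in> A" for e x
  proof -
    have "summable (\<lambda>r. x * (c e r * x ^ r))" by (intro summable_mult entire_coeffsD[OF assms that])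
    then show ?thesis by (subst summable_Suc_iff[symmetric]) (simp add: mult_ac)
  qed
  then show "entire_coeffs A (\<lambda>e r. case r of 0 \<Rightarrow> 0 | Suc r \<Rightarrow> c e r)" by (simp add: entire_coeffs_def)
  show "x * hat s A c x = hat s A (\<lambda>e r. case r of 0 \<Rightarrow> 0 | Suc r \<Rightarrow> c e r) x"
    unfolding hat_def sum_distrib_left
  proof (rule sum.cong)
    fix e assume e: "e \<in> A"
    have "(\<Sum>r. (case r of 0 \<Rightarrow> 0 | Suc r \<Rightarrow> c e r) * x ^ r) = (\<Sum>r. x * (c e r * x ^ r))"
      using suminf_split_head[OF sm[OF e, of x]] by (simp add: mult_ac)
    also have "\<dots> = x * (\<Sum>r. c e r * x ^ r)" by (rule suminf_mult[OF entire_coeffsD[OF assms e]])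
    finally show "x * (pw x (e + s) * (\<Sum>r. c e r * x ^ r)) =
        pw x (e + s) * (\<Sum>r. (case r of 0 \<Rightarrow> 0 | Suc r \<Rightarrow> c e r) * x ^ r)" by simp
  qed simp
qed

text \<open>Each exponent is treated alone: the factor \<open>t powr (- s)\<close> is beaten by
  \<open>t powr (e + s')\<close> if \<open>s < e + s'\<close>, and by a factor \<open>t\<close>
  split off from the power series if its constant term is 0.\<close>

lemma hat_vanish:
  assumes A: "finite A" and c: "entire_coeffs A c" and s: "0 \<le> s" "s < 1" and y: "0 \<le> y"
    and e: "\<And>e. e \<in> A \<Longrightarrow> 0 \<le> e + s' \<and> (c e 0 = 0 \<or> s < e + s')"
  shows "((\<lambda>t. t powr (- s) * hat s' A c (t * y)) \<longlongrightarrow> 0) (at_right 0)"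
proof -
  let ?E = "\<lambda>e x. \<Sum>r. c e r * x ^ r"
  have ev: "\<forall>\<^sub>F t in at_right (0::real). 0 < t" by (simp add: eventually_at_right_less)
  have lim_ty: "((\<lambda>t. t * y) \<longlongrightarrow> 0 * y) (at_right 0)" by (intro tendsto_intros)
  have mem: "\<forall>\<^sub>F t in at_right 0. t * y \<in> {0..}" using ev by eventually_elim (use y in auto)
  have to0: "((\<lambda>t. h (t * y)) \<longlongrightarrow> h 0) (at_right 0)" if "continuous_on {0..} h" for h :: "real \<Rightarrow> real"
    using continuous_on_tendsto_compose[OF that lim_ty] mem by simp
  have pow0: "((\<lambda>t::real. t powr a) \<longlongrightarrow> 0) (at_right 0)" if "0 < a" for a
    using that by real_asymp
  have "((\<lambda>t. t powr (- s) * (pw (t * y) (e + s') * ?E e (t * y))) \<longlongrightarrow> 0) (at_right 0)" if eA: "e \<in> A" for e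
  proof (cases "c e 0 = 0")
    case True
    define d where "d r = c e (Suc r)" for r
    have sm: "summable (\<lambda>r. d r * x ^ r)" for x
    proof -
      have "summable (\<lambda>r. c e (Suc r) * x ^ Suc r)"
        using entire_coeffsD[OF c eA, of x] by (subst summable_Suc_iff)
      then have "summable (\<lambda>r. (1 / x) * (c e (Suc r) * x ^ Suc r))" by (rule summable_mult)
      then show ?thesis
        by (cases "x = 0") (auto simp: d_def summable_0_powser)
    qed
    then have dd: "entire_coeffs {e} (\<lambda>_. d)" by (simp add: entire_coeffs_def)
    have E: "?E e x = x * (\<Sum>r. d r * x ^ r)" for x
    proof -
      have "?E e x = (\<Sum>r. x * (d r * x ^ r))"
        using suminf_split_head[OF entire_coeffsD[OF c eA, of x]] True by (simp add: d_def mult_ac)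
      then show ?thesis by (simp add: suminf_mult sm)
    qed
    have "((\<lambda>t. t powr (1 - s) * (y * (pw (t * y) (e + s') * (\<Sum>r. d r * (t * y) ^ r)))) \<longlongrightarrow>
        0 * (y * (pw 0 (e + s') * (\<Sum>r. d r * 0 ^ r)))) (at_right 0)"
      using e[OF eA] s
      by (intro tendsto_mult pow0 tendsto_const to0[where h = "\<lambda>x. pw x (e + s')"] continuous_on_pw
          to0[where h = "\<lambda>x. \<Sum>r. d r * x ^ r"] continuous_on_series[OF dd, of e]) auto
    then have "((\<lambda>t. t powr (1 - s) * (y * (pw (t * y) (e + s') * (\<Sum>r. d r * (t * y) ^ r)))) \<longlongrightarrow> 0) (at_right 0)" by simp
    then show ?thesis
    proof (rule Lim_transform_eventually)
      show "\<forall>\<^sub>F t in at_right 0. t powr (1 - s) * (y * (pw (t * y) (e + s') * (\<Sum>r. d r * (t * y) ^ r))) =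
          t powr (- s) * (pw (t * y) (e + s') * ?E e (t * y))"
        using ev
      proof eventually_elim
        case (elim t)
        have "t powr (1 - s) = t * t powr (- s)" using elim powr_add[of t 1 "- s"] by simp
        then show ?case unfolding E by (simp add: mult_ac)
      qed
    qed
  next
    case False
    then have es: "s < e + s'" using e[OF eA] by auto
    have "((\<lambda>t. t powr (e + s' - s) * (y powr (e + s') * ?E e (t * y))) \<longlongrightarrow> 0 * (y powr (e + s') * ?E e 0)) (at_right 0)"
      using es by (intro tendsto_mult pow0 tendsto_const to0[where h = "?E e"] continuous_on_series[OF c eA]) auto
    then have "((\<lambda>t. t powr (e + s' - s) * (y powr (e + s') * ?E e (t * y))) \<longlongrightarrow> 0) (at_right 0)" by simp
    then show ?thesis
    proof (rule Lim_transform_eventually)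
      show "\<forall>\<^sub>F t in at_right 0. t powr (e + s' - s) * (y powr (e + s') * ?E e (t * y)) =
          t powr (- s) * (pw (t * y) (e + s') * ?E e (t * y))"
        using ev
      proof eventually_elim
        case (elim t)
        have "pw (t * y) (e + s') = t powr (e + s') * y powr (e + s')"
          using es s y elim by (simp add: pw_def powr_mult)
        moreover have "t powr (e + s' - s) = t powr (- s) * t powr (e + s')"
          by (simp flip: powr_add)
        ultimately show ?case by (simp add: mult_ac)
      qed
    qed
  qed
  then have "((\<lambda>t. \<Sum>e\<in>A. t powr (- s) * (pw (t * y) (e + s') * ?E e (t * y))) \<longlongrightarrow> (\<Sum>e\<in>A. 0)) (at_right 0)"
    by (intro tendsto_sum)
  then show ?thesis by (simp add: hat_def sum_distrib_left)
qed

text \<open>Otherwise \<open>F\<close> would have a logarithmic singularity at \<open>0\<close>.\<close>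

lemma euler_deriv_zero:
  assumes F: "continuous_on {0..} F" and L: "continuous_on {0..} L" and der: "euler_deriv B F L" and B: "0 < B"
  shows "L 0 = 0"
proof (rule ccontr)
  assume "L 0 \<noteq> 0"
  define \<epsilon> where "\<epsilon> = \<bar>L 0\<bar> / 2"
  have \<epsilon>: "\<epsilon> > 0" using \<open>L 0 \<noteq> 0\<close> by (simp add: \<epsilon>_def)
  have near: "\<exists>d>0. \<forall>y. 0 \<le> y \<longrightarrow> y < d \<longrightarrow> \<bar>h y - h 0\<bar> < r" if h: "continuous_on {0..} h" and r: "0 < r" for h :: "real \<Rightarrow> real" and r
  proof -
    have "0 \<in> {0::real..}" by simp
    from h[unfolded continuous_on_iff, rule_format, OF this r] obtain d where
      d: "d > 0" "\<forall>y\<in>{0..}. dist y 0 < d \<longrightarrow> dist (h y) (h 0) < r" by blast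
    then show ?thesis by (intro exI[of _ d]) (simp add: dist_real_def)
  qed
  obtain d1 where d1: "d1 > 0" "\<And>y. 0 \<le> y \<Longrightarrow> y < d1 \<Longrightarrow> \<bar>L y - L 0\<bar> < \<epsilon>"
    using near[OF L \<epsilon>] by blast
  obtain d2 where d2: "d2 > 0" "\<And>y. 0 \<le> y \<Longrightarrow> y < d2 \<Longrightarrow> \<bar>F y - F 0\<bar> < \<epsilon> / 8"
    using near[OF F, of "\<epsilon> / 8"] \<epsilon> by auto
  define x where "x = min B (min d1 d2) / 2"
  have x: "0 < x" "x < B" "x < d1" "x < d2" using B d1 d2 by (auto simp: x_def)
  have "\<exists>z>x / 2. z < x \<and> F x - F (x / 2) = (x - x / 2) * (L z / z)"
    by (rule MVT2) (use x euler_derivD[OF der] in auto)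
  then obtain z where z: "x / 2 < z" "z < x" "F x - F (x / 2) = (x - x / 2) * (L z / z)" by blast
  have z0: "0 < z" using z(1) x(1) by linarith
  have "\<bar>L z - L 0\<bar> < \<epsilon>" by (rule d1(2)) (use z x z0 in auto)
  then have Lz: "\<epsilon> < \<bar>L z\<bar>" unfolding \<epsilon>_def by linarith
  have "\<epsilon> / 2 \<le> \<bar>L z\<bar> * (x / (2 * z))"
  proof -
    have "\<epsilon> * (1 / 2) \<le> \<bar>L z\<bar> * (x / (2 * z))"
      using Lz \<epsilon> z x z0 by (intro mult_mono) (auto simp: field_simps)
    then show ?thesis by simp
  qed
  also have "\<dots> = \<bar>F x - F (x / 2)\<bar>" unfolding z(3) using z0 x(1) by (simp add: abs_mult)
  also have "\<dots> < \<epsilon> / 4"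
    using d2(2)[of x] d2(2)[of "x / 2"] x \<epsilon> by linarith
  finally show False using \<epsilon> by simp
qed

section \<open>Averages of products over dilations\<close>

text \<open>With \<open>\<kappa> = 1 / (1 - s)\<close> this is the integral of \<open>F (t * x) * G (t * y)\<close> against the weight
  \<open>wt s t\<close> over \<open>[0, 1]\<close>, after a substitution which makes the integrand continuous.\<close>

definition scal :: "real \<Rightarrow> (real \<Rightarrow> real) \<Rightarrow> (real \<Rightarrow> real) \<Rightarrow> real \<Rightarrow> real \<Rightarrow> real" where
  "scal \<kappa> F G x y = \<kappa> * integral {0..1} (\<lambda>t. F (t powr \<kappa> * x) * G (t powr \<kappa> * y))"

lemma scal_commute: "scal \<kappa> F G x y = scal \<kappa> G F y x"
  by (simp add: scal_def mult.commute)

lemma continuous_on_scaled: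
  fixes g h :: "'a :: metric_space \<Rightarrow> real"
  assumes "0 < \<kappa>" "continuous_on {0..} F"
    and g: "continuous_on S g" "\<And>z. z \<in> S \<Longrightarrow> 0 \<le> g z" and h: "continuous_on S h" "\<And>z. z \<in> S \<Longrightarrow> 0 \<le> h z"
  shows "continuous_on S (\<lambda>z. F (g z powr \<kappa> * h z))"
proof (rule continuous_on_compose2[OF assms(2)])
  have "continuous_on S (\<lambda>z. g z powr \<kappa>)"
    by (rule continuous_on_powr'[OF g(1) continuous_on_const]) (use assms(1) g(2) in auto)
  then show "continuous_on S (\<lambda>z. g z powr \<kappa> * h z)" by (intro continuous_on_mult h(1))
  show "(\<lambda>z. g z powr \<kappa> * h z) ` S \<subseteq> {0..}"
    by (auto intro: mult_nonneg_nonneg h(2))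
qed

lemma continuous_on_scal:
  assumes \<kappa>: "0 < \<kappa>" and F: "continuous_on {0..} F" and G: "continuous_on {0..} G"
  shows "continuous_on ({0..} \<times> {0..}) (\<lambda>z. scal \<kappa> F G (fst z) (snd z))"
proof -
  have "continuous_on (({0..} \<times> {0..}) \<times> cbox 0 1)
     (\<lambda>(z, t). F (t powr \<kappa> * fst z) * G (t powr \<kappa> * snd z))"
    unfolding case_prod_unfold
    by (intro continuous_on_mult continuous_on_scaled[OF \<kappa> F] continuous_on_scaled[OF \<kappa> G] continuous_intros) auto
  then have "continuous_on ({0..} \<times> {0..}) (\<lambda>z. integral (cbox 0 1) (\<lambda>t. F (t powr \<kappa> * fst z) * G (t powr \<kappa> * snd z)))"
    by (rule integral_continuous_on_param)
  then show ?thesis unfolding scal_def by (intro continuous_on_mult continuous_on_const) (simp only: cbox_interval)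
qed

lemma scaled_integrable:
  fixes F G :: "real \<Rightarrow> real"
  assumes \<kappa>: "0 < \<kappa>" and F: "continuous_on {0..} F" and G: "continuous_on {0..} G" and xy: "0 \<le> x" "0 \<le> y"
  shows "(\<lambda>t. F (t powr \<kappa> * x) * G (t powr \<kappa> * y)) integrable_on {0..1}"
  by (intro integrable_continuous_real continuous_on_mult continuous_on_scaled[OF \<kappa> F] continuous_on_scaled[OF \<kappa> G] continuous_intros) (use xy in auto)

locale euler_fun =
  fixes u du :: "real \<Rightarrow> real"
  assumes u: "continuous_on {0..} u" and du: "continuous_on {0..} du"
    and deriv: "\<And>x. 0 < x \<Longrightarrow> (u has_real_derivative du x / x) (at x)"
begin

text \<open>Covers \<open>t = 0\<close> in \<open>deriv_scale_arg\<close>, where the function is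
  constant and the claimed derivative is \<open>du 0 / x\<close>.\<close>

lemma du_0: "du 0 = 0"
  by (rule euler_deriv_zero[OF u du, of 1]) (auto simp: euler_deriv_def deriv)

lemma deriv_scale_arg:
  assumes "0 \<le> t" "0 < x" shows "((\<lambda>x. u (t * x)) has_real_derivative du (t * x) / x) (at x)"
proof (cases "t = 0")
  case False
  then have t: "0 < t" using assms by simp
  have "((\<lambda>x. u (t * x)) has_real_derivative (du (t * x) / (t * x)) * t) (at x)"
    by (rule DERIV_chain'[of "\<lambda>x. t * x" t x UNIV u]) (use t assms in \<open>auto intro!: derivative_eq_intros deriv\<close>)
  then show ?thesis using t by simp
qed (simp add: du_0)

lemma deriv_scale:
  assumes "0 < t" "0 \<le> x" shows "((\<lambda>t. u (t * x)) has_real_derivative du (t * x) / t) (at t)"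
  using deriv_scale_arg[OF assms(2,1)] by (simp add: mult.commute)

lemma deriv_scale_powr:
  assumes t: "0 < t" "0 \<le> x"
  shows "((\<lambda>t. u (t powr \<kappa> * x)) has_real_derivative \<kappa> * du (t powr \<kappa> * x) / t) (at t)"
proof -
  have "((\<lambda>t. u (t powr \<kappa> * x)) has_real_derivative (du (t powr \<kappa> * x) / t powr \<kappa>) * (\<kappa> * t powr (\<kappa> - 1))) (at t)"
    by (rule DERIV_chain'[of "\<lambda>t. t powr \<kappa>" _ t UNIV "\<lambda>r. u (r * x)"])
       (use t in \<open>auto intro!: has_real_derivative_powr deriv_scale\<close>)
  moreover have "t powr (\<kappa> - 1) = t powr \<kappa> / t" using t by (simp add: powr_diff)
  ultimately show ?thesis using t by (simp add: mult.commute)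
qed

lemma scal_deriv:
  assumes \<kappa>: "0 < \<kappa>" and v: "continuous_on {0..} v" and x: "0 < x" and y: "0 \<le> y"
  shows "((\<lambda>x. scal \<kappa> u v x y) has_real_derivative scal \<kappa> du v x y / x) (at x)"
proof -
  let ?f = "\<lambda>x t. u (t powr \<kappa> * x) * v (t powr \<kappa> * y)"
  let ?fx = "\<lambda>x t. du (t powr \<kappa> * x) / x * v (t powr \<kappa> * y)"
  have "((\<lambda>x. integral (cbox 0 1) (?f x)) has_field_derivative integral (cbox 0 1) (?fx x)) (at x within {0<..})"
  proof (rule leibniz_rule_field_derivative)
    fix x t :: real assume "x \<in> {0<..}" "t \<in> cbox 0 1"
    then have "((\<lambda>x. u (t powr \<kappa> * x)) has_real_derivative du (t powr \<kappa> * x) / x) (at x within {0<..})"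
      by (intro has_field_derivative_at_within[OF deriv_scale_arg]) auto
    then show "((\<lambda>x. ?f x t) has_field_derivative ?fx x t) (at x within {0<..})"
      by (intro DERIV_cmult_right)
  next
    show "?f x integrable_on cbox 0 1" if "x \<in> {0<..}" for x
      using scaled_integrable[OF \<kappa> u v, of x y] that y by simp
    show "continuous_on ({0<..} \<times> cbox 0 1) (\<lambda>(x, t). ?fx x t)"
      unfolding case_prod_unfold
      by (intro continuous_on_mult continuous_on_divide continuous_on_scaled[OF \<kappa> du] continuous_on_scaled[OF \<kappa> v] continuous_intros) (use y in auto)
  qed (use x in auto)
  then have "((\<lambda>x. \<kappa> * integral {0..1} (?f x)) has_field_derivative \<kappa> * integral {0..1} (?fx x)) (at x)"
    using x by (intro DERIV_cmult) (simp add: at_within_open[of x "{0<..}"])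
  also have "integral {0..1} (?fx x) = integral {0..1} (\<lambda>t. du (t powr \<kappa> * x) * v (t powr \<kappa> * y)) / x"
    by simp
  finally show ?thesis by (simp add: scal_def)
qed

end

text \<open>Integrate the derivative of
  \<open>t * u (t powr \<kappa> * x) * v (t powr \<kappa> * y)\<close>: the upper limit gives the
  rank-one term, the lower one 0, and \<open>(1 - s) * \<kappa> = 1\<close> fits the
  coefficients.\<close>

lemma scal_euler:
  assumes uu: "euler_fun u du" and vv: "euler_fun v dv" and s: "s < 1" and xy: "0 \<le> x" "0 \<le> y"
  defines "\<kappa> \<equiv> 1 / (1 - s)"
  shows "scal \<kappa> du v x y + scal \<kappa> u dv x y + (1 - s) * scal \<kappa> u v x y = u x * v y"
proof -
  interpret U: euler_fun u du by fact
  interpret V: euler_fun v dv by fact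
  have \<kappa>: "0 < \<kappa>" "(1 - s) * \<kappa> = 1" using s by (auto simp: \<kappa>_def)
  let ?U = "\<lambda>t. u (t powr \<kappa> * x)" and ?V = "\<lambda>t. v (t powr \<kappa> * y)"
  let ?dU = "\<lambda>t. du (t powr \<kappa> * x)" and ?dV = "\<lambda>t. dv (t powr \<kappa> * y)"
  have "((\<lambda>t. ?U t * ?V t + \<kappa> * (?dU t * ?V t) + \<kappa> * (?U t * ?dV t)) has_integral
      1 * (?U 1 * ?V 1) - 0 * (?U 0 * ?V 0)) {0..1}"
  proof (rule fundamental_theorem_of_calculus_interior)
    show "continuous_on {0..1} (\<lambda>t. t * (?U t * ?V t))"
      by (intro continuous_on_mult continuous_on_scaled[OF \<kappa>(1) U.u] continuous_on_scaled[OF \<kappa>(1) V.u] continuous_intros) (use xy in auto)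
    fix t :: real assume t: "t \<in> {0<..<1}"
    have "((\<lambda>t. t * (?U t * ?V t)) has_real_derivative
       1 * (?U t * ?V t) + (\<kappa> * ?dU t / t * ?V t + \<kappa> * ?dV t / t * ?U t) * t) (at t)"
      by (intro DERIV_mult DERIV_ident U.deriv_scale_powr V.deriv_scale_powr) (use t xy in auto)
    moreover have "1 * (?U t * ?V t) + (\<kappa> * ?dU t / t * ?V t + \<kappa> * ?dV t / t * ?U t) * t =
        ?U t * ?V t + \<kappa> * (?dU t * ?V t) + \<kappa> * (?U t * ?dV t)"
      using t by (simp add: field_simps)
    ultimately show "((\<lambda>t. t * (?U t * ?V t)) has_vector_derivative
        ?U t * ?V t + \<kappa> * (?dU t * ?V t) + \<kappa> * (?U t * ?dV t)) (at t)"
      by (simp only: has_real_derivative_iff_has_vector_derivative)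
  qed simp
  then have "integral {0..1} (\<lambda>t. ?U t * ?V t + \<kappa> * (?dU t * ?V t) + \<kappa> * (?U t * ?dV t)) = u x * v y"
    by (simp add: integral_unique)
  moreover have "integral {0..1} (\<lambda>t. ?U t * ?V t + \<kappa> * (?dU t * ?V t) + \<kappa> * (?U t * ?dV t)) =
     integral {0..1} (\<lambda>t. ?U t * ?V t) + \<kappa> * integral {0..1} (\<lambda>t. ?dU t * ?V t) + \<kappa> * integral {0..1} (\<lambda>t. ?U t * ?dV t)"
    using scaled_integrable[OF \<kappa>(1) U.u V.u xy] scaled_integrable[OF \<kappa>(1) U.du V.u xy] scaled_integrable[OF \<kappa>(1) U.u V.du xy]
    by (simp add: Henstock_Kurzweil_Integration.integral_add integrable_add integrable_on_mult_right)
  moreover have "(1 - s) * scal \<kappa> u v x y = integral {0..1} (\<lambda>t. ?U t * ?V t)"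
    unfolding scal_def mult.assoc[symmetric] \<kappa>(2) by simp
  moreover have "scal \<kappa> du v x y = \<kappa> * integral {0..1} (\<lambda>t. ?dU t * ?V t)"
    "scal \<kappa> u dv x y = \<kappa> * integral {0..1} (\<lambda>t. ?U t * ?dV t)" by (simp_all add: scal_def)
  ultimately show ?thesis by linarith
qed

text \<open>By \<open>alg\<close>, the derivative of the function under the limit is the integrand on the left-hand side
  times \<open>x - y\<close>.\<close>

lemma scal_integrable_form:
  fixes f g df dg :: "nat \<Rightarrow> real \<Rightarrow> real"
  assumes f: "\<And>i. i < N \<Longrightarrow> euler_fun (f i) (df i)" and g: "\<And>i. i < N \<Longrightarrow> euler_fun (g i) (dg i)"
    and u: "continuous_on {0..} u" and v: "continuous_on {0..} v"
    and s: "0 \<le> s" "s < 1" and xy: "0 \<le> x" "0 \<le> y"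
    and alg: "\<And>X Y. 0 \<le> X \<Longrightarrow> 0 \<le> Y \<Longrightarrow>
       (\<Sum>i<N. df i X * g i Y + f i X * dg i Y) - s * (\<Sum>i<N. f i X * g i Y) = (X - Y) * (u X * v Y)"
    and lim: "((\<lambda>t. t powr (- s) * (\<Sum>i<N. f i (t * x) * g i (t * y))) \<longlongrightarrow> 0) (at_right 0)"
  shows "(x - y) * scal (1 / (1 - s)) u v x y = (\<Sum>i<N. f i x * g i y)"
proof -
  define \<kappa> where "\<kappa> = 1 / (1 - s)"
  have \<kappa>: "0 < \<kappa>" "\<kappa> * (1 - s) = 1" using s by (auto simp: \<kappa>_def)
  define H where "H t = t powr (- s) * (\<Sum>i<N. f i (t * x) * g i (t * y))" for t
  \<comment> \<open>The substituted function, whose value at 0 is the limit given by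
    \<open>lim\<close>; this makes it continuous on \<open>[0, 1]\<close>.\<close>
  define S where "S t = (if t = 0 then 0 else H (t powr \<kappa>))" for t
  have dH: "(H has_real_derivative t powr (- s) * ((x - y) * (u (t * x) * v (t * y)))) (at t)" if t: "0 < t" for t
  proof -
    have "(H has_real_derivative (- s * t powr (- s - 1)) * (\<Sum>i<N. f i (t * x) * g i (t * y))
      + (\<Sum>i<N. df i (t * x) / t * g i (t * y) + dg i (t * y) / t * f i (t * x)) * t powr (- s)) (at t)"
      unfolding H_def
      by (intro DERIV_mult[OF has_real_derivative_powr[OF t] DERIV_sum]
          DERIV_mult[OF euler_fun.deriv_scale[OF f t xy(1)] euler_fun.deriv_scale[OF g t xy(2)]]) auto
    moreover have "(- s * t powr (- s - 1)) * (\<Sum>i<N. f i (t * x) * g i (t * y))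
      + (\<Sum>i<N. df i (t * x) / t * g i (t * y) + dg i (t * y) / t * f i (t * x)) * t powr (- s) =
      t powr (- s) / t * ((\<Sum>i<N. df i (t * x) * g i (t * y) + f i (t * x) * dg i (t * y)) - s * (\<Sum>i<N. f i (t * x) * g i (t * y)))"
    proof -
      have 1: "t powr (- s - 1) = t powr (- s) / t" using t by (simp add: powr_diff)
      have 2: "(\<Sum>i<N. df i (t * x) / t * g i (t * y) + dg i (t * y) / t * f i (t * x)) =
          (\<Sum>i<N. df i (t * x) * g i (t * y) + f i (t * x) * dg i (t * y)) / t"
        by (simp add: sum_divide_distrib add_divide_distrib mult.commute)
      have 3: "(- s * (T / t)) * C + (D / t) * T = T / t * (D - s * C)" for T C D :: real
        using t by (simp add: field_simps)
      show ?thesis unfolding 1 2 by (rule 3)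
    qed
    moreover have "t powr (- s) / t * ((t * x - t * y) * (u (t * x) * v (t * y))) = t powr (- s) * ((x - y) * (u (t * x) * v (t * y)))"
      using t by (simp add: field_simps)
    ultimately show ?thesis using alg[of "t * x" "t * y"] t xy by simp
  qed
  have dS: "(S has_real_derivative \<kappa> * ((x - y) * (u (t powr \<kappa> * x) * v (t powr \<kappa> * y)))) (at t)" if t: "0 < t" for t
  proof -
    let ?uv = "(x - y) * (u (t powr \<kappa> * x) * v (t powr \<kappa> * y))"
    have "((\<lambda>t. H (t powr \<kappa>)) has_real_derivative ((t powr \<kappa>) powr (- s) * ?uv) * (\<kappa> * t powr (\<kappa> - 1))) (at t)"
      by (rule DERIV_chain'[of "\<lambda>t. t powr \<kappa>" _ t UNIV H]) (use t in \<open>auto intro!: has_real_derivative_powr dH\<close>)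
    \<comment> \<open>This cancellation is the reason for the exponent \<kappa>: the substitution
      removes the singular weight.\<close>
    moreover have "(t powr \<kappa>) powr (- s) * t powr (\<kappa> - 1) = 1"
    proof -
      have "(t powr \<kappa>) powr (- s) * t powr (\<kappa> - 1) = t powr (\<kappa> * (- s) + (\<kappa> - 1))" by (simp only: powr_powr powr_add)
      also have "\<kappa> * (- s) + (\<kappa> - 1) = 0" using \<kappa>(2) by (simp add: algebra_simps)
      finally show ?thesis using t by simp
    qed
    then have "((t powr \<kappa>) powr (- s) * t powr (\<kappa> - 1)) * (\<kappa> * ?uv) = \<kappa> * ?uv" by simp
    then have "((t powr \<kappa>) powr (- s) * ?uv) * (\<kappa> * t powr (\<kappa> - 1)) = \<kappa> * ?uv" by (simp only: mult_ac)
    ultimately have "((\<lambda>t. H (t powr \<kappa>)) has_real_derivative \<kappa> * ?uv) (at t)" by simp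
    then show ?thesis
      by (rule has_field_derivative_transform_within_open[of _ _ _ "{0<..}"]) (use t in \<open>auto simp: S_def\<close>)
  qed
  have "((\<lambda>t. \<kappa> * ((x - y) * (u (t powr \<kappa> * x) * v (t powr \<kappa> * y)))) has_integral S 1 - S 0) {0..1}"
  proof (rule fundamental_theorem_of_calculus_interior)
    show "continuous_on {0..1} S"
      unfolding continuous_on_eq_continuous_within
    proof
      fix t :: real assume t: "t \<in> {0..1}"
      show "continuous (at t within {0..1}) S"
      proof (cases "t = 0")
        case True
        have "filterlim (\<lambda>t. t powr \<kappa>) (at_right 0) (at_right (0::real))"
          unfolding filterlim_at
        proof
          show "((\<lambda>t. t powr \<kappa>) \<longlongrightarrow> 0) (at_right (0::real))" using \<kappa>(1) by real_asymp
          show "\<forall>\<^sub>F t in at_right (0::real). t powr \<kappa> \<in> {0<..} \<and> t powr \<kappa> \<noteq> 0"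
            unfolding eventually_at_filter by (rule always_eventually) simp
        qed
        from filterlim_compose[OF lim this]
        have "((\<lambda>t. H (t powr \<kappa>)) \<longlongrightarrow> 0) (at_right 0)" by (simp add: H_def)
        then have "(S \<longlongrightarrow> 0) (at_right 0)"
        proof (rule Lim_transform_eventually)
          show "\<forall>\<^sub>F t in at_right 0. H (t powr \<kappa>) = S t"
            unfolding eventually_at_filter by (rule always_eventually) (simp add: S_def)
        qed
        moreover have "at 0 within {0..1} = at_right (0::real)" by (rule at_within_Icc_at_right) simp
        ultimately show ?thesis using True by (simp add: continuous_within S_def)
      next
        case False
        then have "0 < t" using t by simp
        from DERIV_isCont[OF dS[OF this]] show ?thesis by (rule continuous_at_imp_continuous_at_within)
      qed
    qed
    show "(S has_vector_derivative \<kappa> * ((x - y) * (u (t powr \<kappa> * x) * v (t powr \<kappa> * y)))) (at t)"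
      if "t \<in> {0<..<1}" for t
      using dS[of t] that by (simp add: has_real_derivative_iff_has_vector_derivative)
  qed simp
  from integral_unique[OF this]
  have "\<kappa> * ((x - y) * integral {0..1} (\<lambda>t. u (t powr \<kappa> * x) * v (t powr \<kappa> * y))) = (\<Sum>i<N. f i x * g i y)"
    by (simp add: S_def H_def)
  then show ?thesis unfolding \<kappa>_def[symmetric] by (simp add: scal_def mult_ac)
qed

section \<open>The kernel of the paper\<close>

lemma frac_not_int:
  fixes i j m :: nat
  assumes "i < m" "j < m" "i \<noteq> j" shows "(real i - real j) / real m \<notin> \<int>"
proof
  assume "(real i - real j) / real m \<in> \<int>"
  then obtain q where q: "(real i - real j) / real m = of_int q" by (auto elim: Ints_cases)
  then have "real i - real j = of_int q * real m" using assms by (simp add: field_simps)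
  then have "real_of_int (int i - int j) = of_int (q * int m)" by simp
  then have eq: "int i - int j = q * int m" by (simp only: of_int_eq_iff)
  then have "q \<noteq> 0" using assms by auto
  then have "1 * int m \<le> \<bar>q\<bar> * int m" by (intro mult_right_mono) auto
  then have "int m \<le> \<bar>q * int m\<bar>" by (simp add: abs_mult)
  with eq assms show False by auto
qed

lemma wt_mult_hat: "0 < x \<Longrightarrow> wt s x * hat s A c x = hat 0 A c x"
  unfolding hat_def sum_distrib_left
  by (intro sum.cong) (auto simp: wt_def pw_pos powr_add powr_minus field_simps)

lemma euler_op_power_hat:
  assumes A: "finite A" and c: "entire_coeffs A c" and h: "\<And>x. 0 < x \<Longrightarrow> h x = hat 0 A c x"
  shows "0 < x \<Longrightarrow> (euler_op ^^ i) h x = hat 0 A (\<lambda>e r. (e + real r) ^ i * c e r) x"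
proof (induction i arbitrary: x)
  case (Suc i)
  let ?c = "\<lambda>e r. (e + real r) ^ i * c e r"
  have "(hat 0 A ?c has_real_derivative hat 0 A (\<lambda>e r. (e + 0 + real r) * ?c e r) x / x) (at x)"
    using entire_coeffs_power[OF c, of 0 i] by (intro hat_deriv A Suc.prems) simp
  then have "((euler_op ^^ i) h has_real_derivative hat 0 A (\<lambda>e r. (e + 0 + real r) * ?c e r) x / x) (at x)"
    by (rule has_field_derivative_transform_within_open[of _ _ _ "{0<..}"]) (use Suc in auto)
  then have "deriv ((euler_op ^^ i) h) x = hat 0 A (\<lambda>e r. (e + 0 + real r) * ?c e r) x / x"
    by (rule DERIV_imp_deriv)
  moreover have "(euler_op ^^ Suc i) h x = x * deriv ((euler_op ^^ i) h) x"
    by (simp add: euler_op_def[of "(euler_op ^^ i) h"])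
  ultimately show ?case using Suc.prems by (simp add: mult.assoc)
qed (simp add: h)

lemma meijer_G_Re:
  assumes A: "meijer_simple (take k \<beta>s)" and z: "0 < z"
  defines "c \<equiv> \<lambda>e r. Re (meijer_simple.res_coeff (take k \<beta>s) (drop k \<beta>s) e r)"
  shows "Re (meijer_G k \<beta>s z) = hat 0 (set (take k \<beta>s)) c z"
proof -
  interpret m: meijer_simple "take k \<beta>s" "drop k \<beta>s" by (rule A)
  have "Re (of_real (z powr e) * (\<Sum>q. m.res_coeff e q * of_real z ^ q)) = pw z (e + 0) * (\<Sum>r. c e r * z ^ r)"
    if e: "e \<in> set (take k \<beta>s)" for e
  proof -
    have sm: "summable (\<lambda>q. m.res_coeff e q * of_real z ^ q)"
      by (rule summable_norm_cancel[OF m.res_coeff_summable[OF e]])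
    have "Re (\<Sum>q. m.res_coeff e q * of_real z ^ q) = (\<Sum>q. Re (m.res_coeff e q * of_real z ^ q))"
      by (rule bounded_linear.suminf[OF bounded_linear_Re sm])
    also have "\<dots> = (\<Sum>q. c e q * z ^ q)" by (simp add: c_def flip: of_real_power)
    finally show ?thesis using z by (simp add: pw_pos)
  qed
  then show ?thesis unfolding meijer_G_expansion[OF A z] hat_def by (simp add: Re_sum)
qed

lemma meijer_G_Re_coeffs:
  assumes A: "meijer_simple (take k \<beta>s)"
  defines "c \<equiv> \<lambda>e r. Re (meijer_simple.res_coeff (take k \<beta>s) (drop k \<beta>s) e r)"
  shows "entire_coeffs (set (take k \<beta>s)) c"
    and "e \<in> set (take k \<beta>s) \<Longrightarrow> c e (Suc r) * (\<Prod>\<beta>\<leftarrow>\<beta>s. \<beta> - e - real (Suc r)) = (-1) ^ length (drop k \<beta>s) * c e r"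
proof -
  interpret m: meijer_simple "take k \<beta>s" "drop k \<beta>s" by (rule A)
  show "entire_coeffs (set (take k \<beta>s)) c"
    unfolding entire_coeffs_def
  proof (intro ballI allI)
    fix e x assume e: "e \<in> set (take k \<beta>s)"
    have "summable (\<lambda>q. m.res_coeff e q * of_real x ^ q)"
      by (rule summable_norm_cancel[OF m.res_coeff_summable[OF e]])
    then have "summable (\<lambda>q. Re (m.res_coeff e q * of_real x ^ q))" by (rule bounded_linear.summable[OF bounded_linear_Re])
    then show "summable (\<lambda>q. c e q * x ^ q)" by (simp add: c_def flip: of_real_power)
  qed
  show "c e (Suc r) * (\<Prod>\<beta>\<leftarrow>\<beta>s. \<beta> - e - real (Suc r)) = (-1) ^ length (drop k \<beta>s) * c e r" if e: "e \<in> set (take k \<beta>s)"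
  proof -
    have "(\<Prod>\<beta>\<leftarrow>xs. complex_of_real \<beta> - of_real e - of_nat (Suc r)) = of_real (\<Prod>\<beta>\<leftarrow>xs. \<beta> - e - real (Suc r))" for xs
      by (induction xs) simp_all
    then have "m.res_coeff e (Suc r) * of_real (\<Prod>\<beta>\<leftarrow>\<beta>s. \<beta> - e - real (Suc r)) = of_real ((-1) ^ length (drop k \<beta>s)) * m.res_coeff e r"
      using m.res_coeff_Suc[OF e, of r] by (simp only: append_take_drop_id of_real_power of_real_minus of_real_1)
    moreover have "Re (w * of_real x) = Re w * x" "Re (of_real x * w) = x * Re w" for w x by simp_all
    ultimately show ?thesis unfolding c_def by metis
  qed
qed

section \<open>Exponents, coefficients and Euler equations of the functions phi and psi\<close>

locale mb_params =
  fixes m n :: nat and \<alpha> :: real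
  assumes m: "m \<ge> 1" and n: "n \<ge> 1" and \<alpha>: "\<alpha> > real m - 1 - real m / real n"
begin

abbreviation "N \<equiv> m + n"
abbreviation "\<nu> \<equiv> mb_nu m n \<alpha>"
abbreviation "b \<equiv> mb_b m n \<alpha>"
abbreviation "\<sigma> \<equiv> (- 1 :: real) ^ n"

text \<open>The functions \<open>\<phi>\<^sub>i\<close> may have a singularity at \<open>0\<close>, but only of order at most \<open>s\<close>.\<close>

definition s :: real where "s = max 0 (1 - (\<alpha> + 1) / real m)"

lemma s_nonneg: "0 \<le> s" by (simp add: s_def)

text \<open>This is what the hypothesis on \<alpha> means: \<open>1 / n\<close> is the least
  possible positive exponent of \<open>mb_g\<close>. The bound implies integrability of the weight
  and is used again in \<open>Ag_cases\<close>.\<close>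

lemma s_less: "s < 1 / real n"
  using \<alpha> m n by (auto simp: s_def field_simps)

lemma s_less_1: "s < 1"
proof -
  have "1 / real n \<le> 1" using n by simp
  then show ?thesis using s_less by linarith
qed

text \<open>Connects the absence of a weight with the condition in
  \<open>x_finite_at\<close>.\<close>

lemma s_eq_0: "s = 0 \<longleftrightarrow> real m - 1 \<le> \<alpha>"
  using m by (auto simp: s_def max_def field_simps)

text \<open>\<open>t * Bp t\<close> is the indicial polynomial of the hypergeometric equation of
  \<open>mb_g\<close>; that of \<open>mb_f\<close> arises by replacing \<open>t\<close> by
  \<open>- t\<close>.\<close>

definition Bp :: "real \<Rightarrow> real" where "Bp t = (\<Prod>i\<in>{1..<N}. t - \<nu> i)"

lemma b_poly: "Bp t = (\<Sum>k<N. b k * t ^ k)" and b_last: "b (N - 1) = 1"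
proof -
  define pp where "pp M = (\<Prod>k = 1..M. [:- \<nu> k, 1:])" for M
  have deg: "degree (pp M) = M \<and> coeff (pp M) M = 1" for M
  proof (induction M)
    case (Suc M)
    have eq: "pp (Suc M) = [:- \<nu> (Suc M), 1:] * pp M" by (simp add: pp_def mult.commute)
    have nz: "pp M \<noteq> 0" using Suc by auto
    have "degree (pp (Suc M)) = Suc M" unfolding eq using nz Suc by (subst degree_mult_eq) auto
    moreover have "lead_coeff (pp (Suc M)) = 1" unfolding eq lead_coeff_mult using Suc by simp
    ultimately show ?case by simp
  qed (simp add: pp_def)
  have bpp: "b k = coeff (pp (N - 1)) k" for k by (simp add: mb_b_def pp_def)
  show "b (N - 1) = 1" using deg bpp by simp
  have "poly (pp (N - 1)) t = Bp t"
  proof -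
    have "{1..N - 1} = {1..<N}" using m by auto
    then show ?thesis unfolding pp_def Bp_def poly_prod by (intro prod.cong) auto
  qed
  moreover have "poly (pp (N - 1)) t = (\<Sum>k<N. b k * t ^ k)"
  proof -
    have "{..N - 1} = {..<N}" using m by auto
    then show ?thesis using deg[of "N - 1"] by (simp add: poly_altdef bpp)
  qed
  ultimately show "Bp t = (\<Sum>k<N. b k * t ^ k)" by simp
qed

definition Lf where "Lf = map (\<lambda>i. - \<nu> i) (rev [1..<N]) @ [\<nu> 0]"
definition Lg where "Lg = map \<nu> [0..<N]"

lemma upt_split: "[i..<m + n] = [i..<n] @ [n..<m + n]" if "i \<le> n" for i
  using upt_add_eq_append[OF that, of m] by (simp add: add.commute)

text \<open>The reversal in the parameter list puts the indices from \<open>n\<close> on first, so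
  the leading exponents of \<open>mb_f\<close> are the \<open>- \<nu> i\<close> with
  \<open>n \<le> i\<close>.\<close>

lemma take_Lf: "take m Lf = map (\<lambda>i. - \<nu> i) (rev [n..<N])"
  and drop_Lf: "length (drop m Lf) = n"
  unfolding Lf_def using upt_split[of 1] n by (auto simp: take_map)

lemma take_Lg: "take n Lg = map \<nu> [0..<n]" and drop_Lg: "length (drop n Lg) = m"
  unfolding Lg_def using upt_split[of 0] by (auto simp: take_map)

definition Af where "Af = set (take m Lf)"
definition Ag where "Ag = set (take n Lg)"

lemma Af: "Af = (\<lambda>i. - \<nu> i) ` {n..<N}" and Ag: "Ag = \<nu> ` {0..<n}"
  by (auto simp: Af_def Ag_def take_Lf take_Lg)

lemma finite_Af: "finite Af" and finite_Ag: "finite Ag" by (simp_all add: Af_def Ag_def)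

text \<open>Differences of exponents are differences of two distinct numbers below \<open>m\<close>,
  divided by \<open>m\<close>.\<close>

lemma simple_f: "meijer_simple (take m Lf)"
proof -
  have key: "(- \<nu> i) - (- \<nu> j) \<notin> \<int>" if "i \<in> {n..<N}" "j \<in> {n..<N}" "i \<noteq> j" for i j
  proof -
    have "(- \<nu> i) - (- \<nu> j) = (real (i - n) - real (j - n)) / real m"
      using that m by (simp add: mb_nu_def of_nat_diff field_simps)
    then show ?thesis by (simp only:) (rule frac_not_int; use that in auto)
  qed
  show ?thesis
  proof
    have "inj_on (\<lambda>i. - \<nu> i) {n..<N}"
    proof (rule inj_onI)
      fix i j assume ij: "i \<in> {n..<N}" "j \<in> {n..<N}" "- \<nu> i = - \<nu> j"
      show "i = j"
      proof (rule ccontr)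
        assume "i \<noteq> j"
        from key[OF ij(1,2) this] ij(3) show False by simp
      qed
    qed
    then show "distinct (take m Lf)" by (simp add: take_Lf distinct_map)
    show "x - y \<notin> \<int>" if xy: "x \<in> set (take m Lf)" "y \<in> set (take m Lf)" "x \<noteq> y" for x y
    proof -
      obtain i j where "x = - \<nu> i" "y = - \<nu> j" "i \<in> {n..<N}" "j \<in> {n..<N}"
        using xy(1,2) unfolding Af_def[symmetric] Af by blast
      then show ?thesis using key[of i j] xy(3) by blast
    qed
    show "take m Lf \<noteq> []" using m by (simp add: take_Lf)
  qed
qed

lemma simple_g: "meijer_simple (take n Lg)"
proof -
  have nu: "\<nu> i = real i / real n" if "i < n" for i using that by (simp add: mb_nu_def)
  have key: "\<nu> i - \<nu> j \<notin> \<int>" if "i < n" "j < n" "i \<noteq> j" for i j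
    using frac_not_int[OF that] by (simp add: nu that diff_divide_distrib)
  show ?thesis
  proof
    have "inj_on \<nu> {0..<n}" by (auto simp: inj_on_def nu)
    then show "distinct (take n Lg)" by (simp add: take_Lg distinct_map)
    show "x - y \<notin> \<int>" if xy: "x \<in> set (take n Lg)" "y \<in> set (take n Lg)" "x \<noteq> y" for x y
    proof -
      obtain i j where "x = \<nu> i" "y = \<nu> j" "i < n" "j < n"
        using xy(1,2) unfolding Ag_def[symmetric] Ag by auto
      then show ?thesis using key[of i j] xy(3) by blast
    qed
    show "take n Lg \<noteq> []" using n by (simp add: take_Lg)
  qed
qed

definition cf where "cf e r = Re (meijer_simple.res_coeff (take m Lf) (drop m Lf) e r)"
definition cg where "cg e r = Re (meijer_simple.res_coeff (take n Lg) (drop n Lg) e r)"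

lemma mb_f_hat: "0 < x \<Longrightarrow> mb_f m n \<alpha> x = hat 0 Af cf x"
  using meijer_G_Re[OF simple_f] unfolding mb_f_def Lf_def[symmetric] Af_def cf_def[abs_def] by simp

lemma mb_g_hat: "0 < x \<Longrightarrow> mb_g m n \<alpha> x = hat 0 Ag cg x"
  using meijer_G_Re[OF simple_g] unfolding mb_g_def Lg_def[symmetric] Ag_def cg_def[abs_def] by simp

lemma entire_cf: "entire_coeffs Af cf"
  using meijer_G_Re_coeffs(1)[OF simple_f] unfolding Af_def cf_def[abs_def] .

lemma entire_cg: "entire_coeffs Ag cg"
  using meijer_G_Re_coeffs(1)[OF simple_g] unfolding Ag_def cg_def[abs_def] .

lemma nu_0 [simp]: "\<nu> 0 = 0" using n by (simp add: mb_nu_def)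

lemma prod_Lf: "(\<Prod>\<beta>\<leftarrow>Lf. \<beta> - t) = (- t) * Bp (- t)"
proof -
  have "(\<Prod>\<beta>\<leftarrow>map (\<lambda>i. - \<nu> i) (rev [1..<N]). \<beta> - t) = prod_list (map (\<lambda>i. - t - \<nu> i) (rev [1..<N]))"
  proof -
    have "(\<lambda>i. - \<nu> i - t) = (\<lambda>i. - t - \<nu> i)" by (simp add: fun_eq_iff)
    then show ?thesis by (simp only: map_map o_def)
  qed
  also have "\<dots> = Bp (- t)"
    unfolding Bp_def by (subst prod.distinct_set_conv_list[symmetric]) auto
  finally show ?thesis by (simp add: Lf_def)
qed

lemma prod_Lg: "(\<Prod>\<beta>\<leftarrow>Lg. \<beta> - t) = (- 1) ^ N * (t * Bp t)"
proof -
  have "(\<Prod>\<beta>\<leftarrow>Lg. \<beta> - t) = (\<Prod>i\<in>{0..<N}. \<nu> i - t)"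
    using prod.distinct_set_conv_list[of "[0..<N]" "\<lambda>i. \<nu> i - t"] by (simp add: Lg_def o_def)
  also have "\<dots> = (\<Prod>i\<in>{0..<N}. (- 1) * (t - \<nu> i))" by (intro prod.cong) auto
  also have "\<dots> = (- 1) ^ N * (\<Prod>i\<in>{0..<N}. t - \<nu> i)" by (simp only: prod.distrib prod_constant card_atLeastLessThan diff_zero)
  also have "{0..<N} = insert 0 {1..<N}" using m by auto
  also have "(\<Prod>i\<in>insert 0 {1..<N}. t - \<nu> i) = t * Bp t" by (simp add: Bp_def)
  finally show ?thesis .
qed

lemma cf_Suc: "e \<in> Af \<Longrightarrow> (- (e + real (Suc r))) * Bp (- (e + real (Suc r))) * cf e (Suc r) = \<sigma> * cf e r"
  using meijer_G_Re_coeffs(2)[OF simple_f, of e r] prod_Lf[of "e + real (Suc r)"] drop_Lf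
  unfolding Af_def cf_def diff_diff_eq by (simp only: mult.commute)

text \<open>The sign agrees with that of \<open>cf_Suc\<close>: \<open>(-1) ^ m\<close> from the
  denominator parameters meets \<open>(-1) ^ N\<close> from \<open>prod_Lg\<close>.\<close>

lemma cg_Suc:
  assumes "e \<in> Ag" shows "(e + real (Suc r)) * Bp (e + real (Suc r)) * cg e (Suc r) = \<sigma> * cg e r"
proof -
  have "cg e (Suc r) * ((- 1) ^ N * ((e + real (Suc r)) * Bp (e + real (Suc r)))) = (- 1) ^ m * cg e r"
    using meijer_G_Re_coeffs(2)[OF simple_g, of e r] prod_Lg[of "e + real (Suc r)"] drop_Lg assms
    unfolding Ag_def cg_def diff_diff_eq by (simp only:)
  then have "(- 1) ^ N * (cg e (Suc r) * ((- 1) ^ N * ((e + real (Suc r)) * Bp (e + real (Suc r))))) = (- 1) ^ N * ((- 1) ^ m * cg e r)"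
    by (rule arg_cong)
  moreover have "(- 1) ^ N * ((- 1) ^ m * cg e r) = \<sigma> * cg e r" by (simp add: power_add flip: mult.assoc)
  moreover have "(- 1) ^ N * (cg e (Suc r) * ((- 1) ^ N * ((e + real (Suc r)) * Bp (e + real (Suc r))))) =
      ((- 1) ^ N * (- 1) ^ N) * ((e + real (Suc r)) * Bp (e + real (Suc r)) * cg e (Suc r))"
    by (simp only: mult_ac)
  ultimately show ?thesis by (simp flip: power_add)
qed

lemma Bp_root_f: "e \<in> Af \<Longrightarrow> Bp (- e) = 0"
  using n m by (auto simp: Af Bp_def intro!: bexI)

lemma Bp_root_g: "e \<in> Ag \<Longrightarrow> e * Bp e = 0"
proof -
  assume "e \<in> Ag"
  then obtain i where i: "i < n" "e = \<nu> i" by (auto simp: Ag)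
  show ?thesis
  proof (cases "i = 0")
    case False
    then have "Bp e = 0" unfolding Bp_def using i by (intro prod_zero) (auto intro!: bexI[of _ i])
    then show ?thesis by simp
  qed (use i in simp)
qed

lemma Af_ge: "e \<in> Af \<Longrightarrow> 0 \<le> e + s"
proof -
  assume "e \<in> Af"
  then obtain i where i: "n \<le> i" "i < N" "e = - \<nu> i" by (auto simp: Af)
  have "e = \<alpha> / real m - 1 + (real i - real n + 1) / real m" using i by (simp add: mb_nu_def)
  moreover have "1 / real m \<le> (real i - real n + 1) / real m" using i m by (intro divide_right_mono) auto
  moreover have "1 - (\<alpha> + 1) / real m \<le> s" by (simp add: s_def)
  ultimately show ?thesis by (simp add: add_divide_distrib)
qed

lemma Ag_cases: "e \<in> Ag \<Longrightarrow> e = 0 \<or> s < e"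
proof -
  assume "e \<in> Ag"
  then obtain i where i: "i < n" "e = real i / real n" by (auto simp: Ag mb_nu_def)
  show ?thesis
  proof (cases "i = 0")
    case False
    then have "1 / real n \<le> e" using i n by (simp add: divide_right_mono)
    then show ?thesis using s_less by linarith
  qed (use i in simp)
qed

lemma Ag_ge: "e \<in> Ag \<Longrightarrow> 0 \<le> e + 0"
  using Ag_cases[of e] s_nonneg by auto

lemma zero_in_Ag: "0 \<in> Ag"
  unfolding Ag by (rule image_eqI[of _ _ 0]) (use n in simp_all)

text \<open>Coefficients of \<open>\<phi>\<^sub>i\<close> and \<open>\<psi>\<^sub>i\<close>; accordingly \<open>f i\<close> and \<open>g i\<close> below are \<open>\<phi>\<^sub>i\<close> divided by the weight
  and \<open>\<psi>\<^sub>i\<close>, both continuous on \<open>[0, \<infinity>)\<close>.\<close>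

definition fc :: "nat \<Rightarrow> real \<Rightarrow> nat \<Rightarrow> real" where
  "fc i e r = - \<sigma> * (- (e + real r)) ^ i * cf e r"
definition gc :: "nat \<Rightarrow> real \<Rightarrow> nat \<Rightarrow> real" where
  "gc i e r = (\<Sum>j<N - i. b (i + j) * (e + real r) ^ j) * cg e r"
definition f :: "nat \<Rightarrow> real \<Rightarrow> real" where "f i = hat s Af (fc i)"
definition g :: "nat \<Rightarrow> real \<Rightarrow> real" where "g i = hat 0 Ag (gc i)"
definition \<beta> :: "nat \<Rightarrow> real" where "\<beta> i = (if i = 0 then 0 else b (i - 1))"
definition df :: "nat \<Rightarrow> real \<Rightarrow> real" where "df i x = s * f i x - f (i + 1) x"
definition dg :: "nat \<Rightarrow> real \<Rightarrow> real" where
  "dg j y = (if j = 0 then \<sigma> * (y * g (N - 1) y) else g (j - 1) y - \<beta> j * g (N - 1) y)"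

lemma fc_alt: "fc i e r = (- \<sigma> * (- 1) ^ i) * ((e + 0 + real r) ^ i * cf e r)"
  unfolding fc_def power_minus[of "e + real r"] by simp

lemma entire_fc: "entire_coeffs Af (fc i)"
proof -
  have "fc i = (\<lambda>e r. (- \<sigma> * (- 1) ^ i) * ((e + 0 + real r) ^ i * cf e r))" by (intro ext fc_alt)
  then show ?thesis by (simp only: entire_coeffs_cmult[OF entire_coeffs_power[OF entire_cf]])
qed

lemma gc_alt: "gc i e r = (\<Sum>j<N - i. b (i + j) * ((e + 0 + real r) ^ j * cg e r))"
  by (simp add: gc_def sum_distrib_right mult.assoc)

lemma entire_gc: "entire_coeffs Ag (gc i)"
proof -
  have "gc i = (\<lambda>e r. \<Sum>j<N - i. b (i + j) * ((e + 0 + real r) ^ j * cg e r))" by (intro ext gc_alt)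
  then show ?thesis by (simp only: entire_coeffs_sum entire_coeffs_cmult[OF entire_coeffs_power[OF entire_cg]])
qed

lemma phi_eq:
  assumes x: "0 < x" shows "mb_phi m n \<alpha> i x = wt s x * f i x"
proof -
  have "(- 1 :: real) powi (int n + 1 - int i) = - \<sigma> * (- 1) ^ i"
  proof -
    have "(- 1 :: real) powi (int n + 1 - int i) = (- 1) powi (int (n + 1)) / (- 1) powi (int i)"
      by (subst power_int_diff[symmetric]) (auto simp: add.commute)
    also have "\<dots> = (- 1) ^ (n + 1) / (- 1) ^ i" by (simp only: power_int_of_nat)
    also have "\<dots> = - \<sigma> * (- 1) ^ i" by (cases "even i") auto
    finally show ?thesis .
  qed
  moreover have "(euler_op ^^ i) (mb_f m n \<alpha>) x = hat 0 Af (\<lambda>e r. (e + real r) ^ i * cf e r) x"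
    by (rule euler_op_power_hat[OF finite_Af entire_cf mb_f_hat x])
  moreover have "wt s x * f i x = hat 0 Af (fc i) x" unfolding f_def by (rule wt_mult_hat[OF x])
  moreover have "hat 0 Af (fc i) x = (- \<sigma> * (- 1) ^ i) * hat 0 Af (\<lambda>e r. (e + real r) ^ i * cf e r) x"
  proof -
    have "fc i = (\<lambda>e r. (- \<sigma> * (- 1) ^ i) * ((e + 0 + real r) ^ i * cf e r))" by (intro ext fc_alt)
    then show ?thesis using hat_cmult[OF entire_coeffs_power[OF entire_cf, of 0 i], of 0 "- \<sigma> * (- 1) ^ i"] by simp
  qed
  ultimately show ?thesis by (simp add: mb_phi_def)
qed

lemma psi_eq:
  assumes y: "0 < y" shows "mb_psi m n \<alpha> i y = g i y"
proof -
  have "mb_psi m n \<alpha> i y = (\<Sum>j<N - i. b (i + j) * hat 0 Ag (\<lambda>e r. (e + real r) ^ j * cg e r) y)"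
    unfolding mb_psi_def
    by (intro sum.cong refl arg_cong2[where f="(*)"] euler_op_power_hat[OF finite_Ag entire_cg mb_g_hat y])
  also have "\<dots> = (\<Sum>j<N - i. hat 0 Ag (\<lambda>e r. b (i + j) * ((e + 0 + real r) ^ j * cg e r)) y)"
    using hat_cmult[OF entire_coeffs_power[OF entire_cg, of 0]] by simp
  also have "\<dots> = hat 0 Ag (\<lambda>e r. \<Sum>j<N - i. b (i + j) * ((e + 0 + real r) ^ j * cg e r)) y"
    by (subst hat_sum[OF entire_coeffs_cmult[OF entire_coeffs_power[OF entire_cg]]]) simp
  also have "(\<lambda>e r. \<Sum>j<N - i. b (i + j) * ((e + 0 + real r) ^ j * cg e r)) = gc i" by (intro ext gc_alt[symmetric])
  finally show ?thesis by (simp add: g_def)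
qed

lemma continuous_f: "continuous_on {0..} (f i)"
  unfolding f_def by (rule continuous_on_hat[OF finite_Af entire_fc Af_ge])

lemma continuous_g: "continuous_on {0..} (g i)"
  unfolding g_def by (rule continuous_on_hat[OF finite_Ag entire_gc Ag_ge])

text \<open>The differential equation of \<open>mb_f\<close>, which closes the chain of Euler
  derivatives after \<open>N\<close> steps: the leading coefficients vanish at the roots of
  \<open>Bp\<close>, and \<open>cf_Suc\<close> shifts the others.\<close>

lemma f_N: "f N x = \<sigma> * (x * f 0 x) - (\<Sum>i<N. \<beta> i * f i x)"
proof -
  have id: "(\<Sum>k<N. b k * fc (k + 1) e r) = \<sigma> * (case r of 0 \<Rightarrow> 0 | Suc r \<Rightarrow> fc 0 e r)" if e: "e \<in> Af" for e r
  proof -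
    let ?t = "- (e + real r)"
    have "(\<Sum>k<N. b k * fc (k + 1) e r) = - \<sigma> * (?t * Bp ?t * cf e r)"
      unfolding b_poly by (simp add: fc_def sum_distrib_left sum_distrib_right mult_ac)
    also have "\<dots> = \<sigma> * (case r of 0 \<Rightarrow> 0 | Suc r \<Rightarrow> fc 0 e r)"
    proof (cases r)
      case 0 then show ?thesis using Bp_root_f[OF e] by simp
    next
      case (Suc r') then show ?thesis using cf_Suc[OF e, of r'] by (simp add: fc_def)
    qed
    finally show ?thesis .
  qed
  have "(\<Sum>k<N. b k * f (k + 1) x) = hat s Af (\<lambda>e r. \<Sum>k<N. b k * fc (k + 1) e r) x"
    unfolding f_def by (subst hat_sum[OF entire_coeffs_cmult[OF entire_fc]]) (simp add: hat_cmult[OF entire_fc])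
  also have "\<dots> = hat s Af (\<lambda>e r. \<sigma> * (case r of 0 \<Rightarrow> 0 | Suc r \<Rightarrow> fc 0 e r)) x"
    unfolding hat_def by (intro sum.cong refl) (simp only: id)
  also have "\<dots> = \<sigma> * (x * f 0 x)"
    unfolding f_def mult_hat[OF entire_fc] by (rule hat_cmult[OF entire_coeffs_shift[OF entire_fc]])
  finally have "(\<Sum>k<N. b k * f (k + 1) x) = \<sigma> * (x * f 0 x)" .
  moreover have "(\<Sum>k<N. b k * f (k + 1) x) = f N x + (\<Sum>i<N. \<beta> i * f i x)"
  proof -
    obtain M where M: "N = Suc M" using m by (cases N) auto
    have "(\<Sum>i<Suc M. \<beta> i * f i x) = \<beta> 0 * f 0 x + (\<Sum>i<M. \<beta> (Suc i) * f (Suc i) x)" by (rule sum.lessThan_Suc_shift)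
    then show ?thesis using b_last by (simp add: M \<beta>_def)
  qed
  ultimately show ?thesis by simp
qed

lemma euler_fun_f: "euler_fun (f i) (df i)"
proof
  show "continuous_on {0..} (f i)" by (rule continuous_f)
  show "continuous_on {0..} (df i)" unfolding df_def by (intro continuous_intros continuous_f)
  fix x :: real assume x: "0 < x"
  have "(\<lambda>e r. (e + s + real r) * fc i e r) = (\<lambda>e r. s * fc i e r + (- 1) * fc (i + 1) e r)"
    by (simp add: fc_def fun_eq_iff algebra_simps)
  then have "hat s Af (\<lambda>e r. (e + s + real r) * fc i e r) x = df i x"
    using hat_add[OF entire_coeffs_cmult[OF entire_fc] entire_coeffs_cmult[OF entire_fc], of s "\<lambda>_. s" i "\<lambda>_. - 1" "i + 1" x]
    by (simp add: df_def f_def hat_cmult[OF entire_fc, of s s] hat_cmult[OF entire_fc, of s "- 1", simplified])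
  then show "(f i has_real_derivative df i x / x) (at x)"
    using hat_deriv[OF finite_Af entire_fc x, of s i] by (simp add: f_def)
qed

lemma gc_last: "gc (N - 1) e r = cg e r"
proof -
  have "N - (N - 1) = Suc 0" using m by simp
  then show ?thesis using b_last by (simp add: gc_def)
qed

text \<open>Horner's scheme for \<open>Bp\<close>: the polynomial in \<open>gc (j - 1)\<close> is
  \<open>b (j - 1)\<close> plus the variable times the polynomial in \<open>gc j\<close>.\<close>

lemma gc_Suc:
  assumes j: "1 \<le> j" "j < N"
  shows "(e + real r) * gc j e r = gc (j - 1) e r - b (j - 1) * gc (N - 1) e r"
proof -
  have "N - (j - 1) = Suc (N - j)" using j by simp
  then have "(\<Sum>i<N - (j - 1). b (j - 1 + i) * (e + real r) ^ i) = b (j - 1) + (\<Sum>i<N - j. b (j - 1 + Suc i) * (e + real r) ^ Suc i)"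
    by (simp only: sum.lessThan_Suc_shift) simp
  also have "(\<Sum>i<N - j. b (j - 1 + Suc i) * (e + real r) ^ Suc i) = (e + real r) * (\<Sum>i<N - j. b (j + i) * (e + real r) ^ i)"
    unfolding sum_distrib_left using j by (intro sum.cong) (auto simp: mult_ac)
  finally show ?thesis unfolding gc_last by (simp add: gc_def algebra_simps)
qed

text \<open>Horner's scheme ends with \<open>Bp\<close> itself, so this is the differential equation
  of \<open>mb_g\<close>.\<close>

lemma gc_0: "e \<in> Ag \<Longrightarrow> (e + real r) * gc 0 e r = \<sigma> * (case r of 0 \<Rightarrow> 0 | Suc r \<Rightarrow> gc (N - 1) e r)"
proof -
  assume e: "e \<in> Ag"
  have "(e + real r) * gc 0 e r = (e + real r) * Bp (e + real r) * cg e r"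
    by (simp add: gc_def b_poly)
  also have "\<dots> = \<sigma> * (case r of 0 \<Rightarrow> 0 | Suc r \<Rightarrow> cg e r)"
  proof (cases r)
    case 0 then show ?thesis using Bp_root_g[OF e] by simp
  next
    case (Suc r') then show ?thesis using cg_Suc[OF e, of r'] by simp
  qed
  finally show ?thesis by (simp only: gc_last)
qed

lemma euler_fun_g:
  assumes j: "j < N" shows "euler_fun (g j) (dg j)"
proof
  show "continuous_on {0..} (g j)" by (rule continuous_g)
  show "continuous_on {0..} (dg j)"
    unfolding dg_def by (cases "j = 0") (auto intro!: continuous_intros continuous_g)
  fix y :: real assume y: "0 < y"
  have "hat 0 Ag (\<lambda>e r. (e + 0 + real r) * gc j e r) y = dg j y"
  proof (cases "j = 0")
    case True
    have "hat 0 Ag (\<lambda>e r. (e + 0 + real r) * gc 0 e r) y = hat 0 Ag (\<lambda>e r. \<sigma> * (case r of 0 \<Rightarrow> 0 | Suc r \<Rightarrow> gc (N - 1) e r)) y"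
      unfolding hat_def by (intro sum.cong refl) (simp only: add_0_right gc_0)
    also have "\<dots> = \<sigma> * (y * g (N - 1) y)"
      unfolding g_def mult_hat[OF entire_gc] by (rule hat_cmult[OF entire_coeffs_shift[OF entire_gc]])
    finally show ?thesis using True by (simp add: dg_def)
  next
    case False
    then have "(\<lambda>e r. (e + 0 + real r) * gc j e r) = (\<lambda>e r. gc (j - 1) e r + (- \<beta> j) * gc (N - 1) e r)"
      using gc_Suc[of j] j by (simp add: fun_eq_iff \<beta>_def)
    moreover have "hat 0 Ag (\<lambda>e r. gc (j - 1) e r + (- \<beta> j) * gc (N - 1) e r) y = g (j - 1) y + (- \<beta> j) * g (N - 1) y"
      unfolding g_def hat_cmult[OF entire_gc, symmetric] by (rule hat_add[OF entire_gc entire_coeffs_cmult[OF entire_gc]])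
    ultimately show ?thesis using False by (simp add: dg_def)
  qed
  then show "(g j has_real_derivative dg j y / y) (at y)"
    using hat_deriv[OF finite_Ag entire_gc y, of 0 j] by (simp add: g_def)
qed

section \<open>The kernel as an average of a product over dilations\<close>

definition u where "u x = - \<sigma> * f 0 x"
definition du where "du x = - \<sigma> * df 0 x"
abbreviation "v \<equiv> g (N - 1)"
abbreviation "dv \<equiv> dg (N - 1)"

lemma N2: "2 \<le> N" using m n by simp

lemma euler_fun_u: "euler_fun u du"
proof -
  interpret f0: euler_fun "f 0" "df 0" by (rule euler_fun_f)
  show ?thesis
  proof
    show "continuous_on {0..} u" unfolding u_def by (intro continuous_intros f0.u)
    show "continuous_on {0..} du" unfolding du_def by (intro continuous_intros f0.du)
    fix x :: real assume "0 < x"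
    from DERIV_cmult[OF f0.deriv[OF this], of "- \<sigma>"]
    show "(u has_real_derivative du x / x) (at x)" by (simp add: u_def[abs_def] du_def)
  qed
qed

lemma euler_fun_v: "euler_fun v dv"
  using N2 by (intro euler_fun_g) simp

text \<open>Lagrange's identity: the chains \<open>f\<close> and \<open>g\<close> belong to adjoint
  equations, so their bilinear concomitant telescopes, and only the terms with the factors
  \<open>X\<close> and \<open>Y\<close> from the two ends remain.\<close>

lemma concomitant:
  "(\<Sum>i<N. df i X * g i Y + f i X * dg i Y) - s * (\<Sum>i<N. f i X * g i Y) = (X - Y) * (u X * v Y)"
proof -
  obtain M where M: "N = Suc M" using m by (cases N) auto
  have "(\<Sum>i<N. df i X * g i Y + f i X * dg i Y) - s * (\<Sum>i<N. f i X * g i Y) =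
      (\<Sum>i<N. f i X * dg i Y) - (\<Sum>i<N. f (Suc i) X * g i Y)"
    by (simp add: df_def left_diff_distrib sum.distrib sum_subtractf sum_distrib_left mult.assoc)
  also have "(\<Sum>i<N. f (Suc i) X * g i Y) = (\<Sum>i<M. f (Suc i) X * g i Y) + f N X * v Y"
    by (simp add: M)
  also have "(\<Sum>i<N. f i X * dg i Y) = f 0 X * (\<sigma> * (Y * v Y)) + (\<Sum>i<M. f (Suc i) X * (g i Y - \<beta> (Suc i) * v Y))"
    unfolding M sum.lessThan_Suc_shift by (simp add: dg_def M)
  also have "(\<Sum>i<M. f (Suc i) X * (g i Y - \<beta> (Suc i) * v Y)) =
      (\<Sum>i<M. f (Suc i) X * g i Y) - (\<Sum>i<M. \<beta> (Suc i) * f (Suc i) X) * v Y"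
    by (simp add: right_diff_distrib sum_subtractf sum_distrib_left sum_distrib_right mult_ac)
  also have "(\<Sum>i<M. \<beta> (Suc i) * f (Suc i) X) = (\<Sum>i<N. \<beta> i * f i X)"
    unfolding M sum.lessThan_Suc_shift by (simp add: \<beta>_def)
  also have "f N X = \<sigma> * (X * f 0 X) - (\<Sum>i<N. \<beta> i * f i X)" by (rule f_N)
  finally show ?thesis by (simp add: u_def algebra_simps)
qed

text \<open>The exponents of \<open>g i\<close> other than \<open>0\<close> exceed \<open>s\<close>. The exponent \<open>0\<close> contributes a multiple of
  the sum of all \<open>b i * f i\<close>, whose leading coefficients vanish since the exponents of the \<open>\<phi>\<^sub>i\<close>
  are roots of the indicial polynomial.\<close>

lemma form_vanish:
  assumes xy: "0 \<le> x" "0 \<le> y"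
  shows "((\<lambda>t. t powr (- s) * (\<Sum>i<N. f i (t * x) * g i (t * y))) \<longlongrightarrow> 0) (at_right 0)"
proof -
  define d where "d = cg 0 0"
  \<comment> \<open>The constant \<open>- (b i * d)\<close> written as a Frobenius series; adding it
    removes the constant term at exponent 0 from \<open>g i\<close>.\<close>
  define \<delta> where "\<delta> i e r = (if e = (0::real) \<and> r = (0::nat) then - (b i * d) else 0)" for i e r
  have ed: "entire_coeffs Ag (\<delta> i)" for i
    unfolding entire_coeffs_def \<delta>_def by (intro ballI allI summable_finite[of "{0}"]) auto
  have hd: "hat 0 Ag (\<delta> i) Y = - (b i * d)" for i Y
  proof -
    have "(\<Sum>r. \<delta> i e r * Y ^ r) = (if e = 0 then - (b i * d) else 0)" for e
      by (subst suminf_finite[of "{0}"]) (auto simp: \<delta>_def)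
    then have "hat 0 Ag (\<delta> i) Y = (\<Sum>e\<in>Ag. if e = 0 then pw Y 0 * - (b i * d) else 0)"
      unfolding hat_def by (intro sum.cong) auto
    also have "\<dots> = - (b i * d)" using zero_in_Ag finite_Ag by (simp add: pw_def)
    finally show ?thesis .
  qed
  have g1: "((\<lambda>t. t powr (- s) * (g i (t * y) - b i * d)) \<longlongrightarrow> 0) (at_right 0)" if i: "i < N" for i
  proof -
    have "g i Y - b i * d = hat 0 Ag (\<lambda>e r. gc i e r + \<delta> i e r) Y" for Y
      by (simp add: hat_add[OF entire_gc ed] hd g_def)
    moreover have "((\<lambda>t. t powr (- s) * hat 0 Ag (\<lambda>e r. gc i e r + \<delta> i e r) (t * y)) \<longlongrightarrow> 0) (at_right 0)"
    proof (rule hat_vanish[OF finite_Ag entire_coeffs_add[OF entire_gc ed] s_nonneg s_less_1 xy(2)])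
      fix e assume e: "e \<in> Ag"
      have "gc i 0 0 + \<delta> i 0 0 = 0"
      proof -
        obtain M where M: "N - i = Suc M" using i by (cases "N - i") auto
        have "(\<Sum>j<N - i. b (i + j) * 0 ^ j) = b i" unfolding M sum.lessThan_Suc_shift by simp
        then show ?thesis by (simp add: gc_def \<delta>_def d_def)
      qed
      then show "0 \<le> e + 0 \<and> (gc i e 0 + \<delta> i e 0 = 0 \<or> s < e + 0)"
        using Ag_cases[OF e] Ag_ge[OF e] by auto
    qed
    ultimately show ?thesis by simp
  qed
  have f1: "((\<lambda>t. f i (t * x)) \<longlongrightarrow> f i 0) (at_right 0)" for i
  proof -
    have "((\<lambda>t. t * x) \<longlongrightarrow> 0 * x) (at_right 0)" by (intro tendsto_intros)
    moreover have "\<forall>\<^sub>F t in at_right 0. t * x \<in> {0..}"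
      using eventually_at_right_less[of "0::real"] by eventually_elim (use xy in auto)
    ultimately show ?thesis using continuous_on_tendsto_compose[OF continuous_f] by force
  qed
  have "((\<lambda>t. \<Sum>i<N. f i (t * x) * (t powr (- s) * (g i (t * y) - b i * d))) \<longlongrightarrow> (\<Sum>i<N. f i 0 * 0)) (at_right 0)"
    by (rule tendsto_sum, rule tendsto_mult[OF f1 g1]) simp
  then have 1: "((\<lambda>t. \<Sum>i<N. f i (t * x) * (t powr (- s) * (g i (t * y) - b i * d))) \<longlongrightarrow> 0) (at_right 0)" by simp
  have eb: "entire_coeffs Af (\<lambda>e r. \<Sum>i<N. b i * fc i e r)" by (intro entire_coeffs_sum entire_coeffs_cmult entire_fc)
  have "((\<lambda>t. t powr (- s) * hat s Af (\<lambda>e r. \<Sum>i<N. b i * fc i e r) (t * x)) \<longlongrightarrow> 0) (at_right 0)"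
  proof (rule hat_vanish[OF finite_Af eb s_nonneg s_less_1 xy(1)])
    fix e assume e: "e \<in> Af"
    have "(\<Sum>i<N. b i * fc i e 0) = - \<sigma> * (Bp (- e) * cf e 0)"
      unfolding b_poly by (simp add: fc_def sum_distrib_left sum_distrib_right mult_ac)
    then show "0 \<le> e + s \<and> ((\<Sum>i<N. b i * fc i e 0) = 0 \<or> s < e + s)"
      using Bp_root_f[OF e] Af_ge[OF e] by simp
  qed
  moreover have "hat s Af (\<lambda>e r. \<Sum>i<N. b i * fc i e r) X = (\<Sum>i<N. b i * f i X)" for X
    unfolding f_def by (subst hat_sum[OF entire_coeffs_cmult[OF entire_fc]]) (simp add: hat_cmult[OF entire_fc])
  ultimately have "((\<lambda>t. t powr (- s) * (\<Sum>i<N. b i * f i (t * x))) \<longlongrightarrow> 0) (at_right 0)" by simp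
  then have "((\<lambda>t. d * (t powr (- s) * (\<Sum>i<N. b i * f i (t * x)))) \<longlongrightarrow> 0) (at_right 0)"
    by (rule tendsto_mult_right_zero)
  from tendsto_add[OF 1 this]
  show ?thesis
    by (simp add: sum_distrib_left right_diff_distrib sum_subtractf mult_ac)
qed

definition \<kappa> :: real where "\<kappa> = 1 / (1 - s)"
definition k where "k = scal \<kappa> u v"
definition kx where "kx = scal \<kappa> du v"
definition ky where "ky = scal \<kappa> u dv"

lemma kappa_pos: "0 < \<kappa>" using s_less_1 by (simp add: \<kappa>_def)

lemma continuous_k: "continuous_on ({0..} \<times> {0..}) (\<lambda>z. k (fst z) (snd z))"
  and continuous_kx: "continuous_on ({0..} \<times> {0..}) (\<lambda>z. kx (fst z) (snd z))"
  and continuous_ky: "continuous_on ({0..} \<times> {0..}) (\<lambda>z. ky (fst z) (snd z))"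
  unfolding k_def kx_def ky_def
  by (intro continuous_on_scal kappa_pos euler_fun.u[OF euler_fun_u] euler_fun.u[OF euler_fun_v]
      euler_fun.du[OF euler_fun_u] euler_fun.du[OF euler_fun_v])+

lemma deriv_k_fst: "0 < x \<Longrightarrow> 0 \<le> y \<Longrightarrow> ((\<lambda>x. k x y) has_real_derivative kx x y / x) (at x)"
  unfolding k_def kx_def by (rule euler_fun.scal_deriv[OF euler_fun_u kappa_pos euler_fun.u[OF euler_fun_v]])

lemma deriv_k_snd: "0 \<le> x \<Longrightarrow> 0 < y \<Longrightarrow> ((\<lambda>y. k x y) has_real_derivative ky x y / y) (at y)"
  using euler_fun.scal_deriv[OF euler_fun_v kappa_pos euler_fun.u[OF euler_fun_u], of y x]
  unfolding k_def ky_def scal_commute[of \<kappa> v] scal_commute[of \<kappa> dv] by blast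

lemma k_rank_one: "0 \<le> x \<Longrightarrow> 0 \<le> y \<Longrightarrow> kx x y + ky x y + (1 - s) * k x y = u x * v y"
  unfolding k_def kx_def ky_def \<kappa>_def by (rule scal_euler[OF euler_fun_u euler_fun_v s_less_1])

lemma k_form: "0 \<le> x \<Longrightarrow> 0 \<le> y \<Longrightarrow> (x - y) * k x y = (\<Sum>i<N. f i x * g i y)"
  unfolding k_def \<kappa>_def
  by (rule scal_integrable_form[OF euler_fun_f euler_fun_g euler_fun.u[OF euler_fun_u] euler_fun.u[OF euler_fun_v]
        s_nonneg s_less_1 _ _ concomitant form_vanish])

text \<open>Off the diagonal this is \<open>k_form\<close>. On the diagonal the kernel is a limit
  over points off it, which exists because \<open>k\<close> is continuous.\<close>

lemma mb_K_eq:
  assumes x: "0 < x" and y: "0 < y" shows "mb_K m n \<alpha> x y = wt s x * k x y"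
proof -
  have quot: "mb_quot m n \<alpha> x y = wt s x * k x y" if "0 < x" "0 < y" "x \<noteq> y" for x y
  proof -
    have "(\<Sum>i<N. mb_phi m n \<alpha> i x * mb_psi m n \<alpha> i y) = wt s x * ((x - y) * k x y)"
      using that by (simp add: k_form phi_eq psi_eq sum_distrib_left mult.assoc)
    then show ?thesis using that by (simp add: mb_quot_def)
  qed
  show ?thesis
  proof (cases "x = y")
    case True
    let ?S = "{(p, q). 0 < p \<and> 0 < q \<and> p \<noteq> q} :: (real \<times> real) set"
    have "continuous_on ({0<..} \<times> {0<..}) (\<lambda>z. wt s (fst z) * k (fst z) (snd z))"
    proof (intro continuous_on_mult)
      show "continuous_on ({0<..} \<times> {0<..}) (\<lambda>z. wt s (fst z))"
        unfolding wt_def by (cases "s = 0") (auto intro!: continuous_intros)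
      show "continuous_on ({0<..} \<times> {0<..}) (\<lambda>z. k (fst z) (snd z))"
        by (rule continuous_on_subset[OF continuous_k]) auto
    qed
    then have "((\<lambda>z. wt s (fst z) * k (fst z) (snd z)) \<longlongrightarrow> wt s x * k x x) (at (x, x) within {0<..} \<times> {0<..})"
      using x by (auto simp: continuous_on_def)
    then have "((\<lambda>z. wt s (fst z) * k (fst z) (snd z)) \<longlongrightarrow> wt s x * k x x) (at (x, x) within ?S)"
      by (rule tendsto_within_subset) auto
    then have lim: "((\<lambda>(p, q). mb_quot m n \<alpha> p q) \<longlongrightarrow> wt s x * k x x) (at (x, x) within ?S)"
    proof (rule Lim_transform_eventually)
      show "\<forall>\<^sub>F z in at (x, x) within ?S. wt s (fst z) * k (fst z) (snd z) = (case z of (p, q) \<Rightarrow> mb_quot m n \<alpha> p q)"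
        unfolding eventually_at_filter by (rule always_eventually) (auto simp: quot)
    qed
    have "(x, x) islimpt ?S"
      unfolding islimpt_approachable
    proof (intro allI impI)
      fix e :: real assume "0 < e"
      then show "\<exists>z'\<in>?S. z' \<noteq> (x, x) \<and> dist z' (x, x) < e"
        using x by (intro bexI[of _ "(x + e / 2, x)"]) (auto simp: dist_Pair_Pair dist_real_def)
    qed
    then have "\<not> trivial_limit (at (x, x) within ?S)" by (simp add: trivial_limit_within)
    from tendsto_Lim[OF this lim] show ?thesis using True by (simp add: mb_K_def)
  qed (use quot x y in \<open>simp add: mb_K_def\<close>)
qed

end

section \<open>Resolvents\<close>

context endpoint_system
begin

lemma P_partial:
  assumes a: "a \<in> E" and i: "i \<in> {1..2 * p}" and ai: "0 < a i \<or> s = 0" and h: "h \<in> bcont"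
  shows "((\<lambda>t. P (a(i := t)) h x) has_real_derivative (-1) ^ i * (wt s (a i) * (R a (a i) x * P a h (a i))))
     (at (a i) within slice a i)"
  using endpoint_system.Q_partial[OF transpose a i ai h, of x] by (simp add: transpose_Q transpose_R[OF a])

lemma P_partial_diag:
  assumes a: "a \<in> E" and i: "i \<in> {1..2 * p}" and ai: "0 < a i \<or> s = 0" and h: "h \<in> bcont"
    and D: "(P a h has_real_derivative D) (at (a i) within slice a i)"
  shows "((\<lambda>t. P (a(i := t)) h t) has_real_derivative (-1) ^ i * (wt s (a i) * (R a (a i) (a i) * P a h (a i))) + D)
     (at (a i) within slice a i)"
  using endpoint_system.Q_partial_diag[OF transpose a i ai h] D by (simp add: transpose_Q transpose_R[OF a])

lemma bilinear_partial_tr: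
  assumes a: "a \<in> E" and i: "i \<in> {1..2 * p}" and ai: "0 < a i \<or> s = 0" and h: "h \<in> bcont" and g: "g \<in> bcont"
  shows "((\<lambda>t. \<integral>y. g y * P (a(i := t)) h y \<partial>M (a(i := t))) has_real_derivative
     (-1) ^ i * (wt s (a i) * (Q a g (a i) * P a h (a i)))) (at (a i) within slice a i)"
  using endpoint_system.bilinear_partial[OF transpose a i ai h g] by (simp add: transpose_Q transpose_P)

lemma R_bcont_fst: "a \<in> E \<Longrightarrow> (\<lambda>x. R a x y) \<in> bcont"
proof -
  assume a: "a \<in> E"
  have "(\<lambda>x. R a x y) = Q a (\<lambda>x. k x y)" by (simp add: fun_eq_iff Q_kernel[OF a])
  then show ?thesis using Q_bcont[OF a kernel_bcont(2)] by simp
qed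

end

lemma continuous_on_section:
  assumes "continuous_on ({0..} \<times> {0..}) (\<lambda>z. kk (fst z) (snd z))" "0 \<le> (x::real)"
  shows "continuous_on {0..} (kk x :: real \<Rightarrow> real)"
proof -
  have "continuous_on {0..} (\<lambda>y. (x, y))" by (intro continuous_intros)
  from continuous_on_compose2[OF assms(1) this] assms(2) show ?thesis by force
qed

text \<open>The weight is attached to the first variable for the operator with kernel \<open>L\<close> and to the second
  one for its transpose; \<open>\<omega>1\<close> and \<open>\<omega>2\<close> cover both cases.\<close>

lemma resolvent_representation:
  fixes L kk :: "real \<Rightarrow> real \<Rightarrow> real" and h q :: "real \<Rightarrow> real"
  assumes s: "0 \<le> s" "s < 1" and a: "a \<in> endpoints_upto p B" and B: "0 \<le> B"
    and L: "\<And>x y. 0 < x \<Longrightarrow> 0 < y \<Longrightarrow> L x y = \<omega>1 x * \<omega>2 y * kk x y"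
    and \<omega>: "\<And>y. 0 < y \<Longrightarrow> \<omega>1 y * \<omega>2 y = wt s y"
    and kk: "continuous_on ({0..} \<times> {0..}) (\<lambda>z. kk (fst z) (snd z))"
    and q: "q \<in> bcont"
    and eq: "\<And>x. 0 < x \<Longrightarrow> x \<le> B \<Longrightarrow> q x = h x + (\<integral>y. kk x (clamp0 B y) * q y \<partial>mb_measure s p a)"
  defines "Qf \<equiv> \<lambda>x\<in>{0<..}. \<omega>1 x * (h x + (\<integral>y. kk x (clamp0 B y) * q y \<partial>mb_measure s p a))"
  shows "Qf \<in> op_dom L (mb_J p a)"
    and "id_minus_op L (mb_J p a) Qf = (\<lambda>x\<in>{0<..}. \<omega>1 x * h x)"
proof -
  let ?J = "mb_J p a"
  have ae: "a \<in> endpoints p" "a (2 * p) \<le> B" using a by (auto simp: endpoints_upto_def)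
  have J: "0 < y" "y \<le> B" if "y \<in> ?J" for y using mb_J_subset[OF ae(1)] that ae(2) by auto
  \<comment> \<open>\<open>Qf\<close> extends the solution beyond \<open>[0, B]\<close> by the
    right-hand side of its equation. The integrals see only the intervals, where it agrees with
    \<open>\<omega>1 * q\<close>.\<close>
  have Qf: "Qf y = \<omega>1 y * q y" if "y \<in> ?J" for y using J[OF that] eq[of y] by (simp add: Qf_def)
  have bc: "(\<lambda>y. kk x (clamp0 B y) * q y) \<in> bcont" if "0 < x" for x
    by (intro bcont_mult q bcont_clamp0[OF continuous_on_section[OF kk] B]) (use that in simp)
  have LQ: "L x y * Qf y = \<omega>1 x * (wt s y * (kk x (clamp0 B y) * q y))" if "0 < x" "y \<in> ?J" for x y
  proof -
    have "L x y * Qf y = \<omega>1 x * ((\<omega>1 y * \<omega>2 y) * (kk x y * q y))"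
      using J[OF that(2)] that by (simp add: L Qf mult_ac)
    then show ?thesis using J[OF that(2)] by (simp add: \<omega>)
  qed
  have int: "set_integrable lborel ?J (\<lambda>y. wt s y * (kk x (clamp0 B y) * q y))" if "0 < x" for x
    by (rule wt_mult_set_integrable[OF s bc[OF that], of _ "a (2 * p)"]) (use mb_J_subset[OF ae(1)] in auto)
  have "set_integrable lborel ?J (\<lambda>y. L x y * Qf y)" if x: "0 < x" for x
  proof -
    have "set_integrable lborel ?J (\<lambda>y. \<omega>1 x * (wt s y * (kk x (clamp0 B y) * q y)))"
      by (intro set_integrable_mult_right int x)
    then show ?thesis by (rule set_integrable_cong[THEN iffD1, rotated -1]) (auto simp: LQ[OF x])
  qed
  then show "Qf \<in> op_dom L ?J" by (auto simp: op_dom_def Qf_def)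
  show "id_minus_op L ?J Qf = (\<lambda>x\<in>{0<..}. \<omega>1 x * h x)"
    unfolding id_minus_op_def
  proof (rule restrict_ext)
    fix x :: real assume "x \<in> {0<..}"
    then have x: "0 < x" by simp
    have "(LINT y:?J|lborel. L x y * Qf y) = (LINT y:?J|lborel. \<omega>1 x * (wt s y * (kk x (clamp0 B y) * q y)))"
      by (rule set_lebesgue_integral_cong) (auto simp: LQ[OF x])
    also have "\<dots> = \<omega>1 x * (\<integral>y. kk x (clamp0 B y) * q y \<partial>mb_measure s p a)"
      by (simp add: integral_mb_measure[OF bc[OF x]])
    finally show "Qf x - (LINT y:?J|lborel. L x y * Qf y) = \<omega>1 x * h x"
      using x by (simp add: Qf_def distrib_left)
  qed
qed

lemma resolvent_op_eq:
  assumes "id_minus_op_invertible L J" "Qf \<in> op_dom L J" "id_minus_op L J Qf = restrict \<phi> {0<..}"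
  shows "resolvent_op L J \<phi> = Qf"
  unfolding resolvent_op_def
  using assms by (intro inv_into_f_eq) (auto simp: id_minus_op_invertible_def bij_betw_def)

text \<open>Both \<open>q\<close> and the zero function extend to elements of \<open>op_dom\<close>
  with the same image, so by injectivity they agree on \<open>(0, B]\<close>. The value at 0,
  invisible to the operator, follows by continuity, and the rest of the line by the clamp.\<close>

lemma homogeneous_zero:
  fixes L kk :: "real \<Rightarrow> real \<Rightarrow> real" and q :: "real \<Rightarrow> real"
  assumes s: "0 \<le> s" "s < 1" and a: "a \<in> endpoints_upto p B" and B: "0 < B"
    and L: "\<And>x y. 0 < x \<Longrightarrow> 0 < y \<Longrightarrow> L x y = \<omega>1 x * \<omega>2 y * kk x y"
    and \<omega>: "\<And>y. 0 < y \<Longrightarrow> \<omega>1 y * \<omega>2 y = wt s y"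
    and kk: "continuous_on ({0..} \<times> {0..}) (\<lambda>z. kk (fst z) (snd z))"
    and inv: "id_minus_op_invertible L (mb_J p a)"
    and q: "q \<in> bcont"
    and eq: "\<And>x. q x = (\<integral>y. kk (clamp0 B x) (clamp0 B y) * q y \<partial>mb_measure s p a)"
  shows "q = (\<lambda>_. 0)"
proof -
  have B0: "0 \<le> B" using B by simp
  define Qf where "Qf = (\<lambda>x\<in>{0<..}. \<omega>1 x * (0 + (\<integral>y. kk x (clamp0 B y) * q y \<partial>mb_measure s p a)))"
  have eq': "q x = 0 + (\<integral>y. kk x (clamp0 B y) * q y \<partial>mb_measure s p a)" if "0 < x" "x \<le> B" for x
    using eq[of x] that by simp
  have z: "0 = 0 + (\<integral>y. kk x (clamp0 B y) * 0 \<partial>mb_measure s p a)" for x by simp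
  have 1: "Qf \<in> op_dom L (mb_J p a)" "id_minus_op L (mb_J p a) Qf = (\<lambda>x\<in>{0<..}. \<omega>1 x * 0)"
    unfolding Qf_def by (rule resolvent_representation[OF s a B0 L \<omega> kk q eq'], assumption+)+
  define Z where "Z = (\<lambda>x\<in>{0<..}. \<omega>1 x * (0 + (\<integral>y. kk x (clamp0 B y) * 0 \<partial>mb_measure s p a)))"
  have 2: "Z \<in> op_dom L (mb_J p a)" "id_minus_op L (mb_J p a) Z = (\<lambda>x\<in>{0<..}. \<omega>1 x * 0)"
    unfolding Z_def by (rule resolvent_representation[OF s a B0 L \<omega> kk bcont_const z], assumption+)+
  have "Qf = Z" using inv 1 2 by (auto simp: id_minus_op_invertible_def bij_betw_def inj_on_def)
  have pos: "q x = 0" if "0 < x" "x \<le> B" for x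
  proof -
    have "Qf x = Z x" using \<open>Qf = Z\<close> by simp
    then have "\<omega>1 x * q x = 0" using that eq'[of x] by (simp add: Qf_def Z_def)
    moreover have "\<omega>1 x \<noteq> 0" using \<omega>[of x] wt_pos[of x s] that by auto
    ultimately show ?thesis by simp
  qed
  have "q 0 = 0"
  proof (rule tendsto_unique)
    have "(q \<longlongrightarrow> q 0) (at 0)" using bcontD(1)[OF q] by (simp add: continuous_on_def)
    then show "(q \<longlongrightarrow> q 0) (at_right 0)" by (rule tendsto_within_subset) simp
    have "\<forall>\<^sub>F x in at_right 0. 0 = q x"
      unfolding eventually_at_right_field using B pos by (intro exI[of _ B]) auto
    then show "(q \<longlongrightarrow> 0) (at_right 0)" by (rule Lim_transform_eventually[OF tendsto_const])
  qed simp
  then have "q (clamp0 B x) = 0" for x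
    using pos[of "clamp0 B x"] clamp0_mem[OF B0, of x] by (cases "clamp0 B x = 0") (auto simp: less_le)
  moreover have "q (clamp0 B x) = q x" for x using eq[of x] eq[of "clamp0 B x"] by simp
  ultimately show ?thesis by (simp add: fun_eq_iff)
qed

lemma euler_deriv_clamp0:
  assumes "\<And>x. 0 < x \<Longrightarrow> x < B \<Longrightarrow> (h has_real_derivative h1 x / x) (at x)"
  shows "euler_deriv B (\<lambda>x. h (clamp0 B x)) (\<lambda>x. h1 (clamp0 B x))"
  unfolding euler_deriv_def
proof (intro allI impI)
  fix x assume x: "0 < x" "x < B"
  from assms[OF x] have "((\<lambda>x. h (clamp0 B x)) has_real_derivative h1 x / x) (at x)"
    by (rule has_field_derivative_transform_within_open[of _ _ _ "{0<..<B}"]) (use x in auto)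
  then show "((\<lambda>x. h (clamp0 B x)) has_real_derivative h1 (clamp0 B x) / x) (at x)" using x by simp
qed

text \<open>Makes the limits defining \<open>mb_x\<close> and \<open>mb_y\<close> unique: right ends
  are approached from the left, left ends from the right.\<close>

lemma mb_J_islimpt:
  assumes a: "a \<in> endpoints p" and k: "k \<in> {1..2 * p}"
  shows "at (a k) within mb_J p a \<noteq> bot"
proof -
  have "a k islimpt mb_J p a"
  proof (cases "even k")
    case True
    then obtain j where j: "k = 2 * j" by blast
    have j1: "j \<in> {1..p}" using j k by auto
    have "a (2 * j - 1) < a (2 * j)" by (rule endpoints_mono[OF a]) (use j1 in auto)
    then have "a k islimpt {a (2 * j - 1)<..<a (2 * j)}" unfolding j by (rule islimpt_greaterThanLessThan2)
    then show ?thesis by (rule islimpt_subset) (use j1 in \<open>auto simp: mb_J_def\<close>)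
  next
    case False
    then obtain i where i: "k = 2 * i + 1" by (auto elim: oddE)
    have j1: "Suc i \<in> {1..p}" using i k by auto
    have "a k < a (2 * Suc i)" by (rule endpoints_mono[OF a]) (use i j1 in auto)
    then have "a k islimpt {a k<..<a (2 * Suc i)}" by (rule islimpt_greaterThanLessThan1)
    then show ?thesis
      by (rule islimpt_subset) (use j1 i in \<open>auto simp: mb_J_def intro!: bexI[of _ "Suc i"]\<close>)
  qed
  then show ?thesis by (simp add: trivial_limit_within)
qed

section \<open>The system of differential equations\<close>

locale mb_system = mb_params +
  fixes p :: nat and B :: real
  assumes p: "1 \<le> p" and B: "0 < B"
    and inv: "\<And>a. a \<in> endpoints p \<Longrightarrow> id_minus_op_invertible (mb_K m n \<alpha>) (mb_J p a)"
    and inv_tr: "\<And>a. a \<in> endpoints p \<Longrightarrow> id_minus_op_invertible (\<lambda>y x. mb_K m n \<alpha> x y) (mb_J p a)"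
begin

abbreviation "cl \<equiv> clamp0 B"

lemma B0: "0 \<le> B" using B by simp

lemma continuous_k_tr: "continuous_on ({0..} \<times> {0..}) (\<lambda>z. k (snd z) (fst z))"
proof -
  have "continuous_on ({0..} \<times> {0..}) (\<lambda>z::real \<times> real. (snd z, fst z))" by (intro continuous_intros)
  from continuous_on_compose2[OF continuous_k this] show ?thesis by force
qed

lemma ide: "ide_system s B p (\<lambda>x y. k (cl x) (cl y)) (\<lambda>x y. kx (cl x) (cl y)) (\<lambda>x y. ky (cl x) (cl y))
   (\<lambda>x. u (cl x)) (\<lambda>x. v (cl x)) N n \<beta> (\<lambda>j x. f j (cl x)) (\<lambda>j x. g j (cl x))"
proof
  show "0 \<le> s" "s < 1" "1 \<le> p" by (fact s_nonneg s_less_1 p)+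
  show "clamped_kernel B (\<lambda>x y. k (cl x) (cl y))" "clamped_kernel B (\<lambda>x y. kx (cl x) (cl y))" "clamped_kernel B (\<lambda>x y. ky (cl x) (cl y))"
    by (rule clamped_kernelI[OF B0 continuous_k] clamped_kernelI[OF B0 continuous_kx] clamped_kernelI[OF B0 continuous_ky])+
  show "(\<lambda>x. u (cl x)) \<in> bcont" "(\<lambda>x. v (cl x)) \<in> bcont"
    by (rule bcont_clamp0[OF euler_fun.u[OF euler_fun_u] B0] bcont_clamp0[OF continuous_g B0])+
  show "(\<lambda>x. f j (cl x)) \<in> bcont" "(\<lambda>x. g j (cl x)) \<in> bcont" for j
    by (rule bcont_clamp0[OF continuous_f B0] bcont_clamp0[OF continuous_g B0])+
  show "2 \<le> N" by (rule N2)
  show "\<beta> 0 = 0" by (simp add: \<beta>_def)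
  show "(\<lambda>x. u (cl x)) = (\<lambda>x. - ((- 1) ^ n) * f 0 (cl x))" by (simp add: u_def)
  show "(\<lambda>x. v (cl x)) = (\<lambda>x. v (cl x))" ..
  show "(cl x - cl y) * k (cl x) (cl y) = (\<Sum>l<N. f l (cl x) * g l (cl y))" for x y by (rule k_form) simp_all
  show "kx (cl x) (cl y) + ky (cl x) (cl y) + (1 - s) * k (cl x) (cl y) = u (cl x) * v (cl y)" for x y
    by (rule k_rank_one) simp_all
  show "euler_deriv B (\<lambda>x. k (cl x) (cl y)) (\<lambda>x. kx (cl x) (cl y))" for y
    by (rule euler_deriv_clamp0[where h = "\<lambda>x. k x (cl y)" and ?h1.0 = "\<lambda>x. kx x (cl y)"], rule deriv_k_fst) simp_all
  show "euler_deriv B (\<lambda>y. k (cl x) (cl y)) (\<lambda>y. ky (cl x) (cl y))" for x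
    by (rule euler_deriv_clamp0[where h = "k (cl x)" and ?h1.0 = "ky (cl x)"], rule deriv_k_snd) simp_all
  have F: "euler_deriv B (\<lambda>x. f j (cl x)) (\<lambda>x. df j (cl x))" for j
    by (rule euler_deriv_clamp0, rule euler_fun.deriv[OF euler_fun_f])
  have G: "euler_deriv B (\<lambda>x. g j (cl x)) (\<lambda>x. dg j (cl x))" if "j < N" for j
    by (rule euler_deriv_clamp0, rule euler_fun.deriv[OF euler_fun_g[OF that]])
  show "euler_deriv B (\<lambda>x. f j (cl x)) (\<lambda>x. s * f j (cl x) - f (j + 1) (cl x))" for j
    using F[of j] unfolding df_def .
  show "euler_deriv B (\<lambda>x. f (N - 1) (cl x))
     (\<lambda>x. s * f (N - 1) (cl x) - (- 1) ^ n * (cl x * f 0 (cl x)) + (\<Sum>i<N. \<beta> i * f i (cl x)))"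
  proof -
    have "df (N - 1) x = s * f (N - 1) x - (- 1) ^ n * (x * f 0 x) + (\<Sum>i<N. \<beta> i * f i x)" for x
    proof -
      have "N - 1 + 1 = N" using m by simp
      then have "df (N - 1) x = s * f (N - 1) x - f N x" by (simp only: df_def)
      then show ?thesis unfolding f_N by simp
    qed
    then show ?thesis using F[of "N - 1"] by simp
  qed
  show "euler_deriv B (\<lambda>x. g j (cl x)) (\<lambda>y. g (j - 1) (cl y) - \<beta> j * g (N - 1) (cl y))" if "1 \<le> j" "j < N" for j
    using G[OF that(2)] that(1) by (simp add: dg_def)
  show "euler_deriv B (\<lambda>x. g 0 (cl x)) (\<lambda>y. (- 1) ^ n * (cl y * g (N - 1) (cl y)))"
    using G[of 0] m by (simp add: dg_def)
next
  fix a q assume a: "a \<in> endpoints_upto p B" and q: "q \<in> bcont"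
  have ae: "a \<in> endpoints p" using a by (simp add: endpoints_upto_def)
  show "q = (\<lambda>_. 0)" if "\<And>x. q x = (\<integral>y. k (cl x) (cl y) * q y \<partial>mb_measure s p a)"
    by (rule homogeneous_zero[where L = "mb_K m n \<alpha>" and ?\<omega>1.0 = "wt s" and ?\<omega>2.0 = "\<lambda>_. 1" and kk = k,
        OF s_nonneg s_less_1 a B _ _ continuous_k inv[OF ae] q that]) (simp_all add: mb_K_eq)
  show "q = (\<lambda>_. 0)" if "\<And>x. q x = (\<integral>y. k (cl y) (cl x) * q y \<partial>mb_measure s p a)"
    by (rule homogeneous_zero[where L = "\<lambda>y x. mb_K m n \<alpha> x y" and ?\<omega>1.0 = "\<lambda>_. 1" and ?\<omega>2.0 = "wt s" and kk = "\<lambda>x y. k y x",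
        OF s_nonneg s_less_1 a B _ _ continuous_k_tr inv_tr[OF ae] q that]) (simp_all add: mb_K_eq)
qed

sublocale I: ide_system s B p "\<lambda>x y. k (cl x) (cl y)" "\<lambda>x y. kx (cl x) (cl y)" "\<lambda>x y. ky (cl x) (cl y)"
   "\<lambda>x. u (cl x)" "\<lambda>x. v (cl x)" N n \<beta> "\<lambda>j x. f j (cl x)" "\<lambda>j x. g j (cl x)"
  by (rule ide)

lemma X_bcont: "a \<in> I.E \<Longrightarrow> I.X a j \<in> bcont"
  unfolding I.X_def by (intro I.Q_bcont bcont_clamp0[OF continuous_f B0])

lemma Y_bcont: "a \<in> I.E \<Longrightarrow> I.Y a j \<in> bcont"
  unfolding I.Y_def by (intro I.P_bcont bcont_clamp0[OF continuous_g B0])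

lemma mb_Q_eq:
  assumes a: "a \<in> I.E" and x: "0 < x" "x \<le> B" shows "mb_Q m n \<alpha> p a j x = wt s x * I.X a j x"
proof -
  have ae: "a \<in> endpoints p" using a by (simp add: endpoints_upto_def)
  have eq: "I.X a j x = f j x + (\<integral>y. k x (cl y) * I.X a j y \<partial>mb_measure s p a)" if "0 < x" "x \<le> B" for x
    using I.Q_eq[OF a bcont_clamp0[OF continuous_f B0, of j], of x] that by (simp add: I.X_def)
  define Qf where "Qf = (\<lambda>x\<in>{0<..}. wt s x * (f j x + (\<integral>y. k x (cl y) * I.X a j y \<partial>mb_measure s p a)))"
  have "Qf \<in> op_dom (mb_K m n \<alpha>) (mb_J p a) \<and> id_minus_op (mb_K m n \<alpha>) (mb_J p a) Qf = (\<lambda>x\<in>{0<..}. wt s x * f j x)"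
    unfolding Qf_def
    by (rule conjI; rule resolvent_representation[where ?\<omega>1.0 = "wt s" and ?\<omega>2.0 = "\<lambda>_. 1" and kk = k,
        OF s_nonneg s_less_1 a B0 _ _ continuous_k X_bcont[OF a] eq]) (simp_all add: mb_K_eq)
  moreover have "(\<lambda>x\<in>{0<..}. wt s x * f j x) = restrict (mb_phi m n \<alpha> j) {0<..}"
    by (rule restrict_ext) (simp add: phi_eq)
  ultimately have "mb_Q m n \<alpha> p a j = Qf"
    unfolding mb_Q_def by (intro resolvent_op_eq inv[OF ae]) auto
  then show ?thesis using x eq[of x] by (simp add: Qf_def)
qed

lemma mb_P_eq:
  assumes a: "a \<in> I.E" and y: "0 < y" "y \<le> B" shows "mb_P m n \<alpha> p a j y = I.Y a j y"
proof -
  have ae: "a \<in> endpoints p" using a by (simp add: endpoints_upto_def)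
  have eq: "I.Y a j y = g j y + (\<integral>x. k (cl x) y * I.Y a j x \<partial>mb_measure s p a)" if "0 < y" "y \<le> B" for y
    using I.P_eq[OF a bcont_clamp0[OF continuous_g B0, of j], of y] that by (simp add: I.Y_def)
  define Pf where "Pf = (\<lambda>y\<in>{0<..}. 1 * (g j y + (\<integral>x. k (cl x) y * I.Y a j x \<partial>mb_measure s p a)))"
  let ?L = "\<lambda>y x. mb_K m n \<alpha> x y"
  have "Pf \<in> op_dom ?L (mb_J p a) \<and> id_minus_op ?L (mb_J p a) Pf = (\<lambda>y\<in>{0<..}. 1 * g j y)"
    unfolding Pf_def
    by (rule conjI; rule resolvent_representation[where ?\<omega>1.0 = "\<lambda>_. 1" and ?\<omega>2.0 = "wt s" and kk = "\<lambda>x y. k y x",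
        OF s_nonneg s_less_1 a B0 _ _ continuous_k_tr Y_bcont[OF a] eq]) (simp_all add: mb_K_eq)
  moreover have "(\<lambda>y\<in>{0<..}. 1 * g j y) = restrict (mb_psi m n \<alpha> j) {0<..}"
    by (rule restrict_ext) (simp add: psi_eq)
  ultimately have "mb_P m n \<alpha> p a j = Pf"
    unfolding mb_P_def by (intro resolvent_op_eq inv_tr[OF ae]) auto
  then show ?thesis using y eq[of y] by (simp add: Pf_def)
qed

lemma J_mem:
  assumes a: "a \<in> I.E" and y: "y \<in> mb_J p a" shows "0 < y" "y \<le> B"
proof -
  have "a \<in> endpoints p" "a (2 * p) \<le> B" using a by (auto simp: endpoints_upto_def)
  with mb_J_subset[of a p] y show "0 < y" "y \<le> B" by auto
qed

text \<open>The side condition, which amounts to \<open>x_finite_at\<close>, makes the weight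
  continuous at \<open>a i\<close>.\<close>

lemma mb_x_eq:
  assumes a: "a \<in> I.E" and i: "i \<in> {1..2 * p}" and ai: "0 < a i \<or> s = 0"
  shows "mb_x m n \<alpha> p j i a = wt s (a i) * I.X a j (a i)"
proof -
  have ae: "a \<in> endpoints p" using a by (simp add: endpoints_upto_def)
  have "((\<lambda>x. wt s x * I.X a j x) \<longlongrightarrow> wt s (a i) * I.X a j (a i)) (at (a i) within mb_J p a)"
  proof (intro tendsto_mult)
    show "(I.X a j \<longlongrightarrow> I.X a j (a i)) (at (a i) within mb_J p a)"
      using bcontD(1)[OF X_bcont[OF a, of j]] by (auto simp: continuous_on_def intro: tendsto_within_subset)
    show "(wt s \<longlongrightarrow> wt s (a i)) (at (a i) within mb_J p a)"
      using ai by (cases "s = 0") (auto simp: wt_def[abs_def] intro!: tendsto_intros)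
  qed
  then have "(mb_Q m n \<alpha> p a j \<longlongrightarrow> wt s (a i) * I.X a j (a i)) (at (a i) within mb_J p a)"
    by (rule Lim_transform_eventually) (auto simp: eventually_at_filter mb_Q_eq[OF a J_mem[OF a]] intro!: always_eventually)
  then show ?thesis unfolding mb_x_def by (rule tendsto_Lim[OF mb_J_islimpt[OF ae i]])
qed

lemma mb_y_eq:
  assumes a: "a \<in> I.E" and i: "i \<in> {1..2 * p}"
  shows "mb_y m n \<alpha> p j i a = I.Y a j (a i)"
proof -
  have ae: "a \<in> endpoints p" using a by (simp add: endpoints_upto_def)
  have "(I.Y a j \<longlongrightarrow> I.Y a j (a i)) (at (a i) within mb_J p a)"
    using bcontD(1)[OF Y_bcont[OF a, of j]] by (auto simp: continuous_on_def intro: tendsto_within_subset)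
  then have "(mb_P m n \<alpha> p a j \<longlongrightarrow> I.Y a j (a i)) (at (a i) within mb_J p a)"
    by (rule Lim_transform_eventually) (auto simp: eventually_at_filter mb_P_eq[OF a J_mem[OF a]] intro!: always_eventually)
  then show ?thesis unfolding mb_y_def by (rule tendsto_Lim[OF mb_J_islimpt[OF ae i]])
qed

lemma phi_P_integral:
  assumes a: "a \<in> I.E"
  shows "(LINT x:mb_J p a|lborel. mb_phi m n \<alpha> i x * mb_P m n \<alpha> p a j x) = (\<integral>x. f i (cl x) * I.Y a j x \<partial>mb_measure s p a)"
proof -
  have "(LINT x:mb_J p a|lborel. mb_phi m n \<alpha> i x * mb_P m n \<alpha> p a j x) = (LINT x:mb_J p a|lborel. wt s x * (f i (cl x) * I.Y a j x))"
  proof (rule set_lebesgue_integral_cong, simp, intro allI impI)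
    fix x assume "x \<in> mb_J p a"
    then have "0 < x" "x \<le> B" using J_mem[OF a] by auto
    then show "mb_phi m n \<alpha> i x * mb_P m n \<alpha> p a j x = wt s x * (f i (cl x) * I.Y a j x)"
      by (simp add: phi_eq mb_P_eq[OF a])
  qed
  also have "\<dots> = (\<integral>x. f i (cl x) * I.Y a j x \<partial>mb_measure s p a)"
    by (rule integral_mb_measure[symmetric]) (intro bcont_mult bcont_clamp0[OF continuous_f B0] Y_bcont[OF a])
  finally show ?thesis .
qed

lemma mb_u_eq: "a \<in> I.E \<Longrightarrow> mb_u m n \<alpha> p j a = I.U a j"
  by (simp add: mb_u_def phi_P_integral I.U_def \<beta>_def)

lemma mb_v_eq: "a \<in> I.E \<Longrightarrow> mb_v m n \<alpha> p j a = I.V a j"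
  by (simp add: mb_v_def phi_P_integral I.V_def)

section \<open>Partial derivatives at a fixed endpoint vector\<close>

context
  fixes a :: "nat \<Rightarrow> real"
  assumes a: "a \<in> endpoints p" and aB: "a (2 * p) < B"
begin

lemma aE: "a \<in> I.E" using a aB by (simp add: endpoints_upto_def)

lemma a_bounds: "i \<in> {1..2 * p} \<Longrightarrow> 0 \<le> a i" "i \<in> {1..2 * p} \<Longrightarrow> a i < B"
proof -
  have *: "a \<in> endpoints_upto p (a (2 * p))" using a by (simp add: endpoints_upto_def)
  show "i \<in> {1..2 * p} \<Longrightarrow> 0 \<le> a i" using endpoints_upto_bounds(1)[OF *, of i] by auto
  show "i \<in> {1..2 * p} \<Longrightarrow> a i < B" using endpoints_upto_bounds(2)[OF *, of i] aB by auto
qed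

lemma cl_a [simp]: "i \<in> {1..2 * p} \<Longrightarrow> cl (a i) = a i"
  using a_bounds[of i] by simp

lemma a_neq: "i \<in> {1..2 * p} \<Longrightarrow> j \<in> {1..2 * p} \<Longrightarrow> i \<noteq> j \<Longrightarrow> a i \<noteq> a j"
  using endpoints_mono[OF a, of i j] endpoints_mono[OF a, of j i] by (cases "i < j") auto

text \<open>All endpoints lie strictly below \<open>B\<close>, so near \<open>a i\<close> the bound
  \<open>B\<close> does not restrict the slice.\<close>

lemma slice_eq:
  assumes i: "i \<in> {1..2 * p}"
  shows "at (a i) within {t. a(i := t) \<in> endpoints p} = at (a i) within I.slice a i"
proof (rule at_within_nhd[of _ "{..<B}"])
  show "{t. a(i := t) \<in> endpoints p} \<inter> {..<B} - {a i} = I.slice a i \<inter> {..<B} - {a i}"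
    using aB by (auto simp: endpoints_upto_def)
qed (use a_bounds(2)[OF i] in auto)

lemma has_partialI:
  assumes i: "i \<in> {1..2 * p}"
    and D: "(\<Phi> has_real_derivative d) (at (a i) within I.slice a i)"
    and eq: "\<And>t. a(i := t) \<in> I.E \<Longrightarrow> (0 < a i \<Longrightarrow> 0 < t) \<Longrightarrow> F (a(i := t)) = \<Phi> t"
  shows "has_partial p F i d a"
proof -
  have "((\<lambda>t. F (a(i := t))) has_real_derivative d) (at (a i) within I.slice a i)"
  proof (rule has_field_derivative_transform_within[OF D, of "if 0 < a i then a i else 1"])
    show "a i \<in> I.slice a i" using aE by simp
    fix t assume t: "t \<in> I.slice a i" "dist t (a i) < (if 0 < a i then a i else 1)"
    have "0 < t" if "0 < a i" using t(2) that by (simp add: dist_real_def abs_if split: if_splits)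
    then show "\<Phi> t = F (a(i := t))" using eq[of t] t(1) by simp
  qed simp
  then show ?thesis unfolding has_partial_def slice_eq[OF i] .
qed

abbreviation "x \<equiv> mb_x m n \<alpha> p"
abbreviation "y \<equiv> mb_y m n \<alpha> p"

lemma x_finite: "x_finite_at m \<alpha> t \<longleftrightarrow> 0 < t \<or> s = 0"
  by (simp add: x_finite_at_def s_eq_0)

lemma x_val: "i \<in> {1..2 * p} \<Longrightarrow> 0 < a i \<or> s = 0 \<Longrightarrow> x j i a = wt s (a i) * I.X a j (a i)"
  by (rule mb_x_eq[OF aE])

lemma y_val: "i \<in> {1..2 * p} \<Longrightarrow> y j i a = I.Y a j (a i)"
  by (rule mb_y_eq[OF aE])

text \<open>The resolvent kernel in integrable form. The weight is carried by the \<open>x\<close>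
  alone and hence taken at \<open>a i\<close>.\<close>

lemma xy_sum:
  assumes "i \<in> {1..2 * p}" "j \<in> {1..2 * p}" "0 < a i \<or> s = 0"
  shows "(\<Sum>l<N. x l i a * y l j a) = wt s (a i) * ((a i - a j) * I.R a (a i) (a j))"
proof -
  have "(\<Sum>l<N. x l i a * y l j a) = wt s (a i) * (\<Sum>l<N. I.X a l (a i) * I.Y a l (a j))"
    using assms by (simp add: x_val y_val sum_distrib_left mult.assoc)
  also have "(\<Sum>l<N. I.X a l (a i) * I.Y a l (a j)) = (a i - a j) * I.R a (a i) (a j)"
    using I.R_form[OF aE, of "a i" "a j"] assms by simp
  finally show ?thesis .
qed

lemma xy_sum_divide:
  assumes "i \<in> {1..2 * p}" "j \<in> {1..2 * p}" "i \<noteq> j" "0 < a i \<or> s = 0"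
  shows "e * (c / (a i - a j)) * (\<Sum>l<N. x l i a * y l j a) = wt s (a i) * (e * c * I.R a (a i) (a j))"
  unfolding xy_sum[OF assms(1,2,4)] using a_neq[OF assms(1-3)] by simp

lemma F_bcont: "(\<lambda>x. f j (cl x)) \<in> bcont" and G_bcont: "(\<lambda>x. g j (cl x)) \<in> bcont"
  by (rule bcont_clamp0[OF continuous_f B0], rule bcont_clamp0[OF continuous_g B0])

lemma partial_x:
  fixes k :: nat
  assumes k: "k \<in> {1..2 * p}" and i: "i \<in> {1..2 * p} - {k}"
    and ak: "0 < a k \<or> s = 0" and ai: "0 < a i \<or> s = 0"
  shows "has_partial p (x j k) i ((- 1) ^ i * (x j i a / (a k - a i)) * (\<Sum>l<N. x l k a * y l i a)) a"
proof (rule has_partialI)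
  have i': "i \<in> {1..2 * p}" and ik: "k \<noteq> i" using i by auto
  show "i \<in> {1..2 * p}" by (rule i')
  have "(- 1) ^ i * (x j i a / (a k - a i)) * (\<Sum>l<N. x l k a * y l i a) =
      wt s (a k) * ((- 1) ^ i * (wt s (a i) * (I.R a (a k) (a i) * I.X a j (a i))))"
    unfolding xy_sum_divide[OF k i' ik ak] x_val[OF i' ai] by (simp only: mult_ac)
  then show "((\<lambda>t. wt s (a k) * I.X (a(i := t)) j (a k)) has_real_derivative
      (- 1) ^ i * (x j i a / (a k - a i)) * (\<Sum>l<N. x l k a * y l i a)) (at (a i) within I.slice a i)"
    using DERIV_cmult[OF I.Q_partial[OF aE i' ai F_bcont[of j], of "a k"], of "wt s (a k)"] by (simp add: I.X_def)
  fix t assume t: "a(i := t) \<in> I.E"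
  then show "x j k (a(i := t)) = wt s (a k) * I.X (a(i := t)) j (a k)"
    using mb_x_eq[OF t k, of j] ak ik by simp
qed

lemma partial_y:
  fixes k :: nat
  assumes k: "k \<in> {1..2 * p}" and i: "i \<in> {1..2 * p} - {k}" and ai: "0 < a i \<or> s = 0"
  shows "has_partial p (y j k) i ((- 1) ^ i * (y j i a / (a i - a k)) * (\<Sum>l<N. x l i a * y l k a)) a"
proof (rule has_partialI)
  have i': "i \<in> {1..2 * p}" and ik: "i \<noteq> k" using i by auto
  show "i \<in> {1..2 * p}" by (rule i')
  have "(- 1) ^ i * (y j i a / (a i - a k)) * (\<Sum>l<N. x l i a * y l k a) =
      (- 1) ^ i * (wt s (a i) * (I.R a (a i) (a k) * I.Y a j (a i)))"
    unfolding xy_sum_divide[OF i' k ik ai] y_val[OF i'] by (simp only: mult_ac)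
  then show "((\<lambda>t. I.Y (a(i := t)) j (a k)) has_real_derivative
      (- 1) ^ i * (y j i a / (a i - a k)) * (\<Sum>l<N. x l i a * y l k a)) (at (a i) within I.slice a i)"
    using I.P_partial[OF aE i' ai G_bcont[of j], of "a k"] by (simp add: I.Y_def)
  fix t assume t: "a(i := t) \<in> I.E"
  then show "y j k (a(i := t)) = I.Y (a(i := t)) j (a k)"
    using mb_y_eq[OF t k, of j] ik by simp
qed

text \<open>The summand of index \<open>k\<close>, for which the denominator would be 0, is kept
  apart; the derivative with respect to \<open>a k\<close> will cancel it.\<close>

lemma edge_split:
  fixes k :: nat
  assumes k: "k \<in> {1..2 * p}" and ak: "0 < a k \<or> s = 0"
  shows "wt s (a k) * I.edge a (a k) (I.X a j) =
     (\<Sum>i\<in>{1..2 * p} - {k}. (- 1) ^ i * (a i * x j i a / (a k - a i)) * (\<Sum>l<N. x l k a * y l i a))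
     + wt s (a k) * ((- 1) ^ k * (a k * wt s (a k) * I.X a j (a k)) * I.R a (a k) (a k))"
proof -
  have "wt s (a k) * ((- 1) ^ i * (a i * wt s (a i) * I.X a j (a i)) * I.R a (a k) (a i)) =
      (- 1) ^ i * (a i * x j i a / (a k - a i)) * (\<Sum>l<N. x l k a * y l i a)" if i: "i \<in> {1..2 * p} - {k}" for i
  \<comment> \<open>If \<open>a i = 0\<close>, the factor \<open>a i\<close> makes both sides 0 even
    where the limit defining \<open>x j i a\<close> is infinite.\<close>
  proof (cases "a i = 0")
    case False
    then have ai: "0 < a i \<or> s = 0" using a_bounds(1)[of i] i by (auto simp: less_le)
    have i': "i \<in> {1..2 * p}" and ik: "k \<noteq> i" using i by auto
    show ?thesis
      unfolding xy_sum_divide[OF k i' ik ak] x_val[OF i' ai] by (simp only: mult_ac)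
  qed simp
  then show ?thesis
    unfolding I.edge_def sum.remove[OF finite_atLeastAtMost k] distrib_left
    by (simp add: sum_distrib_left)
qed

lemma edge_tr_split:
  fixes k :: nat
  assumes k: "k \<in> {1..2 * p}"
  shows "I.edge_tr a (a k) (I.Y a j) =
     (\<Sum>i\<in>{1..2 * p} - {k}. (- 1) ^ i * (a i * y j i a / (a i - a k)) * (\<Sum>l<N. x l i a * y l k a))
     + (- 1) ^ k * (a k * wt s (a k) * I.Y a j (a k)) * I.R a (a k) (a k)"
proof -
  have "(- 1) ^ i * (a i * wt s (a i) * I.Y a j (a i)) * I.R a (a i) (a k) =
      (- 1) ^ i * (a i * y j i a / (a i - a k)) * (\<Sum>l<N. x l i a * y l k a)" if i: "i \<in> {1..2 * p} - {k}" for i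
  proof (cases "a i = 0")
    case False
    then have ai: "0 < a i \<or> s = 0" using a_bounds(1)[of i] i by (auto simp: less_le)
    have i': "i \<in> {1..2 * p}" and ik: "i \<noteq> k" using i by auto
    show ?thesis
      unfolding xy_sum_divide[OF i' k ik ai] y_val[OF i'] by (simp only: mult_ac)
  qed simp
  then show ?thesis
    unfolding I.edge_tr_def sum.remove[OF finite_atLeastAtMost k] by simp
qed

lemma euler_partial_x:
  fixes k :: nat
  assumes k: "k \<in> {1..2 * p}" and ak: "0 < a k \<or> s = 0" and T: "T \<in> bcont"
    and der: "euler_deriv B (I.X a j) (\<lambda>x. s * I.X a j x + T x - I.edge a x (I.X a j))"
  shows "has_euler_partial p (x j k) k (wt s (a k) * T (a k) -
     (\<Sum>i\<in>{1..2 * p} - {k}. (- 1) ^ i * (a i * x j i a / (a k - a i)) * (\<Sum>l<N. x l k a * y l i a))) a"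
    (is "has_euler_partial p _ k ?e a")
proof -
  let ?L = "\<lambda>x. s * I.X a j x + T x - I.edge a x (I.X a j)"
  have e: "?e = wt s (a k) * (?L (a k) - s * I.X a j (a k) + (- 1) ^ k * (a k * wt s (a k) * I.X a j (a k)) * I.R a (a k) (a k))"
    using edge_split[OF k ak, of j] by (simp add: algebra_simps)
  show ?thesis
  proof (cases "a k = 0")
    \<comment> \<open>Here \<open>has_euler_partial\<close> amounts to \<open>?e = 0\<close>, which
      is the vanishing of an Euler derivative at 0.\<close>
    case True
    then have s0: "s = 0" using ak by simp
    have "(\<lambda>x. I.edge a x (I.X a j)) \<in> bcont"
      unfolding I.edge_def by (intro bcont_sum bcont_cmult I.R_bcont_fst aE)
    then have "?L \<in> bcont" by (intro bcont_diff bcont_add bcont_cmult X_bcont[OF aE] T)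
    then have "?L 0 = 0"
      by (intro euler_deriv_zero[OF _ _ der B] continuous_on_subset[OF bcontD(1)] X_bcont[OF aE]) auto
    then have "?e = 0" unfolding e using True s0 by simp
    then show ?thesis using True by (simp add: has_euler_partial_def)
  next
    case False
    then have ak0: "0 < a k" using a_bounds(1)[OF k] by simp
    let ?D = "(- 1) ^ k * (wt s (a k) * (I.R a (a k) (a k) * I.X a j (a k))) + ?L (a k) / a k"
    have "(I.X a j has_real_derivative ?L (a k) / a k) (at (a k) within I.slice a k)"
      by (rule has_field_derivative_at_within[OF euler_derivD[OF der ak0 a_bounds(2)[OF k]]])
    then have DX: "((\<lambda>t. I.X (a(k := t)) j t) has_real_derivative ?D) (at (a k) within I.slice a k)"
      using I.Q_partial_diag[OF aE k _ F_bcont[of j]] ak by (simp add: I.X_def)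
    \<comment> \<open>The derivative of the weight contributes \<open>- s\<close> times the
      function, which cancels the term \<open>s * I.X a j x\<close> in \<open>der\<close>.\<close>
    have Dw: "(wt s has_real_derivative - s * wt s (a k) / a k) (at (a k) within I.slice a k)"
    proof (cases "s = 0")
      case True
      then have "wt s = (\<lambda>_. 1)" by (simp add: wt_def fun_eq_iff)
      then show ?thesis using True by simp
    next
      case False
      then have w: "wt s = (\<lambda>y. y powr (- s))" by (simp add: wt_def fun_eq_iff)
      have "((\<lambda>y. y powr (- s)) has_real_derivative - s * a k powr (- s - 1)) (at (a k))"
        by (rule has_real_derivative_powr[OF ak0])
      moreover have "a k powr (- s - 1) = a k powr (- s) / a k" using ak0 by (simp add: powr_diff)
      ultimately show ?thesis unfolding w by (simp add: has_field_derivative_at_within)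
    qed
    let ?d = "- s * wt s (a k) / a k * I.X a j (a k) + ?D * wt s (a k)"
    have "has_partial p (x j k) k ?d a"
    proof (rule has_partialI[OF k])
      show "((\<lambda>t. wt s t * I.X (a(k := t)) j t) has_real_derivative ?d) (at (a k) within I.slice a k)"
        using DERIV_mult[OF Dw DX] by simp
      fix t assume t: "a(k := t) \<in> I.E" "0 < a k \<Longrightarrow> 0 < t"
      then show "x j k (a(k := t)) = wt s t * I.X (a(k := t)) j t"
        using mb_x_eq[OF t(1) k, of j] ak0 by simp
    qed
    moreover have "a k * ?d = ?e"
      unfolding e using ak0 by (simp add: field_simps)
    ultimately show ?thesis unfolding has_euler_partial_def by blast
  qed
qed

lemma euler_partial_y:
  fixes k :: nat
  assumes k: "k \<in> {1..2 * p}" and T: "T \<in> bcont"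
    and der: "euler_deriv B (I.Y a j) (\<lambda>y. T y - I.edge_tr a y (I.Y a j))"
  shows "has_euler_partial p (y j k) k (T (a k) -
     (\<Sum>i\<in>{1..2 * p} - {k}. (- 1) ^ i * (a i * y j i a / (a i - a k)) * (\<Sum>l<N. x l i a * y l k a))) a"
    (is "has_euler_partial p _ k ?e a")
proof -
  let ?L = "\<lambda>y. T y - I.edge_tr a y (I.Y a j)"
  have e: "?e = ?L (a k) + (- 1) ^ k * (a k * wt s (a k) * I.Y a j (a k)) * I.R a (a k) (a k)"
    using edge_tr_split[OF k, of j] by simp
  show ?thesis
  proof (cases "a k = 0")
    case True
    have "(\<lambda>y. I.edge_tr a y (I.Y a j)) \<in> bcont"
      unfolding I.edge_tr_def by (intro bcont_sum bcont_cmult I.R_bcont aE)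
    then have "?L \<in> bcont" by (intro bcont_diff T)
    then have "?L 0 = 0"
      by (intro euler_deriv_zero[OF _ _ der B] continuous_on_subset[OF bcontD(1)] Y_bcont[OF aE]) auto
    then have "?e = 0" unfolding e using True by simp
    then show ?thesis using True by (simp add: has_euler_partial_def)
  next
    case False
    then have ak0: "0 < a k" using a_bounds(1)[OF k] by simp
    let ?d = "(- 1) ^ k * (wt s (a k) * (I.R a (a k) (a k) * I.Y a j (a k))) + ?L (a k) / a k"
    have "(I.Y a j has_real_derivative ?L (a k) / a k) (at (a k) within I.slice a k)"
      by (rule has_field_derivative_at_within[OF euler_derivD[OF der ak0 a_bounds(2)[OF k]]])
    then have DY: "((\<lambda>t. I.Y (a(k := t)) j t) has_real_derivative ?d) (at (a k) within I.slice a k)"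
      using I.P_partial_diag[OF aE k _ G_bcont[of j]] ak0 by (simp add: I.Y_def)
    have "has_partial p (y j k) k ?d a"
      by (rule has_partialI[OF k DY]) (use mb_y_eq[OF _ k, of _ j] in simp)
    moreover have "a k * ?d = ?e" unfolding e using ak0 by (simp add: field_simps)
    ultimately show ?thesis unfolding has_euler_partial_def by blast
  qed
qed

lemma partial_u:
  fixes k :: nat
  assumes k: "k \<in> {1..2 * p}" and ak: "0 < a k \<or> s = 0"
  shows "has_partial p (mb_u m n \<alpha> p j) k ((- 1) ^ (n + k) * x 0 k a * y j k a) a"
proof (rule has_partialI[OF k])
  have "((\<lambda>t. (- 1) ^ n * (\<integral>y. f 0 (cl y) * I.Y (a(k := t)) j y \<partial>mb_measure s p (a(k := t))) + \<beta> j) has_real_derivative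
      (- 1) ^ n * ((- 1) ^ k * (wt s (a k) * (I.X a 0 (a k) * I.Y a j (a k)))) + 0) (at (a k) within I.slice a k)"
    using I.bilinear_partial_tr[OF aE k ak G_bcont[of j] F_bcont[of 0]]
    by (intro DERIV_add DERIV_cmult DERIV_const) (simp add: I.X_def I.Y_def)
  then show "((\<lambda>t. I.U (a(k := t)) j) has_real_derivative (- 1) ^ (n + k) * x 0 k a * y j k a) (at (a k) within I.slice a k)"
    using x_val[OF k ak, of 0] y_val[OF k, of j] by (simp add: I.U_def power_add mult_ac)
  show "mb_u m n \<alpha> p j (a(k := t)) = I.U (a(k := t)) j" if "a(k := t) \<in> I.E" for t by (rule mb_u_eq[OF that])
qed

lemma partial_v:
  fixes k :: nat
  assumes k: "k \<in> {1..2 * p}" and ak: "0 < a k \<or> s = 0"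
  shows "has_partial p (mb_v m n \<alpha> p j) k ((- 1) ^ (n + k) * x j k a * y (N - 1) k a) a"
proof (rule has_partialI[OF k])
  have "((\<lambda>t. (- 1) ^ n * (\<integral>y. f j (cl y) * I.Y (a(k := t)) (N - 1) y \<partial>mb_measure s p (a(k := t)))) has_real_derivative
      (- 1) ^ n * ((- 1) ^ k * (wt s (a k) * (I.X a j (a k) * I.Y a (N - 1) (a k))))) (at (a k) within I.slice a k)"
    using I.bilinear_partial_tr[OF aE k ak G_bcont[of "N - 1"] F_bcont[of j]]
    by (intro DERIV_cmult) (simp add: I.X_def I.Y_def)
  then show "((\<lambda>t. I.V (a(k := t)) j) has_real_derivative (- 1) ^ (n + k) * x j k a * y (N - 1) k a) (at (a k) within I.slice a k)"
    using x_val[OF k ak, of j] y_val[OF k, of "N - 1"] by (simp add: I.V_def power_add mult_ac)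
  show "mb_v m n \<alpha> p j (a(k := t)) = I.V (a(k := t)) j" if "a(k := t) \<in> I.E" for t by (rule mb_v_eq[OF that])
qed

end

end

theorem proposition1p2:
  fixes m n p :: nat and \<alpha> :: real and a :: "nat \<Rightarrow> real"
    and x y :: "nat \<Rightarrow> nat \<Rightarrow> (nat \<Rightarrow> real) \<Rightarrow> real"
    and u v :: "nat \<Rightarrow> (nat \<Rightarrow> real) \<Rightarrow> real"
  assumes "m \<ge> 1" and "n \<ge> 1" and "coprime m n"
    and "\<alpha> > real m - 1 - real m / real n"
    and "p \<ge> 1"
    and invertible: "\<forall>a'\<in>endpoints p.
           id_minus_op_invertible (mb_K m n \<alpha>) (mb_J p a') \<and>
           id_minus_op_invertible (\<lambda>y x. mb_K m n \<alpha> x y) (mb_J p a')"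
    and "x = mb_x m n \<alpha> p" and "y = mb_y m n \<alpha> p"
    and "u = mb_u m n \<alpha> p" and "v = mb_v m n \<alpha> p"
    and "a \<in> endpoints p"
  shows
    "(\<forall>k\<in>{1..2 * p}. \<forall>i\<in>{1..2 * p} - {k}. \<forall>j<m + n.
       x_finite_at m \<alpha> (a k) \<longrightarrow> x_finite_at m \<alpha> (a i) \<longrightarrow>
       has_partial p (x j k) i
         ((- 1) ^ i * (x j i a / (a k - a i)) * (\<Sum>l<m + n. x l k a * y l i a)) a)
     \<and> (\<forall>k\<in>{1..2 * p}. \<forall>i\<in>{1..2 * p} - {k}. \<forall>j<m + n.
       x_finite_at m \<alpha> (a i) \<longrightarrow>
       has_partial p (y j k) i
         ((- 1) ^ i * (y j i a / (a i - a k)) * (\<Sum>l<m + n. x l i a * y l k a)) a)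
     \<and> (\<forall>k\<in>{1..2 * p}. \<forall>j. j + 1 < m + n \<longrightarrow>
       x_finite_at m \<alpha> (a k) \<longrightarrow>
       has_euler_partial p (x j k) k
         (- v j a * x 0 k a - x (j + 1) k a
          - (\<Sum>i\<in>{1..2 * p} - {k}.
               (- 1) ^ i * (a i * x j i a / (a k - a i)) * (\<Sum>l<m + n. x l k a * y l i a))) a)
     \<and> (\<forall>k\<in>{1..2 * p}.
       x_finite_at m \<alpha> (a k) \<longrightarrow>
       has_euler_partial p (x (m + n - 1) k) k
         (((- 1) ^ (n + 1) * a k - v (m + n - 1) a) * x 0 k a + (\<Sum>i<m + n. u i a * x i k a)
          - (\<Sum>i\<in>{1..2 * p} - {k}.
               (- 1) ^ i * (a i * x (m + n - 1) i a / (a k - a i))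
                 * (\<Sum>l<m + n. x l k a * y l i a))) a)
     \<and> (\<forall>k\<in>{1..2 * p}. \<forall>j\<in>{1..m + n - 1}.
       has_euler_partial p (y j k) k
         (y (j - 1) k a - u j a * y (m + n - 1) k a
          - (\<Sum>i\<in>{1..2 * p} - {k}.
               (- 1) ^ i * (a i * y j i a / (a i - a k)) * (\<Sum>l<m + n. x l i a * y l k a))) a)
     \<and> (\<forall>k\<in>{1..2 * p}.
       has_euler_partial p (y 0 k) k
         ((\<Sum>i<m + n. v i a * y i k a) + ((- 1) ^ n * a k - u 0 a) * y (m + n - 1) k a
          - (\<Sum>i\<in>{1..2 * p} - {k}.
               (- 1) ^ i * (a i * y 0 i a / (a i - a k)) * (\<Sum>l<m + n. x l i a * y l k a))) a)
     \<and> (\<forall>k\<in>{1..2 * p}. \<forall>j<m + n.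
       x_finite_at m \<alpha> (a k) \<longrightarrow>
       has_partial p (u j) k ((- 1) ^ (n + k) * x 0 k a * y j k a) a \<and>
       has_partial p (v j) k ((- 1) ^ (n + k) * x j k a * y (m + n - 1) k a) a)"
proof -
  \<comment> \<open>Strictly above the last endpoint, which can therefore move upwards without
    reaching \<open>B\<close>.\<close>
  define B where "B = a (2 * p) + 1"
  interpret mb_system m n \<alpha> p B
  proof
    show "m \<ge> 1" "n \<ge> 1" "\<alpha> > real m - 1 - real m / real n" "p \<ge> 1" by fact+
    show "0 < B" using endpoints_nonneg[OF \<open>a \<in> endpoints p\<close>, of "2 * p"] \<open>p \<ge> 1\<close> by (simp add: B_def)
  qed (use invertible in auto)
  note a = \<open>a \<in> endpoints p\<close>
  have aB: "a (2 * p) < B" by (simp add: B_def)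
  note defs = \<open>x = mb_x m n \<alpha> p\<close> \<open>y = mb_y m n \<alpha> p\<close> \<open>u = mb_u m n \<alpha> p\<close> \<open>v = mb_v m n \<alpha> p\<close>
  note fin = x_finite[OF a aB]
  note E = aE[OF a aB]
  note cl [simp] = cl_a[OF a aB]
  note xv = x_val[OF a aB] and yv = y_val[OF a aB]
  have Xb: "I.X a j \<in> bcont" and Yb: "I.Y a j \<in> bcont" for j by (rule X_bcont[OF E], rule Y_bcont[OF E])
  have N1: "N - 1 < N" using m by simp
  have x1: "has_euler_partial p (mb_x m n \<alpha> p j k) k
         (- mb_v m n \<alpha> p j a * mb_x m n \<alpha> p 0 k a - mb_x m n \<alpha> p (j + 1) k a
          - (\<Sum>i\<in>{1..2 * p} - {k}.
               (- 1) ^ i * (a i * mb_x m n \<alpha> p j i a / (a k - a i)) * (\<Sum>l<N. mb_x m n \<alpha> p l k a * mb_y m n \<alpha> p l i a))) a"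
    if k: "k \<in> {1..2 * p}" and j: "j + 1 < N" and fk: "0 < a k \<or> s = 0" for j k
  proof -
    have "euler_deriv B (I.X a j) (\<lambda>x. s * I.X a j x + (- 1 * I.X a (j + 1) x - I.V a j * I.X a 0 x) - I.edge a x (I.X a j))"
      using I.X_euler[OF E j] by (simp add: algebra_simps)
    from euler_partial_x[OF a aB k fk _ this]
    have "has_euler_partial p (mb_x m n \<alpha> p j k) k
         (wt s (a k) * (- 1 * I.X a (j + 1) (a k) - I.V a j * I.X a 0 (a k))
          - (\<Sum>i\<in>{1..2 * p} - {k}.
               (- 1) ^ i * (a i * mb_x m n \<alpha> p j i a / (a k - a i)) * (\<Sum>l<N. mb_x m n \<alpha> p l k a * mb_y m n \<alpha> p l i a))) a"
      by (simp only: bcont_diff bcont_cmult Xb)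
    moreover have "wt s (a k) * (- 1 * I.X a (j + 1) (a k) - I.V a j * I.X a 0 (a k)) =
        - mb_v m n \<alpha> p j a * mb_x m n \<alpha> p 0 k a - mb_x m n \<alpha> p (j + 1) k a"
      by (simp add: xv[OF k fk] mb_v_eq[OF E] algebra_simps)
    ultimately show ?thesis by (simp only:)
  qed
  have x2: "has_euler_partial p (mb_x m n \<alpha> p (N - 1) k) k
         (((- 1) ^ (n + 1) * a k - mb_v m n \<alpha> p (N - 1) a) * mb_x m n \<alpha> p 0 k a + (\<Sum>i<N. mb_u m n \<alpha> p i a * mb_x m n \<alpha> p i k a)
          - (\<Sum>i\<in>{1..2 * p} - {k}.
               (- 1) ^ i * (a i * mb_x m n \<alpha> p (N - 1) i a / (a k - a i)) * (\<Sum>l<N. mb_x m n \<alpha> p l k a * mb_y m n \<alpha> p l i a))) a"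
    if k: "k \<in> {1..2 * p}" and fk: "0 < a k \<or> s = 0" for k
  proof -
    let ?T = "\<lambda>x. ((- 1) ^ (n + 1) * cl x - I.V a (N - 1)) * I.X a 0 x + (\<Sum>i<N. I.U a i * I.X a i x)"
    have T: "?T \<in> bcont"
      by (intro bcont_add bcont_mult bcont_diff bcont_cmult bcont_const bcont_sum Xb I.clamp0_bcont)
    have "euler_deriv B (I.X a (N - 1)) (\<lambda>x. s * I.X a (N - 1) x + ?T x - I.edge a x (I.X a (N - 1)))"
      using I.X_euler_last[OF E] by (simp only: add.assoc)
    from euler_partial_x[OF a aB k fk T this]
    have "has_euler_partial p (mb_x m n \<alpha> p (N - 1) k) k (wt s (a k) * ?T (a k)
          - (\<Sum>i\<in>{1..2 * p} - {k}.
               (- 1) ^ i * (a i * mb_x m n \<alpha> p (N - 1) i a / (a k - a i)) * (\<Sum>l<N. mb_x m n \<alpha> p l k a * mb_y m n \<alpha> p l i a))) a" .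
    moreover have "wt s (a k) * ?T (a k) = ((- 1) ^ (n + 1) * a k - mb_v m n \<alpha> p (N - 1) a) * mb_x m n \<alpha> p 0 k a
        + (\<Sum>i<N. mb_u m n \<alpha> p i a * mb_x m n \<alpha> p i k a)"
      using k by (simp add: xv[OF k fk] mb_v_eq[OF E] mb_u_eq[OF E] distrib_left sum_distrib_left mult_ac)
    ultimately show ?thesis by (simp only:)
  qed
  have y1: "has_euler_partial p (mb_y m n \<alpha> p j k) k
         (mb_y m n \<alpha> p (j - 1) k a - mb_u m n \<alpha> p j a * mb_y m n \<alpha> p (N - 1) k a
          - (\<Sum>i\<in>{1..2 * p} - {k}.
               (- 1) ^ i * (a i * mb_y m n \<alpha> p j i a / (a i - a k)) * (\<Sum>l<N. mb_x m n \<alpha> p l i a * mb_y m n \<alpha> p l k a))) a"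
    if k: "k \<in> {1..2 * p}" and j: "j \<in> {1..N - 1}" for j k
  proof -
    have j': "1 \<le> j" "j < N" using j N1 by auto
    have "(\<lambda>y. I.Y a (j - 1) y - I.U a j * I.Y a (N - 1) y) \<in> bcont" by (intro bcont_diff bcont_cmult Yb)
    from euler_partial_y[OF a aB k this I.Y_euler[OF E j']]
    show ?thesis by (simp only: yv[OF k] mb_u_eq[OF E])
  qed
  have y2: "has_euler_partial p (mb_y m n \<alpha> p 0 k) k
         ((\<Sum>i<N. mb_v m n \<alpha> p i a * mb_y m n \<alpha> p i k a) + ((- 1) ^ n * a k - mb_u m n \<alpha> p 0 a) * mb_y m n \<alpha> p (N - 1) k a
          - (\<Sum>i\<in>{1..2 * p} - {k}.
               (- 1) ^ i * (a i * mb_y m n \<alpha> p 0 i a / (a i - a k)) * (\<Sum>l<N. mb_x m n \<alpha> p l i a * mb_y m n \<alpha> p l k a))) a"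
    if k: "k \<in> {1..2 * p}" for k
  proof -
    have "(\<lambda>y. (\<Sum>i<N. I.V a i * I.Y a i y) + ((- 1) ^ n * cl y - I.U a 0) * I.Y a (N - 1) y) \<in> bcont"
      by (intro bcont_add bcont_mult bcont_diff bcont_cmult bcont_const bcont_sum Yb I.clamp0_bcont)
    from euler_partial_y[OF a aB k this I.Y_euler_0[OF E]]
    show ?thesis by (simp only: yv[OF k] mb_u_eq[OF E] mb_v_eq[OF E] cl[OF k])
  qed
  show ?thesis
    unfolding defs fin
    using partial_x[OF a aB] partial_y[OF a aB] x1 x2 y1 y2 partial_u[OF a aB] partial_v[OF a aB]
    by (intro conjI ballI allI impI) blast+
qed

end
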